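(* Let $S$ be an inverse semigroup with set of idempotents $E$, and regard $\ell^{1}(S)$ as a Banach $\ell^{1}(E)$-module with the trivial left action and the natural right action, i.e. $\delta_e.\delta_s=\delta_s$ and $\delta_s.\delta_e=\delta_{se}$ for $s\in S$, $e\in E$. Then for every $n\in\mathbb{N}$, $\ell^{1}(S)$ is $2n$-weakly module amenable as an $\ell^{1}(E)$-module; that is, $(\ell^{1}(S)/J)^{(2n)}$ is a commutative Banach $\ell^1(S)$-$\ell^1(E)$-module and every continuous module derivation $D:\ell^{1}(S)\to(\ell^{1}(S)/J)^{(2n)}$ is inner: there exists $\Phi\in(\ell^{1}(S)/J)^{(2n)}$ with $D(f)=f\Phi-\Phi f$ for all $f\in\ell^{1}(S)$.
   Context: An inverse semigroup is a semigroup $S$ such that for each $s\in S$ there is a unique $s^{*}\in S$ with $ss^{*}s=s$ and $s^{*}ss^{*}=s^{*}$; $E$ denotes its set of idempotents (every element of $E$ has the form $ss^*$, and $E$ is a commutative subsemigroup). $\ell^1(S)$ is the convolution algebra with $\delta_s*\delta_t=\delta_{st}$; $\ell^1(E)\subseteq\ell^1(S)$. The actions of $\ell^1(E)$ on $\ell^1(S)$ are the continuous bilinear extensions of $\delta_e.\delta_s=\delta_s$, $\delta_s.\delta_e=\delta_{se}$. $J$ is the closed ideal of $\ell^1(S)$ generated by elements $(a.\alpha)b-a(\alpha.b)$ ($a,b\in\ell^1(S)$, $\alpha\in\ell^1(E)$); here $J$ is the closed linear span of $\{\delta_{set}-\delta_{st}: s,t\in S, e\in E\}$. The quotient $\ell^1(S)/J$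 is a Banach algebra and an $\ell^1(E)$-bimodule via $\alpha.(a+J)=\alpha.a+J$, $(a+J).\alpha=a.\alpha+J$, and an $\ell^1(S)$-bimodule via $a(b+J)=ab+J$, $(b+J)a=ba+J$. For a Banach bimodule $X$, its dual $X^*$ carries the actions $\langle x,af\rangle=\langle xa,f\rangle$, $\langle x,fa\rangle=\langle ax,f\rangle$ (for both algebras); $X^{(0)}=X$, $X^{(n)}=(X^{(n-1)})^*$. A module $X$ over $\ell^1(E)$ is commutative if $\alpha.x=x.\alpha$ for all $\alpha,x$. A module derivation $D:\ell^1(S)\to X$ is a bounded map with $D(a\pm b)=D(a)\pm D(b)$, $D(ab)=aD(b)+D(a)b$, $D(\alpha.a)=\alpha.D(a)$, $D(a.\alpha)=D(a).\alpha$ for $a,b\in\ell^1(S)$, $\alpha\in\ell^1(E)$. $\ell^1(S)$ is called $n$-weakly module amenable if $(\ell^1(S)/J)^{(n)}$ is a commutative $\ell^1(E)$-module and every continuous module derivation $\ell^1(S)\to(\ell^1(S)/J)^{(n)}$ is inner, i.e. of the form $a\mapsto a\Phi-\Phi a$ for some $\Phi$. *)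

theory Defs
  imports "HOL-Analysis.Analysis"
begin

definition inverse_semigroup :: "'s::semigroup_mult itself \<Rightarrow> bool" where
  "inverse_semigroup _ \<longleftrightarrow> (\<forall>s::'s. \<exists>!t. s * t * s = s \<and> t * s * t = t)"

definition idems :: "'s::semigroup_mult set" where
  "idems = {e. e * e = e}"

definition delta :: "'s \<Rightarrow> 's \<Rightarrow> complex" where
  "delta s = (\<lambda>u. if u = s then 1 else 0)"

definition l1 :: "('s \<Rightarrow> complex) set" where
  "l1 = {f. (\<lambda>s. norm (f s)) summable_on UNIV}"

definition l1norm :: "('s \<Rightarrow> complex) \<Rightarrow> real" where
  "l1norm f = infsum (\<lambda>s. norm (f s)) UNIV"

definition conv :: "('s::semigroup_mult \<Rightarrow> complex) \<Rightarrow> ('s \<Rightarrow> complex) \<Rightarrow> 's \<Rightarrow> complex" where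
  "conv f g = (\<lambda>u. infsum (\<lambda>(s, t). f s * g t) {(s, t). s * t = u})"

definition l1E :: "('s::semigroup_mult \<Rightarrow> complex) set" where
  "l1E = {\<alpha> \<in> l1. \<forall>s. s \<notin> idems \<longrightarrow> \<alpha> s = 0}"

text \<open>Trivial left action (delta e . delta s = delta s) and natural right action
  (delta s . delta e = delta (s e)), extended bilinearly and continuously.\<close>
definition Eact_l :: "('s \<Rightarrow> complex) \<Rightarrow> ('s \<Rightarrow> complex) \<Rightarrow> 's \<Rightarrow> complex" where
  "Eact_l \<alpha> f = (\<lambda>u. infsum \<alpha> UNIV * f u)"

definition Eact_r :: "('s::semigroup_mult \<Rightarrow> complex) \<Rightarrow> ('s \<Rightarrow> complex) \<Rightarrow> 's \<Rightarrow> complex" where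
  "Eact_r f \<alpha> = conv f \<alpha>"

definition Jspan :: "('s::semigroup_mult \<Rightarrow> complex) set" where
  "Jspan = {f. \<exists>(m::nat) c s e t. (\<forall>i<m. e i \<in> idems) \<and>
      f = (\<lambda>u. \<Sum>i<m. c i * (delta (s i * e i * t i) u - delta (s i * t i) u))}"

definition Jideal :: "('s::semigroup_mult \<Rightarrow> complex) set" where
  "Jideal = {f \<in> l1. \<forall>\<epsilon>>0. \<exists>g\<in>Jspan. l1norm (\<lambda>u. f u - g u) < \<epsilon>}"

definition bfun :: "'v::ab_group_add set \<Rightarrow> (complex \<Rightarrow> 'v \<Rightarrow> 'v) \<Rightarrow> ('v \<Rightarrow> real)
    \<Rightarrow> ('v \<Rightarrow> complex) \<Rightarrow> bool" where
  "bfun X sm nv l \<longleftrightarrow>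
     (\<forall>x\<in>X. \<forall>y\<in>X. l (x + y) = l x + l y) \<and>
     (\<forall>c. \<forall>x\<in>X. l (sm c x) = c * l x) \<and>
     (\<exists>C. \<forall>x\<in>X. norm (l x) \<le> C * nv x)"

text \<open>dual_tower N q sm V pr nv: V 0 (with quotient map q, scalar multiplication sm and
  norm nv 0) is (an isometric copy of) the Banach space l1(S)/J with the quotient norm,
  and for k < N, V (Suc k) with the pairing pr k (pr k phi x = <x, phi>) and norm
  nv (Suc k) is (an isometric copy of) the dual of V k.  Thus V k realises X^(k).\<close>
definition dual_tower :: "nat \<Rightarrow> (('s::semigroup_mult \<Rightarrow> complex) \<Rightarrow> 'v::ab_group_add)
    \<Rightarrow> (complex \<Rightarrow> 'v \<Rightarrow> 'v) \<Rightarrow> (nat \<Rightarrow> 'v set) \<Rightarrow> (nat \<Rightarrow> 'v \<Rightarrow> 'v \<Rightarrow> complex)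
    \<Rightarrow> (nat \<Rightarrow> 'v \<Rightarrow> real) \<Rightarrow> bool" where
  "dual_tower N q sm V pr nv \<longleftrightarrow>
     (\<forall>f\<in>l1. q f \<in> V 0) \<and> (\<forall>x\<in>V 0. \<exists>f\<in>l1. q f = x) \<and>
     (\<forall>f\<in>l1. \<forall>g\<in>l1. q f = q g \<longleftrightarrow> (\<lambda>u. f u - g u) \<in> Jideal) \<and>
     (\<forall>f\<in>l1. \<forall>g\<in>l1. q (\<lambda>u. f u + g u) = q f + q g) \<and>
     (\<forall>c. \<forall>f\<in>l1. q (\<lambda>u. c * f u) = sm c (q f)) \<and>
     (\<forall>f\<in>l1. nv 0 (q f) = Inf {l1norm (\<lambda>u. f u + j u) | j. j \<in> Jideal}) \<and>
     (\<forall>k\<le>N. \<forall>x\<in>V k. \<forall>y\<in>V k. x + y \<in> V k \<and> (\<forall>c. sm c x \<in> V k)) \<and>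
     (\<forall>k<N.
        (\<forall>\<phi>\<in>V (Suc k). bfun (V k) sm (nv k) (pr k \<phi>)) \<and>
        (\<forall>l. bfun (V k) sm (nv k) l \<longrightarrow> (\<exists>!\<phi>. \<phi> \<in> V (Suc k) \<and> (\<forall>x\<in>V k. pr k \<phi> x = l x))) \<and>
        (\<forall>\<phi>\<in>V (Suc k). \<forall>\<psi>\<in>V (Suc k). \<forall>x\<in>V k. pr k (\<phi> + \<psi>) x = pr k \<phi> x + pr k \<psi> x) \<and>
        (\<forall>c. \<forall>\<phi>\<in>V (Suc k). \<forall>x\<in>V k. pr k (sm c \<phi>) x = c * pr k \<phi> x) \<and>
        (\<forall>\<phi>\<in>V (Suc k). nv (Suc k) \<phi> = Sup {norm (pr k \<phi> x) | x. x \<in> V k \<and> nv k x \<le> 1}))"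

text \<open>Module actions on the tower, given the actions L, R of an algebra on l1(S)
  (which descend to l1(S)/J).  On duals: <x, a phi> = <x a, phi>, <x, phi a> = <a x, phi>.\<close>
fun tact_l :: "('a \<Rightarrow> ('s \<Rightarrow> complex) \<Rightarrow> ('s \<Rightarrow> complex)) \<Rightarrow> (('s \<Rightarrow> complex) \<Rightarrow> 'a \<Rightarrow> ('s \<Rightarrow> complex))
    \<Rightarrow> (('s \<Rightarrow> complex) \<Rightarrow> 'v) \<Rightarrow> (nat \<Rightarrow> 'v set) \<Rightarrow> (nat \<Rightarrow> 'v \<Rightarrow> 'v \<Rightarrow> complex)
    \<Rightarrow> nat \<Rightarrow> 'a \<Rightarrow> 'v \<Rightarrow> 'v"
and tact_r :: "('a \<Rightarrow> ('s \<Rightarrow> complex) \<Rightarrow> ('s \<Rightarrow> complex)) \<Rightarrow> (('s \<Rightarrow> complex) \<Rightarrow> 'a \<Rightarrow> ('s \<Rightarrow> complex))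
    \<Rightarrow> (('s \<Rightarrow> complex) \<Rightarrow> 'v) \<Rightarrow> (nat \<Rightarrow> 'v set) \<Rightarrow> (nat \<Rightarrow> 'v \<Rightarrow> 'v \<Rightarrow> complex)
    \<Rightarrow> nat \<Rightarrow> 'v \<Rightarrow> 'a \<Rightarrow> 'v" where
  "tact_l L R q V pr 0 a x = q (L a (SOME b. b \<in> l1 \<and> q b = x))"
| "tact_l L R q V pr (Suc k) a \<phi> =
     (THE \<psi>. \<psi> \<in> V (Suc k) \<and> (\<forall>x\<in>V k. pr k \<psi> x = pr k \<phi> (tact_r L R q V pr k x a)))"
| "tact_r L R q V pr 0 x a = q (R (SOME b. b \<in> l1 \<and> q b = x) a)"
| "tact_r L R q V pr (Suc k) \<phi> a =
     (THE \<psi>. \<psi> \<in> V (Suc k) \<and> (\<forall>x\<in>V k. pr k \<psi> x = pr k \<phi> (tact_l L R q V pr k a x)))"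

abbreviation "Sl q V pr m \<equiv> tact_l conv conv q V pr m"
abbreviation "Sr q V pr m \<equiv> tact_r conv conv q V pr m"
abbreviation "El q V pr m \<equiv> tact_l Eact_l Eact_r q V pr m"
abbreviation "Er q V pr m \<equiv> tact_r Eact_l Eact_r q V pr m"

definition commutative_Emod :: "(('s::semigroup_mult \<Rightarrow> complex) \<Rightarrow> 'v) \<Rightarrow> (nat \<Rightarrow> 'v set)
    \<Rightarrow> (nat \<Rightarrow> 'v \<Rightarrow> 'v \<Rightarrow> complex) \<Rightarrow> nat \<Rightarrow> bool" where
  "commutative_Emod q V pr m \<longleftrightarrow>
     (\<forall>\<alpha>\<in>l1E. \<forall>x\<in>V m. El q V pr m \<alpha> x = Er q V pr m x \<alpha>)"

definition module_derivation :: "(('s::semigroup_mult \<Rightarrow> complex) \<Rightarrow> 'v::ab_group_add)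
    \<Rightarrow> (nat \<Rightarrow> 'v set) \<Rightarrow> (nat \<Rightarrow> 'v \<Rightarrow> 'v \<Rightarrow> complex) \<Rightarrow> (nat \<Rightarrow> 'v \<Rightarrow> real) \<Rightarrow> nat
    \<Rightarrow> (('s \<Rightarrow> complex) \<Rightarrow> 'v) \<Rightarrow> bool" where
  "module_derivation q V pr nv m D \<longleftrightarrow>
     (\<forall>a\<in>l1. D a \<in> V m) \<and>
     (\<forall>a\<in>l1. \<forall>b\<in>l1. D (\<lambda>u. a u + b u) = D a + D b \<and> D (\<lambda>u. a u - b u) = D a - D b) \<and>
     (\<forall>a\<in>l1. \<forall>b\<in>l1. D (conv a b) = Sl q V pr m a (D b) + Sr q V pr m (D a) b) \<and>
     (\<forall>\<alpha>\<in>l1E. \<forall>a\<in>l1. D (Eact_l \<alpha> a) = El q V pr m \<alpha> (D a) \<and>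
                        D (Eact_r a \<alpha>) = Er q V pr m (D a) \<alpha>) \<and>
     (\<exists>C. \<forall>a\<in>l1. nv m (D a) \<le> C * l1norm a)"

definition inner_derivation :: "(('s::semigroup_mult \<Rightarrow> complex) \<Rightarrow> 'v::ab_group_add)
    \<Rightarrow> (nat \<Rightarrow> 'v set) \<Rightarrow> (nat \<Rightarrow> 'v \<Rightarrow> 'v \<Rightarrow> complex) \<Rightarrow> nat
    \<Rightarrow> (('s \<Rightarrow> complex) \<Rightarrow> 'v) \<Rightarrow> bool" where
  "inner_derivation q V pr m D \<longleftrightarrow>
     (\<exists>\<Phi>\<in>V m. \<forall>f\<in>l1. D f = Sl q V pr m f \<Phi> - Sr q V pr m \<Phi> f)"

definition weakly_module_amenable :: "nat \<Rightarrow> (('s::semigroup_mult \<Rightarrow> complex) \<Rightarrow> 'v::ab_group_add)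
    \<Rightarrow> (nat \<Rightarrow> 'v set) \<Rightarrow> (nat \<Rightarrow> 'v \<Rightarrow> 'v \<Rightarrow> complex) \<Rightarrow> (nat \<Rightarrow> 'v \<Rightarrow> real) \<Rightarrow> bool" where
  "weakly_module_amenable m q V pr nv \<longleftrightarrow>
     commutative_Emod q V pr m \<and>
     (\<forall>D. module_derivation q V pr nv m D \<longrightarrow> inner_derivation q V pr m D)"

end

theory Submission
  imports Defs "HOL-Library.Function_Algebras"
begin

text \<open>
  The quotient \<open>\<ell>\<^sup>1(S)/J\<close> is the group algebra \<open>\<ell>\<^sup>1(G)\<close> of the maximal group image \<open>G\<close> of \<open>S\<close>, on which the
  idempotents act trivially.  A module derivation \<open>D\<close> yields the bounded cocycle
  \<open>c g = D(\<delta>\<^sub>g) \<cdot> \<delta>\<^sub>g\<^sub>*\<close> for the conjugation action on \<open>\<ell>\<^sup>1(G)\<^sup>(\<^sup>2\<^sup>n\<^sup>)\<close>, and \<open>D\<close> is inner iff the affine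
  isometries \<open>y \<mapsto> \<delta>\<^sub>g y \<delta>\<^sub>g\<^sub>* + c g\<close> have a common fixed point.

  On \<open>\<ell>\<^sup>1\<close> the norm distance is of negative type, \<open>\<parallel>x - y\<parallel>\<close> being the squared distance of the indicator
  functions of the subgraphs.  A finite family of orbit points almost maximising the mean mutual distance
  therefore has an almost invariant barycentre \<open>h\<close> among functions on \<open>G \<times> \<real>\<close>; applying \<open>3 h\<^sup>2 - 2 h\<^sup>3\<close>
  brings it back to an almost fixed element of \<open>\<ell>\<^sup>1\<close>, which is just the mean of the pointwise medians of all
  triples of the family.  The resulting estimate only involves norms of finitely many linear expressions, so by
  Helly's lemma and weak-* compactness it is inherited by biduals.  A last weak-* compactness argument turns
  almost fixed points into a fixed point.
\<close>

section \<open>Additive functionals below sublinear ones\<close>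

definition add_subgroup :: "'a::ab_group_add set \<Rightarrow> bool" where
  "add_subgroup U \<longleftrightarrow> 0 \<in> U \<and> (\<forall>x\<in>U. \<forall>y\<in>U. x + y \<in> U) \<and> (\<forall>x\<in>U. - x \<in> U)"

lemma
  assumes "add_subgroup U"
  shows add_subgroup_zero: "0 \<in> U"
    and add_subgroup_add: "x \<in> U \<Longrightarrow> y \<in> U \<Longrightarrow> x + y \<in> U"
    and add_subgroup_minus: "x \<in> U \<Longrightarrow> - x \<in> U"
  using assms by (auto simp: add_subgroup_def)

lemma add_subgroup_diff: "add_subgroup U \<Longrightarrow> x \<in> U \<Longrightarrow> y \<in> U \<Longrightarrow> x - y \<in> U"
  using add_subgroup_add[of U x "- y"] add_subgroup_minus by auto

lemma add_subgroup_sum: "add_subgroup U \<Longrightarrow> (\<And>a. a \<in> A \<Longrightarrow> h a \<in> U) \<Longrightarrow> (\<Sum>a\<in>A. h a) \<in> U"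
  by (induction A rule: infinite_finite_induct) (auto intro: add_subgroup_zero add_subgroup_add)

definition additive_on :: "'a::ab_group_add set \<Rightarrow> ('a \<Rightarrow> 'b::ab_group_add) \<Rightarrow> bool" where
  "additive_on U g \<longleftrightarrow> (\<forall>x\<in>U. \<forall>y\<in>U. g (x + y) = g x + g y)"

lemma additive_on_add: "additive_on U g \<Longrightarrow> x \<in> U \<Longrightarrow> y \<in> U \<Longrightarrow> g (x + y) = g x + g y"
  by (simp add: additive_on_def)

lemma additive_on_zero: "additive_on U g \<Longrightarrow> add_subgroup U \<Longrightarrow> g 0 = 0"
  using additive_on_add[of U g 0 0] add_subgroup_zero[of U] by simp

lemma additive_on_minus: "additive_on U g \<Longrightarrow> add_subgroup U \<Longrightarrow> x \<in> U \<Longrightarrow> g (- x) = - g x"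
  using additive_on_add[of U g x "- x"] additive_on_zero[of U g] add_subgroup_minus[of U x]
  by (simp add: eq_neg_iff_add_eq_0 add.commute)

lemma additive_on_diff:
  "additive_on U g \<Longrightarrow> add_subgroup U \<Longrightarrow> x \<in> U \<Longrightarrow> y \<in> U \<Longrightarrow> g (x - y) = g x - g y"
  using additive_on_add[of U g x "- y"] additive_on_minus[of U g y] add_subgroup_minus[of U y] by simp

lemma additive_on_sum:
  assumes "additive_on U g" "add_subgroup U" "\<And>a. a \<in> A \<Longrightarrow> h a \<in> U"
  shows "g (\<Sum>a\<in>A. h a) = (\<Sum>a\<in>A. g (h a))"
  using assms(3)
proof (induction A rule: infinite_finite_induct)
  case (insert a A)
  then show ?case using assms(1,2) by (simp add: additive_on_add add_subgroup_sum)
qed (simp_all add: additive_on_zero[OF assms(1,2)])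

lemma add_subgroup_image:
  assumes A: "add_subgroup A" and f: "additive_on A f"
  shows "add_subgroup (f ` A)"
  unfolding add_subgroup_def
proof (intro conjI ballI)
  show "0 \<in> f ` A" using imageI[OF add_subgroup_zero[OF A], of f] additive_on_zero[OF f A] by simp
  fix a assume "a \<in> f ` A"
  then obtain x where x: "x \<in> A" "a = f x" by blast
  show "- a \<in> f ` A" using imageI[OF add_subgroup_minus[OF A x(1)], of f] additive_on_minus[OF f A] x by simp
  fix b assume "b \<in> f ` A"
  then obtain y where y: "y \<in> A" "b = f y" by blast
  show "a + b \<in> f ` A" using imageI[OF add_subgroup_add[OF A x(1) y(1)], of f] additive_on_add[OF f] x y by simp
qed

text \<open>Positive homogeneity is only required for the factor \<open>2\<close>: the Hahn--Banach theorem below then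
  holds for subgroups of abelian groups, and no scalar multiplication is needed.\<close>

definition sublinear_on :: "'a::ab_group_add set \<Rightarrow> ('a \<Rightarrow> real) \<Rightarrow> bool" where
  "sublinear_on U p \<longleftrightarrow> add_subgroup U \<and> (\<forall>x\<in>U. \<forall>y\<in>U. p (x + y) \<le> p x + p y) \<and>
     (\<forall>x\<in>U. p (x + x) = 2 * p x)"

lemma
  assumes "sublinear_on U p"
  shows sublinear_on_subgroup: "add_subgroup U"
    and sublinear_on_add: "x \<in> U \<Longrightarrow> y \<in> U \<Longrightarrow> p (x + y) \<le> p x + p y"
    and sublinear_on_double: "x \<in> U \<Longrightarrow> p (x + x) = 2 * p x"
  using assms by (auto simp: sublinear_on_def)

lemma sublinear_on_zero: "sublinear_on U p \<Longrightarrow> p 0 = 0"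
  using sublinear_on_double[of U p 0] sublinear_on_subgroup add_subgroup_zero by auto

lemma sublinear_on_minus_le: "sublinear_on U p \<Longrightarrow> x \<in> U \<Longrightarrow> - p (- x) \<le> p x"
  using sublinear_on_add[of U p x "- x"] sublinear_on_zero[of U p] sublinear_on_subgroup[of U p]
  by (simp add: add_subgroup_minus)

lemma sublinear_on_INF:
  fixes f :: "'i \<Rightarrow> 'a::ab_group_add \<Rightarrow> real"
  assumes U: "add_subgroup U" and I: "I \<noteq> {}"
    and lower: "\<And>i x. i \<in> I \<Longrightarrow> x \<in> U \<Longrightarrow> b x \<le> f i x"
    and add: "\<And>i j x y. i \<in> I \<Longrightarrow> j \<in> I \<Longrightarrow> x \<in> U \<Longrightarrow> y \<in> U \<Longrightarrow> \<exists>k\<in>I. f k (x + y) \<le> f i x + f j y"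
    and double: "\<And>i x. i \<in> I \<Longrightarrow> x \<in> U \<Longrightarrow> \<exists>k\<in>I. 2 * f k x \<le> f i (x + x)"
  shows "sublinear_on U (\<lambda>x. INF i\<in>I. f i x)"
proof -
  let ?p = "\<lambda>x. INF i\<in>I. f i x"
  have INF_le: "?p x \<le> f i x" if "i \<in> I" "x \<in> U" for i x
    using that lower by (intro cINF_lower) (auto intro!: bdd_belowI2)
  have subadditive: "?p (x + y) \<le> ?p x + ?p y" if xy: "x \<in> U" "y \<in> U" for x y
  proof -
    have "?p (x + y) \<le> f i x + f j y" if ij: "i \<in> I" "j \<in> I" for i j
      using add[OF ij xy] INF_le add_subgroup_add[OF U xy] by (meson order_trans)
    then have "?p (x + y) - f j y \<le> ?p x" if "j \<in> I" for j
      using I that by (intro cINF_greatest) (auto simp: algebra_simps)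
    then have "?p (x + y) - ?p x \<le> ?p y"
      using I by (intro cINF_greatest) (auto simp: algebra_simps)
    then show ?thesis by simp
  qed
  have "2 * ?p x \<le> ?p (x + x)" if x: "x \<in> U" for x
  proof (intro cINF_greatest I)
    fix i assume "i \<in> I"
    then obtain k where "k \<in> I" "2 * f k x \<le> f i (x + x)" using double x by blast
    then show "2 * ?p x \<le> f i (x + x)" using INF_le[OF _ x] by fastforce
  qed
  then show ?thesis unfolding sublinear_on_def using U subadditive by (force intro: antisym)
qed

primrec nat_mult :: "nat \<Rightarrow> 'a::ab_group_add \<Rightarrow> 'a" where
  "nat_mult 0 x = 0"
| "nat_mult (Suc n) x = x + nat_mult n x"

lemma nat_mult_add: "nat_mult (m + n) x = nat_mult m x + nat_mult n x"
  by (induction m) (simp_all add: algebra_simps)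

lemma nat_mult_in: "add_subgroup U \<Longrightarrow> y \<in> U \<Longrightarrow> nat_mult n y \<in> U"
  by (induction n) (auto intro: add_subgroup_zero add_subgroup_add)

lemma sublinear_on_nat_mult:
  assumes p: "sublinear_on U p" and y: "y \<in> U"
  shows "p (nat_mult n y) = n * p y"
proof -
  note mult_in = nat_mult_in[OF sublinear_on_subgroup[OF p] y]
  have upper: "p (nat_mult n y) \<le> n * p y" for n
  proof (induction n)
    case 0
    show ?case using sublinear_on_zero[OF p] by simp
  next
    case (Suc n)
    then show ?case using sublinear_on_add[OF p y mult_in, of n] by (simp add: algebra_simps)
  qed
  have at_power: "p (nat_mult (2 ^ m) y) = 2 ^ m * p y" for m
  proof (induction m)
    case (Suc m)
    have "nat_mult (2 ^ Suc m) y = nat_mult (2 ^ m) y + nat_mult (2 ^ m) y"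
      by (simp add: nat_mult_add mult_2)
    then show ?case using Suc sublinear_on_double[OF p mult_in] by simp
  qed simp
  have "nat_mult (2 ^ n) y = nat_mult n y + nat_mult (2 ^ n - n) y"
    by (metis nat_mult_add le_add_diff_inverse less_exp order_less_imp_le)
  then have "p (nat_mult (2 ^ n) y) \<le> p (nat_mult n y) + p (nat_mult (2 ^ n - n) y)"
    using sublinear_on_add[OF p mult_in mult_in] by metis
  also have "\<dots> \<le> p (nat_mult n y) + (2 ^ n - n) * p y"
    using upper[of "2 ^ n - n"] less_exp[of n] by (simp add: of_nat_diff order_less_imp_le)
  finally show ?thesis using upper[of n] at_power[of n] by (simp add: algebra_simps)
qed

lemma sublinear_on_descend:
  assumes p: "sublinear_on U p" and y: "y \<in> U"
  obtains p' where "sublinear_on U p'" "\<And>x. x \<in> U \<Longrightarrow> p' x \<le> p x" "p' (- y) \<le> - p y"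
proof -
  note U = sublinear_on_subgroup[OF p]
  note in_U = nat_mult_in[OF U y] add_subgroup_add[OF U] add_subgroup_minus[OF U]
  note mult = sublinear_on_nat_mult[OF p y]
  define f where "f n x = p (x + nat_mult n y) - real n * p y" for n x
  have lower: "- p (- x) \<le> f n x" if x: "x \<in> U" for n x
    using sublinear_on_add[OF p, of "x + nat_mult n y" "- x"] mult[of n] x by (simp add: f_def in_U)
  have sublinear: "sublinear_on U (\<lambda>x. INF n. f n x)"
  proof (rule sublinear_on_INF[OF U])
    show "\<exists>k\<in>UNIV. f k (x + z) \<le> f m x + f n z" if "x \<in> U" "z \<in> U" for m n x z
      using sublinear_on_add[OF p, of "x + nat_mult m y" "z + nat_mult n y"] that
      by (intro bexI[of _ "m + n"]) (simp_all add: f_def in_U nat_mult_add algebra_simps)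
    show "\<exists>k\<in>UNIV. 2 * f k x \<le> f n (x + x)" if x: "x \<in> U" for n x
    proof
      have "2 * f n x = p ((x + x + nat_mult n y) + nat_mult n y) - 2 * n * p y"
        using sublinear_on_double[OF p, of "x + nat_mult n y"] x by (simp add: f_def in_U algebra_simps)
      also have "\<dots> \<le> f n (x + x)"
        using sublinear_on_add[OF p, of "x + x + nat_mult n y" "nat_mult n y"] mult[of n] x
        by (simp add: f_def in_U)
      finally show "2 * f n x \<le> f n (x + x)" .
    qed simp
  qed (use lower in auto)
  have INF_le: "(INF n. f n x) \<le> f n x" if "x \<in> U" for n x
    using lower that by (intro cINF_lower) (auto intro!: bdd_belowI2)
  show ?thesis
  proof (rule that[OF sublinear])
    show "(INF n. f n x) \<le> p x" if "x \<in> U" for x using INF_le[OF that, of 0] by (simp add: f_def)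
    show "(INF n. f n (- y)) \<le> - p y"
      using INF_le[of "- y" 1] y sublinear_on_zero[OF p] by (simp add: f_def in_U)
  qed
qed

lemma sublinear_on_chain_lower_bound:
  assumes p: "sublinear_on U p"
    and C: "\<And>q. q \<in> C \<Longrightarrow> sublinear_on U q" "\<And>q x. q \<in> C \<Longrightarrow> x \<in> U \<Longrightarrow> q x \<le> p x"
    and chain: "\<And>q r. q \<in> C \<Longrightarrow> r \<in> C \<Longrightarrow> (\<forall>x\<in>U. q x \<le> r x) \<or> (\<forall>x\<in>U. r x \<le> q x)"
  obtains s where "sublinear_on U s" "\<And>x. x \<in> U \<Longrightarrow> s x \<le> p x" "\<And>q x. q \<in> C \<Longrightarrow> x \<in> U \<Longrightarrow> s x \<le> q x"
proof (cases "C = {}")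
  case True
  then show ?thesis using that[OF p] by simp
next
  case False
  note U = sublinear_on_subgroup[OF p]
  have lower: "- p (- x) \<le> q x" if "q \<in> C" "x \<in> U" for q x
    using sublinear_on_minus_le[OF C(1)[OF that(1)] that(2)] C(2)[OF that(1), of "- x"]
      add_subgroup_minus[OF U that(2)] by linarith
  have "sublinear_on U (\<lambda>x. INF q\<in>C. q x)"
  proof (rule sublinear_on_INF[OF U False lower])
    fix q r x y assume qr: "q \<in> C" "r \<in> C" and xy: "x \<in> U" "y \<in> U"
    obtain s where "s \<in> C" "s x \<le> q x" "s y \<le> r y" using chain[OF qr] qr xy by blast
    with sublinear_on_add[OF C(1) xy, of s] show "\<exists>s\<in>C. s (x + y) \<le> q x + r y"
      by (intro bexI[of _ s]) linarith+
  next
    show "\<exists>r\<in>C. 2 * r x \<le> q (x + x)" if "q \<in> C" "x \<in> U" for q x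
      using sublinear_on_double[OF C(1)] that by force
  qed
  moreover have INF_le: "(INF q\<in>C. q x) \<le> q x" if "q \<in> C" "x \<in> U" for q x
    using that lower by (intro cINF_lower) (auto intro!: bdd_belowI2)
  moreover have "(INF q\<in>C. q x) \<le> p x" if "x \<in> U" for x
    using False INF_le[OF _ that] C(2)[OF _ that] by (meson all_not_in_conv order_trans)
  ultimately show ?thesis using that by blast
qed

lemma minimal_sublinear_on:
  assumes p: "sublinear_on U p"
  obtains m where "sublinear_on U m" "\<And>x. x \<in> U \<Longrightarrow> m x \<le> p x"
    "\<And>r x. sublinear_on U r \<Longrightarrow> (\<And>x. x \<in> U \<Longrightarrow> r x \<le> m x) \<Longrightarrow> x \<in> U \<Longrightarrow> r x = m x"
proof -
  note U = sublinear_on_subgroup[OF p]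
  define cut where "cut r x = (if x \<in> U then r x else 0)" for r :: "'a \<Rightarrow> real" and x
  have cut: "sublinear_on U (cut r) \<longleftrightarrow> sublinear_on U r" for r
    using U by (auto simp: cut_def sublinear_on_def add_subgroup_def)
  define \<A> where "\<A> = {r. sublinear_on U r \<and> (\<forall>x\<in>U. r x \<le> p x) \<and> cut r = r}"
  define below where "below = (\<lambda>r s :: 'a \<Rightarrow> real. \<forall>x\<in>U. s x \<le> r x)"
  have cut_in: "cut r \<in> \<A>" if "sublinear_on U r" "\<And>x. x \<in> U \<Longrightarrow> r x \<le> p x" for r
    unfolding \<A>_def using that cut by (auto simp: cut_def)
  have "\<exists>m\<in>\<A>. \<forall>r\<in>\<A>. below m r \<longrightarrow> r = m"
  proof (rule predicate_Zorn)
    show "partial_order_on \<A> (relation_of below \<A>)"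
    proof (rule partial_order_on_relation_ofI)
      show "r = s" if "r \<in> \<A>" "s \<in> \<A>" "below r s" "below s r" for r s
      proof -
        have "cut r = cut s" using that by (force simp: below_def cut_def intro: antisym)
        then show ?thesis using that by (simp add: \<A>_def)
      qed
    qed (auto simp: below_def intro: order_trans)
    show "\<exists>u\<in>\<A>. \<forall>r\<in>C. below r u" if C: "C \<in> Chains (relation_of below \<A>)" for C
    proof -
      have members: "\<And>r. r \<in> C \<Longrightarrow> sublinear_on U r" "\<And>r x. r \<in> C \<Longrightarrow> x \<in> U \<Longrightarrow> r x \<le> p x"
        using C by (auto simp: Chains_def relation_of_def \<A>_def)
      have chain: "(\<forall>x\<in>U. r x \<le> s x) \<or> (\<forall>x\<in>U. s x \<le> r x)" if "r \<in> C" "s \<in> C" for r s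
        using C that by (auto simp: Chains_def relation_of_def below_def)
      obtain s where s: "sublinear_on U s" "\<And>x. x \<in> U \<Longrightarrow> s x \<le> p x"
        and "\<And>r x. r \<in> C \<Longrightarrow> x \<in> U \<Longrightarrow> s x \<le> r x"
        using sublinear_on_chain_lower_bound[OF p, of C] members chain by blast
      then have "\<forall>r\<in>C. below r (cut s)" by (simp add: below_def cut_def)
      with cut_in[OF s] show ?thesis by blast
    qed
  qed
  then obtain m where m: "m \<in> \<A>" and minimal: "\<And>r. r \<in> \<A> \<Longrightarrow> below m r \<Longrightarrow> r = m" by auto
  show ?thesis
  proof
    show "sublinear_on U m" "\<And>x. x \<in> U \<Longrightarrow> m x \<le> p x" using m by (auto simp: \<A>_def)
    fix r x assume r: "sublinear_on U r" "\<And>x. x \<in> U \<Longrightarrow> r x \<le> m x" and x: "x \<in> U"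
    have "cut r \<in> \<A>" using r m by (intro cut_in) (force simp: \<A>_def)+
    moreover have "below m (cut r)" using r(2) by (simp add: below_def cut_def)
    ultimately have "cut r = m" by (rule minimal)
    then show "r x = m x" using x by (auto simp: cut_def)
  qed
qed

theorem Hahn_Banach_additive:
  assumes p: "sublinear_on U p" and y: "y \<in> U"
  obtains g where "additive_on U g" "\<And>x. x \<in> U \<Longrightarrow> g x \<le> p x" "g y = p y"
proof -
  note U = sublinear_on_subgroup[OF p]
  obtain p' where p': "sublinear_on U p'" "\<And>x. x \<in> U \<Longrightarrow> p' x \<le> p x" "p' (- y) \<le> - p y"
    using sublinear_on_descend[OF p y] by blast
  obtain m where m: "sublinear_on U m" "\<And>x. x \<in> U \<Longrightarrow> m x \<le> p' x"
    and minimal: "\<And>r x. sublinear_on U r \<Longrightarrow> (\<And>x. x \<in> U \<Longrightarrow> r x \<le> m x) \<Longrightarrow> x \<in> U \<Longrightarrow> r x = m x"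
    using minimal_sublinear_on[OF p'(1)] by blast
  have minus_le: "m (- x) \<le> - m x" if x: "x \<in> U" for x
    using sublinear_on_descend[OF m(1) x] minimal add_subgroup_minus[OF U x] by metis
  have additive: "additive_on U m"
    unfolding additive_on_def
  proof (intro ballI antisym)
    fix x z assume xz: "x \<in> U" "z \<in> U"
    show "m (x + z) \<le> m x + m z" by (rule sublinear_on_add[OF m(1) xz])
    have "m ((x + z) + - z) \<le> m (x + z) + m (- z)"
      by (rule sublinear_on_add[OF m(1) add_subgroup_add[OF U xz] add_subgroup_minus[OF U xz(2)]])
    then show "m x + m z \<le> m (x + z)" using minus_le[OF xz(2)] by simp
  qed
  have m_le: "m x \<le> p x" if "x \<in> U" for x using m(2)[OF that] p'(2)[OF that] by simp
  have "- m y \<le> - p y"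
    using m(2)[OF add_subgroup_minus[OF U y]] p'(3) additive_on_minus[OF additive U y] by simp
  then have "m y = p y" using m_le[OF y] by simp
  with additive m_le show ?thesis by (rule that)
qed

lemma separating_additive_functional:
  assumes p: "sublinear_on U p" and nonneg: "\<And>x. x \<in> U \<Longrightarrow> 0 \<le> p x"
    and A: "add_subgroup A" "A \<subseteq> U" and halves: "\<And>a. a \<in> A \<Longrightarrow> \<exists>h\<in>A. h + h = a"
    and y: "y \<in> U" and far: "\<And>a. a \<in> A \<Longrightarrow> r \<le> p (y - a)"
  obtains g where "additive_on U g" "\<And>x. x \<in> U \<Longrightarrow> g x \<le> p x" "\<And>a. a \<in> A \<Longrightarrow> g a = 0" "r \<le> g y"
proof -
  note U = sublinear_on_subgroup[OF p]
  have diff_in: "x - a \<in> U" if "a \<in> A" "x \<in> U" for a x using add_subgroup_diff[OF U] A(2) that by blast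
  let ?dist = "\<lambda>x. INF a\<in>A. p (x - a)"
  have sublinear: "sublinear_on U ?dist"
  proof (rule sublinear_on_INF[OF U, where b = "\<lambda>_. 0"])
    show "A \<noteq> {}" using add_subgroup_zero[OF A(1)] by blast
    show "0 \<le> p (x - a)" if "a \<in> A" "x \<in> U" for a x using nonneg diff_in that by blast
    show "\<exists>c\<in>A. p (x + z - c) \<le> p (x - a) + p (z - b)"
      if "a \<in> A" "b \<in> A" "x \<in> U" "z \<in> U" for a b x z
      using sublinear_on_add[OF p diff_in[OF that(1,3)] diff_in[OF that(2,4)]] add_subgroup_add[OF A(1) that(1,2)]
      by (intro bexI[of _ "a + b"]) (simp_all add: algebra_simps)
    show "\<exists>h\<in>A. 2 * p (x - h) \<le> p (x + x - a)" if ax: "a \<in> A" "x \<in> U" for a x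
    proof -
      obtain h where h: "h \<in> A" "h + h = a" using halves ax(1) by blast
      then have double_diff: "x + x - a = (x - h) + (x - h)" by (auto simp: algebra_simps)
      have "p (x + x - a) = 2 * p (x - h)"
        unfolding double_diff by (rule sublinear_on_double[OF p diff_in[OF h(1) ax(2)]])
      with h(1) show ?thesis by auto
    qed
  qed
  have dist_le: "?dist x \<le> p (x - a)" if "a \<in> A" "x \<in> U" for a x
    using that nonneg diff_in by (intro cINF_lower) (auto intro!: bdd_belowI2[of _ 0])
  obtain g where g: "additive_on U g" "\<And>x. x \<in> U \<Longrightarrow> g x \<le> ?dist x" "g y = ?dist y"
    using Hahn_Banach_additive[OF sublinear y] by blast
  show ?thesis
  proof (rule that[OF g(1)])
    show "g x \<le> p x" if "x \<in> U" for x
      using g(2)[OF that] dist_le[OF add_subgroup_zero[OF A(1)] that] by simp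
    have nonpos: "g a \<le> 0" if "a \<in> A" for a
      using g(2)[of a] dist_le[OF that, of a] A(2) that sublinear_on_zero[OF p] by fastforce
    show "g a = 0" if "a \<in> A" for a
      using nonpos[OF that] nonpos[OF add_subgroup_minus[OF A(1) that]]
        additive_on_minus[OF g(1) U, of a] A(2) that by auto
    show "r \<le> g y"
      unfolding g(3) using add_subgroup_zero[OF A(1)] far by (intro cINF_greatest) auto
  qed
qed

section \<open>Seminormed spaces and dual pairs\<close>

lemma additive_bounded_imp_linear:
  fixes f :: "real \<Rightarrow> real"
  assumes "Modules.additive f" and bound: "\<And>t. f t \<le> K * \<bar>t\<bar>"
  shows "f t = t * f 1"
proof -
  interpret Modules.additive f by fact
  have abs_le: "\<bar>f s\<bar> \<le> K * \<bar>s\<bar>" for s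
    using bound[of s] bound[of "- s"] minus[of s] by simp
  have hom_nat: "f (real n * s) = real n * f s" for n s
    by (induction n) (simp_all add: zero add algebra_simps)
  have hom_int: "f (of_int m) = of_int m * f 1" for m
    using hom_nat[of _ 1] minus by (cases m rule: int_cases2) auto
  have "real n * \<bar>f t - t * f 1\<bar> \<le> \<bar>K\<bar> + \<bar>f 1\<bar>" for n
  proof -
    define k where "k = \<lfloor>real n * t\<rfloor>"
    define r where "r = frac (real n * t)"
    have r: "0 \<le> r" "r \<le> 1" and split: "real n * t = of_int k + r"
      using frac_lt_1[of "real n * t"] by (simp_all add: r_def k_def frac_def)
    have "real n * \<bar>f t - t * f 1\<bar> = \<bar>f (real n * t) - (real n * t) * f 1\<bar>"
      unfolding hom_nat by (simp add: abs_mult mult.assoc flip: right_diff_distrib)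
    also have "\<dots> = \<bar>f r - r * f 1\<bar>"
      unfolding split by (simp add: add hom_int distrib_right)
    also have "\<dots> \<le> \<bar>f r\<bar> + \<bar>r * f 1\<bar>" by (rule abs_triangle_ineq4)
    finally have "real n * \<bar>f t - t * f 1\<bar> \<le> \<bar>f r\<bar> + \<bar>r * f 1\<bar>" .
    moreover have "\<bar>f r\<bar> \<le> \<bar>K\<bar> * 1"
      using abs_le[of r] r by (intro order_trans[OF abs_le mult_mono]) auto
    moreover have "\<bar>r * f 1\<bar> \<le> 1 * \<bar>f 1\<bar>"
      unfolding abs_mult using r by (intro mult_right_mono) auto
    ultimately show ?thesis by linarith
  qed
  then have "\<bar>f t - t * f 1\<bar> \<le> 0"
    by (metis abs_ge_zero linorder_not_less order_antisym_conv reals_Archimedean3)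
  then show ?thesis by simp
qed

definition dominated_on :: "'a set \<Rightarrow> ('a \<Rightarrow> real) \<Rightarrow> ('a \<Rightarrow> real) \<Rightarrow> bool" where
  "dominated_on V N l \<longleftrightarrow> (\<exists>C\<ge>0. \<forall>x\<in>V. l x \<le> C * N x)"

definition dual_norm :: "'a set \<Rightarrow> ('a \<Rightarrow> real) \<Rightarrow> ('a \<Rightarrow> real) \<Rightarrow> real" where
  "dual_norm V N l = Inf {C. 0 \<le> C \<and> (\<forall>x\<in>V. l x \<le> C * N x)}"

lemma dominated_onI: "0 \<le> C \<Longrightarrow> (\<And>x. x \<in> V \<Longrightarrow> l x \<le> C * N x) \<Longrightarrow> dominated_on V N l"
  by (auto simp: dominated_on_def)

lemma dual_norm_cong: "(\<And>x. x \<in> V \<Longrightarrow> l x = l' x) \<Longrightarrow> dual_norm V N l = dual_norm V N l'"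
  by (simp add: dual_norm_def)

lemma dual_norm_least: "0 \<le> C \<Longrightarrow> (\<And>x. x \<in> V \<Longrightarrow> l x \<le> C * N x) \<Longrightarrow> dual_norm V N l \<le> C"
  unfolding dual_norm_def by (rule cInf_lower) (auto intro!: bdd_belowI[of _ 0])

lemma dual_norm_nonneg: "dominated_on V N l \<Longrightarrow> 0 \<le> dual_norm V N l"
  unfolding dual_norm_def dominated_on_def by (rule cInf_greatest) auto

locale seminormed_space =
  fixes V :: "'a::ab_group_add set" and sc :: "real \<Rightarrow> 'a \<Rightarrow> 'a" and N :: "'a \<Rightarrow> real"
  assumes zero_in: "0 \<in> V"
    and add_in: "x \<in> V \<Longrightarrow> y \<in> V \<Longrightarrow> x + y \<in> V"
    and sc_in: "x \<in> V \<Longrightarrow> sc c x \<in> V"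
    and sc_add: "x \<in> V \<Longrightarrow> sc (a + b) x = sc a x + sc b x"
    and sc_one: "x \<in> V \<Longrightarrow> sc 1 x = x"
    and N_sc: "x \<in> V \<Longrightarrow> N (sc c x) = \<bar>c\<bar> * N x"
    and N_add: "x \<in> V \<Longrightarrow> y \<in> V \<Longrightarrow> N (x + y) \<le> N x + N y"
begin

lemma sc_zero: "x \<in> V \<Longrightarrow> sc 0 x = 0"
  using sc_add[of x 0 0] by simp

lemma sc_minus_one: "x \<in> V \<Longrightarrow> sc (- 1) x = - x"
  using sc_add[of x 1 "- 1"] by (simp add: sc_zero sc_one add_eq_0_iff)

lemma sc_half: "x \<in> V \<Longrightarrow> sc (1/2) x + sc (1/2) x = x"
  using sc_add[of x "1/2" "1/2"] by (simp add: sc_one)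

lemma minus_in: "x \<in> V \<Longrightarrow> - x \<in> V"
  using sc_in[of x "- 1"] by (simp add: sc_minus_one)

lemma subgroup: "add_subgroup V"
  by (simp add: add_subgroup_def zero_in add_in minus_in)

lemmas diff_in = add_subgroup_diff[OF subgroup]
  and sum_in = add_subgroup_sum[OF subgroup]

lemma N_zero: "N 0 = 0"
  using N_sc[OF zero_in, of 0] sc_zero[OF zero_in] by simp

lemma N_minus: "x \<in> V \<Longrightarrow> N (- x) = N x"
  using N_sc[of x "- 1"] by (simp add: sc_minus_one)

lemma N_diff: "x \<in> V \<Longrightarrow> y \<in> V \<Longrightarrow> N (x - y) \<le> N x + N y"
  using N_add[of x "- y"] minus_in N_minus by simp

lemma N_minus_commute: "x \<in> V \<Longrightarrow> y \<in> V \<Longrightarrow> N (x - y) = N (y - x)"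
  using N_minus[OF diff_in, of x y] by simp

lemma N_nonneg: "x \<in> V \<Longrightarrow> 0 \<le> N x"
  using N_diff[of x x] N_zero by simp

lemma N_double: "x \<in> V \<Longrightarrow> N (x + x) = 2 * N x"
  using N_sc[of x 2] sc_add[of x 1 1] by (simp add: sc_one)

lemma sublinear_N: "sublinear_on V N"
  by (simp add: sublinear_on_def subgroup N_add N_double)

lemma dominated_onI': "(\<And>x. x \<in> V \<Longrightarrow> l x \<le> C * N x) \<Longrightarrow> dominated_on V N l"
  by (rule dominated_onI[of "\<bar>C\<bar>"]) (auto intro: order_trans[OF _ mult_right_mono[OF abs_ge_self]] N_nonneg)

lemma dual_norm_upper:
  assumes l: "dominated_on V N l" and x: "x \<in> V"
  shows "l x \<le> dual_norm V N l * N x"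
proof (cases "N x = 0")
  case True
  then show ?thesis using l x by (auto simp: dominated_on_def)
next
  case False
  then have "0 < N x" using N_nonneg[OF x] by simp
  moreover from this have "l x / N x \<le> dual_norm V N l"
    unfolding dual_norm_def using l x by (intro cInf_greatest) (auto simp: dominated_on_def pos_divide_le_eq)
  ultimately show ?thesis by (simp add: pos_divide_le_eq)
qed

context
  fixes l
  assumes additive: "additive_on V l" and dominated: "dominated_on V N l"
begin

lemma additive_dominated_sc:
  assumes x: "x \<in> V"
  shows "l (sc t x) = t * l x"
proof -
  have "l (sc t x) = t * l (sc 1 x)"
  proof (rule additive_bounded_imp_linear)
    show "Modules.additive (\<lambda>t. l (sc t x))"
      by standard (simp add: sc_add[OF x] additive_on_add[OF additive sc_in[OF x] sc_in[OF x]])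
    show "l (sc t x) \<le> (dual_norm V N l * N x) * \<bar>t\<bar>" for t
      using dual_norm_upper[OF dominated sc_in[OF x], of t] N_sc[OF x] by (simp add: mult_ac)
  qed
  then show ?thesis by (simp add: sc_one[OF x])
qed

lemma dual_norm_approx:
  assumes \<delta>: "0 < \<delta>"
  obtains x where "x \<in> V" "N x \<le> 1" "dual_norm V N l - \<delta> \<le> l x"
proof (cases "dual_norm V N l - \<delta> \<le> 0")
  case True
  then show ?thesis using that[of 0] zero_in N_zero additive_on_zero[OF additive subgroup] by simp
next
  case False
  then obtain x where x: "x \<in> V" and less: "(dual_norm V N l - \<delta>) * N x < l x"
    using dual_norm_least[of "dual_norm V N l - \<delta>" V l N] \<delta> by force
  have "N x \<noteq> 0" using less dual_norm_upper[OF dominated x] by auto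
  then have pos: "0 < N x" using N_nonneg[OF x] by simp
  show ?thesis
  proof (rule that)
    show "sc (1 / N x) x \<in> V" by (rule sc_in[OF x])
    show "N (sc (1 / N x) x) \<le> 1" using pos by (simp add: N_sc[OF x])
    show "dual_norm V N l - \<delta> \<le> l (sc (1 / N x) x)"
      using less pos by (simp add: additive_dominated_sc[OF x] field_simps)
  qed
qed

lemma dominated_on_scale: "dominated_on V N (\<lambda>x. c * l x)"
proof (rule dominated_onI')
  fix x assume x: "x \<in> V"
  have "c * l x = l (sc c x)" by (simp add: additive_dominated_sc[OF x])
  also have "\<dots> \<le> (dual_norm V N l * \<bar>c\<bar>) * N x"
    using dual_norm_upper[OF dominated sc_in[OF x], of c] by (simp add: N_sc[OF x])
  finally show "c * l x \<le> (dual_norm V N l * \<bar>c\<bar>) * N x" .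
qed

lemma dual_norm_scale_le: "dual_norm V N (\<lambda>x. c * l x) \<le> \<bar>c\<bar> * dual_norm V N l"
proof (rule dual_norm_least)
  show "0 \<le> \<bar>c\<bar> * dual_norm V N l" using dual_norm_nonneg[OF dominated] by simp
  fix x assume x: "x \<in> V"
  show "c * l x \<le> \<bar>c\<bar> * dual_norm V N l * N x"
    using dual_norm_upper[OF dominated sc_in[OF x, of c]]
    by (simp add: additive_dominated_sc[OF x] N_sc[OF x] mult_ac)
qed

end

lemma dual_norm_scale:
  assumes l: "additive_on V l" "dominated_on V N l"
  shows "dual_norm V N (\<lambda>x. c * l x) = \<bar>c\<bar> * dual_norm V N l"
proof (cases "c = 0")
  case True
  have "dominated_on V N (\<lambda>x. 0 * l x)" by (rule dominated_on_scale[OF l])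
  then show ?thesis using dual_norm_scale_le[OF l, of 0] dual_norm_nonneg True by fastforce
next
  case False
  have cl: "additive_on V (\<lambda>x. c * l x)" using l(1) by (simp add: additive_on_def algebra_simps)
  have "dual_norm V N (\<lambda>x. 1 / c * (c * l x)) \<le> \<bar>1 / c\<bar> * dual_norm V N (\<lambda>x. c * l x)"
    by (rule dual_norm_scale_le[OF cl dominated_on_scale[OF l]])
  then have "\<bar>c\<bar> * dual_norm V N l \<le> dual_norm V N (\<lambda>x. c * l x)"
    using False by (simp add: field_simps)
  then show ?thesis using dual_norm_scale_le[OF l, of c] by simp
qed

lemma seminormed_space_divide: "0 < c \<Longrightarrow> seminormed_space V sc (\<lambda>x. N x / c)"
  by standard
     (auto simp: zero_in add_in sc_in sc_add sc_one N_sc intro: divide_right_mono[OF N_add]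
       simp flip: add_divide_distrib)

lemma dual_norm_add_le:
  assumes "dominated_on V N l" "dominated_on V N l'"
  shows "dual_norm V N (\<lambda>x. l x + l' x) \<le> dual_norm V N l + dual_norm V N l'"
  using dual_norm_nonneg[OF assms(1)] dual_norm_nonneg[OF assms(2)]
    add_mono[OF dual_norm_upper[OF assms(1)] dual_norm_upper[OF assms(2)]]
  by (intro dual_norm_least) (auto simp: algebra_simps)

end

locale dual_pair = Z: seminormed_space V sc N + W: seminormed_space W scW M
  for V :: "'a::ab_group_add set" and sc N and W :: "'b::ab_group_add set" and scW M +
  fixes pr :: "'b \<Rightarrow> 'a \<Rightarrow> real"
  assumes pr_add_left: "\<phi> \<in> W \<Longrightarrow> \<psi> \<in> W \<Longrightarrow> x \<in> V \<Longrightarrow> pr (\<phi> + \<psi>) x = pr \<phi> x + pr \<psi> x"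
    and pr_add_right: "\<phi> \<in> W \<Longrightarrow> x \<in> V \<Longrightarrow> y \<in> V \<Longrightarrow> pr \<phi> (x + y) = pr \<phi> x + pr \<phi> y"
    and pr_sc_left: "\<phi> \<in> W \<Longrightarrow> x \<in> V \<Longrightarrow> pr (scW c \<phi>) x = c * pr \<phi> x"
    and pr_dominated: "\<phi> \<in> W \<Longrightarrow> dominated_on V N (pr \<phi>)"
    and norm_eq: "\<phi> \<in> W \<Longrightarrow> M \<phi> = dual_norm V N (pr \<phi>)"
    and represent: "additive_on V l \<Longrightarrow> dominated_on V N l \<Longrightarrow> \<exists>\<phi>\<in>W. \<forall>x\<in>V. pr \<phi> x = l x"
    and pr_ext: "\<phi> \<in> W \<Longrightarrow> \<psi> \<in> W \<Longrightarrow> (\<And>x. x \<in> V \<Longrightarrow> pr \<phi> x = pr \<psi> x) \<Longrightarrow> \<phi> = \<psi>"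
begin

lemma additive_right: "\<phi> \<in> W \<Longrightarrow> additive_on V (pr \<phi>)"
  by (simp add: additive_on_def pr_add_right)

lemma additive_left: "x \<in> V \<Longrightarrow> additive_on W (\<lambda>\<phi>. pr \<phi> x)"
  by (simp add: additive_on_def pr_add_left)

lemmas pr_zero_right = additive_on_zero[OF additive_right Z.subgroup]
  and pr_minus_right = additive_on_minus[OF additive_right Z.subgroup]
  and pr_diff_right = additive_on_diff[OF additive_right Z.subgroup]
  and pr_sum_right = additive_on_sum[OF additive_right Z.subgroup]
  and pr_zero_left = additive_on_zero[OF additive_left W.subgroup]
  and pr_minus_left = additive_on_minus[OF additive_left W.subgroup]
  and pr_diff_left = additive_on_diff[OF additive_left W.subgroup]
  and pr_sum_left = additive_on_sum[OF additive_left W.subgroup]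
  and pr_sc_right = Z.additive_dominated_sc[OF additive_right pr_dominated]

lemma pr_le: "\<phi> \<in> W \<Longrightarrow> x \<in> V \<Longrightarrow> pr \<phi> x \<le> M \<phi> * N x"
  using Z.dual_norm_upper[OF pr_dominated] norm_eq by simp

lemma norm_le: "\<phi> \<in> W \<Longrightarrow> 0 \<le> C \<Longrightarrow> (\<And>x. x \<in> V \<Longrightarrow> pr \<phi> x \<le> C * N x) \<Longrightarrow> M \<phi> \<le> C"
  using dual_norm_least[of C V "pr \<phi>" N] norm_eq by simp

lemma abs_pr_le: "\<phi> \<in> W \<Longrightarrow> x \<in> V \<Longrightarrow> \<bar>pr \<phi> x\<bar> \<le> M \<phi> * N x"
  using pr_le[of \<phi> x] pr_le[of \<phi> "- x"] by (simp add: abs_le_iff pr_minus_right Z.minus_in Z.N_minus)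

lemma seminormed_space_abs_pr: "\<phi> \<in> W \<Longrightarrow> seminormed_space V sc (\<lambda>x. \<bar>pr \<phi> x\<bar>)"
  by standard
     (auto simp: Z.zero_in Z.add_in Z.sc_in Z.sc_add Z.sc_one pr_sc_right pr_add_right abs_mult)

lemma pr_attains:
  assumes \<phi>: "\<phi> \<in> W" and "\<phi> \<noteq> 0 \<or> c = 0"
  shows "\<exists>x\<in>V. pr \<phi> x = c"
proof (cases "c = 0")
  case True
  then show ?thesis using pr_zero_right[OF \<phi>] Z.zero_in by blast
next
  case False
  then obtain y where y: "y \<in> V" "pr \<phi> y \<noteq> 0"
    using assms pr_ext[OF \<phi> W.zero_in] pr_zero_left by metis
  have "pr \<phi> (sc (c / pr \<phi> y) y) = c" using y by (simp add: pr_sc_right[OF \<phi> \<phi>])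
  then show ?thesis using Z.sc_in[OF y(1)] by blast
qed

lemma pr_le_abs_pr_imp_multiple:
  assumes \<psi>: "\<psi> \<in> W" and \<phi>: "\<phi> \<in> W" and dominated: "\<And>x. x \<in> V \<Longrightarrow> pr \<psi> x \<le> t * \<bar>pr \<phi> x\<bar>"
  shows "\<exists>a. \<psi> = scW a \<phi>"
proof -
  have vanish: "pr \<psi> x = 0" if x: "x \<in> V" "pr \<phi> x = 0" for x
    using dominated[OF x(1)] dominated[OF Z.minus_in[OF x(1)]] x by (simp add: pr_minus_right \<phi> \<psi>)
  obtain y where y: "y \<in> V" "\<phi> \<noteq> 0 \<Longrightarrow> pr \<phi> y = 1"
    using pr_attains[OF \<phi>, of 1] Z.zero_in by blast
  have "\<psi> = scW (pr \<psi> y) \<phi>"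
  proof (rule pr_ext[OF \<psi> W.sc_in[OF \<phi>]])
    fix x assume x: "x \<in> V"
    let ?x = "x - sc (pr \<phi> x) y"
    have scy: "sc (pr \<phi> x) y \<in> V" by (rule Z.sc_in[OF y(1)])
    have "pr \<phi> ?x = 0"
      using y x scy pr_zero_left pr_zero_left[OF Z.diff_in[OF x scy]]
      by (cases "\<phi> = 0") (simp_all add: pr_diff_right \<phi> pr_sc_right[OF \<phi> \<phi>])
    then have "pr \<psi> ?x = 0" using vanish Z.diff_in[OF x scy] by blast
    then show "pr \<psi> x = pr (scW (pr \<psi> y) \<phi>) x"
      using x y(1) scy by (simp add: pr_diff_right \<psi> \<phi> pr_sc_left pr_sc_right[OF \<psi> \<psi>] mult.commute)
  qed
  then show ?thesis by blast
qed

lemma norm_approx: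
  assumes \<phi>: "\<phi> \<in> W" and \<delta>: "0 < \<delta>"
  obtains x where "x \<in> V" "N x \<le> 1" "M \<phi> - \<delta> \<le> pr \<phi> x"
  using Z.dual_norm_approx[OF additive_right[OF \<phi>] pr_dominated[OF \<phi>] \<delta>] norm_eq[OF \<phi>] by metis

lemma norm_eq_0D:
  assumes \<phi>: "\<phi> \<in> W" and "M \<phi> = 0"
  shows "\<phi> = 0"
proof (rule pr_ext[OF \<phi> W.zero_in])
  fix x assume x: "x \<in> V"
  show "pr \<phi> x = pr 0 x"
    using pr_le[OF \<phi> x] pr_le[OF \<phi> Z.minus_in[OF x]] assms(2)
    by (simp add: pr_minus_right[OF \<phi> x] pr_zero_left[OF x])
qed

end

lemma dual_pair_dual_norm:
  fixes V :: "'a::ab_group_add set" and W :: "'b::ab_group_add set"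
  assumes "seminormed_space V sc N"
    and W_add: "\<And>\<phi> \<psi>. \<phi> \<in> W \<Longrightarrow> \<psi> \<in> W \<Longrightarrow> \<phi> + \<psi> \<in> W" and W_sc: "\<And>c \<phi>. \<phi> \<in> W \<Longrightarrow> scW c \<phi> \<in> W"
    and add_left: "\<And>\<phi> \<psi> x. \<phi> \<in> W \<Longrightarrow> \<psi> \<in> W \<Longrightarrow> x \<in> V \<Longrightarrow> pr (\<phi> + \<psi>) x = pr \<phi> x + pr \<psi> x"
    and sc_left: "\<And>c \<phi> x. \<phi> \<in> W \<Longrightarrow> x \<in> V \<Longrightarrow> pr (scW c \<phi>) x = c * pr \<phi> x"
    and additive: "\<And>\<phi>. \<phi> \<in> W \<Longrightarrow> additive_on V (pr \<phi>)"
    and dominated: "\<And>\<phi>. \<phi> \<in> W \<Longrightarrow> dominated_on V N (pr \<phi>)"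
    and represent: "\<And>l. additive_on V l \<Longrightarrow> dominated_on V N l \<Longrightarrow> \<exists>\<phi>\<in>W. \<forall>x\<in>V. pr \<phi> x = l x"
    and ext: "\<And>\<phi> \<psi>. \<phi> \<in> W \<Longrightarrow> \<psi> \<in> W \<Longrightarrow> (\<And>x. x \<in> V \<Longrightarrow> pr \<phi> x = pr \<psi> x) \<Longrightarrow> \<phi> = \<psi>"
  shows "dual_pair V sc N W scW (\<lambda>\<phi>. dual_norm V N (pr \<phi>)) pr"
proof -
  interpret seminormed_space V sc N by fact
  interpret W: seminormed_space W scW "\<lambda>\<phi>. dual_norm V N (pr \<phi>)"
  proof
    obtain \<phi> where \<phi>: "\<phi> \<in> W" "\<And>x. x \<in> V \<Longrightarrow> pr \<phi> x = 0"
      using represent[of "\<lambda>_. 0"] dominated_onI[of 0 V "\<lambda>_. 0" N] by (auto simp: additive_on_def)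
    then have "\<phi> + \<phi> = \<phi>" by (intro ext W_add) (simp_all add: add_left)
    then show "0 \<in> W" using \<phi>(1) by simp
    fix \<phi> assume \<phi>: "\<phi> \<in> W"
    show "scW (a + b) \<phi> = scW a \<phi> + scW b \<phi>" for a b
      using \<phi> by (intro ext W_add W_sc) (simp_all add: sc_left add_left W_sc algebra_simps)
    show "scW 1 \<phi> = \<phi>" using \<phi> by (intro ext W_sc) (simp_all add: sc_left)
    show "dual_norm V N (pr (scW c \<phi>)) = \<bar>c\<bar> * dual_norm V N (pr \<phi>)" for c
      using dual_norm_scale[OF additive dominated, OF \<phi> \<phi>] sc_left[OF \<phi>]
      by (simp cong: dual_norm_cong)
    show "dual_norm V N (pr (\<phi> + \<psi>)) \<le> dual_norm V N (pr \<phi>) + dual_norm V N (pr \<psi>)" if "\<psi> \<in> W" for \<psi>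
      using dual_norm_add_le[OF dominated dominated, OF \<phi> that] add_left[OF \<phi> that]
      by (simp cong: dual_norm_cong)
  qed (simp_all add: W_add W_sc)
  show ?thesis
    by standard (simp_all add: add_left sc_left additive_on_add[OF additive] dominated represent ext)
qed

definition additive_ball :: "'a::ab_group_add set \<Rightarrow> ('a \<Rightarrow> real) \<Rightarrow> real \<Rightarrow> ('a \<Rightarrow> real) set" where
  "additive_ball V N R = {l. additive_on V l \<and> (\<forall>x\<in>V. l x \<le> R * N x) \<and> (\<forall>x. x \<notin> V \<longrightarrow> l x = 0)}"

theorem (in seminormed_space) Banach_Alaoglu: "compact (additive_ball V N R)"
proof -
  define box where "box x = (if x \<in> V then {- (R * N x)..R * N x} else {0})" for x
  have "additive_ball V N R = Pi UNIV box \<inter> (\<Inter>x\<in>V. \<Inter>y\<in>V. {l. l (x + y) = l x + l y})"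
  proof (intro equalityI subsetI)
    fix l assume l: "l \<in> additive_ball V N R"
    then have additive: "additive_on V l" by (simp add: additive_ball_def)
    have "- (R * N x) \<le> l x" if x: "x \<in> V" for x
      using l minus_in[OF x] additive_on_minus[OF additive subgroup x] N_minus[OF x]
      by (force simp: additive_ball_def)
    then show "l \<in> Pi UNIV box \<inter> (\<Inter>x\<in>V. \<Inter>y\<in>V. {l. l (x + y) = l x + l y})"
      using l by (auto simp: additive_ball_def additive_on_def box_def)
  qed (auto simp: additive_ball_def additive_on_def box_def Pi_iff split: if_splits)
  moreover have "compact (box x)" for x by (simp add: box_def)
  then have "compact (Pi UNIV box)"
    using compactin_PiE[of "\<lambda>_. euclidean" UNIV box]
    by (simp add: euclidean_product_topology PiE_UNIV_domain)
  moreover have "closed {l :: 'a \<Rightarrow> real. l (x + y) = l x + l y}" for x y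
    by (intro closed_Collect_eq continuous_intros continuous_on_product_coordinates)
  ultimately show ?thesis by (auto intro!: compact_Int_closed closed_INT)
qed

lemma (in dual_pair) weak_star_finite_intersection:
  assumes G: "\<And>z b. (z, b) \<in> G \<Longrightarrow> z \<in> V"
    and finite: "\<And>F \<epsilon>. finite F \<Longrightarrow> F \<subseteq> G \<Longrightarrow> 0 < \<epsilon> \<Longrightarrow>
        \<exists>\<phi>\<in>W. M \<phi> \<le> R \<and> (\<forall>(z, b)\<in>F. pr \<phi> z \<le> b + \<epsilon>)"
  obtains \<phi> where "\<phi> \<in> W" "M \<phi> \<le> R" "\<And>z b. (z, b) \<in> G \<Longrightarrow> pr \<phi> z \<le> b"
proof -
  obtain \<phi>\<^sub>0 where "\<phi>\<^sub>0 \<in> W" "M \<phi>\<^sub>0 \<le> R" using finite[of "{}" 1] by auto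
  then have R: "0 \<le> R" using W.N_nonneg order_trans by blast
  define halfspace where "halfspace = (\<lambda>((z, b), \<epsilon>). {l :: 'a \<Rightarrow> real. l z \<le> b + \<epsilon>})"
  have "additive_ball V N R \<inter> (\<Inter>i\<in>G \<times> {0<..}. halfspace i) \<noteq> {}"
  proof (rule compact_imp_fip_image[OF Z.Banach_Alaoglu])
    show "closed (halfspace i)" for i
      by (cases i)
         (auto simp: halfspace_def intro!: closed_Collect_le continuous_intros continuous_on_product_coordinates)
    fix I assume I: "finite I" "I \<subseteq> G \<times> {0 :: real<..}"
    define \<epsilon> where "\<epsilon> = Min (insert 1 (snd ` I))"
    have \<epsilon>: "0 < \<epsilon>" "\<And>i. i \<in> I \<Longrightarrow> \<epsilon> \<le> snd i" using I by (auto simp: \<epsilon>_def)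
    obtain \<phi> where \<phi>: "\<phi> \<in> W" "M \<phi> \<le> R" "\<And>z b. (z, b) \<in> fst ` I \<Longrightarrow> pr \<phi> z \<le> b + \<epsilon>"
      using finite[of "fst ` I" \<epsilon>] I \<epsilon> by fastforce
    define l where "l x = (if x \<in> V then pr \<phi> x else 0)" for x
    have "pr \<phi> x \<le> R * N x" if "x \<in> V" for x
      using pr_le[OF \<phi>(1) that] mult_right_mono[OF \<phi>(2) Z.N_nonneg[OF that]] by simp
    then have "l \<in> additive_ball V N R"
      by (simp add: l_def additive_ball_def additive_on_def Z.add_in pr_add_right[OF \<phi>(1)])
    moreover have "l \<in> halfspace i" if i: "i \<in> I" for i
    proof -
      obtain z b \<delta> where i_eq: "i = ((z, b), \<delta>)" by (cases i) auto
      have "z \<in> V" using G I(2) i unfolding i_eq by blast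
      moreover have "(z, b) \<in> fst ` I" using i unfolding i_eq by force
      ultimately show ?thesis using \<phi>(3) \<epsilon>(2)[OF i] unfolding i_eq halfspace_def l_def by force
    qed
    ultimately show "additive_ball V N R \<inter> (\<Inter>i\<in>I. halfspace i) \<noteq> {}" by blast
  qed
  then obtain l where "l \<in> additive_ball V N R" and l_half: "\<And>i. i \<in> G \<times> {0<..} \<Longrightarrow> l \<in> halfspace i" by blast
  then have l: "additive_on V l" "\<And>x. x \<in> V \<Longrightarrow> l x \<le> R * N x" by (simp_all add: additive_ball_def)
  have l_le: "l z \<le> b" if zb: "(z, b) \<in> G" for z b
  proof (rule field_le_epsilon)
    show "l z \<le> b + \<epsilon>" if "0 < \<epsilon>" for \<epsilon>
      using l_half[of "((z, b), \<epsilon>)"] zb that by (simp add: halfspace_def)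
  qed
  obtain \<phi> where \<phi>: "\<phi> \<in> W" "\<And>x. x \<in> V \<Longrightarrow> pr \<phi> x = l x"
    using represent[OF l(1) Z.dominated_onI'[OF l(2)]] by blast
  have "M \<phi> \<le> R" using \<phi> l(2) by (intro norm_le R) auto
  with \<phi> G l_le show ?thesis using that[of \<phi>] by simp
qed

section \<open>Helly's theorem for families of vectors\<close>

definition max_seminorm :: "'k set \<Rightarrow> ('k \<Rightarrow> 'a \<Rightarrow> real) \<Rightarrow> ('k \<Rightarrow> 'a) \<Rightarrow> real" where
  "max_seminorm K P e = Max (insert 0 ((\<lambda>k. P k (e k)) ` K))"

lemma max_seminorm_le_iff:
  "finite K \<Longrightarrow> max_seminorm K P e \<le> c \<longleftrightarrow> 0 \<le> c \<and> (\<forall>k\<in>K. P k (e k) \<le> c)"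
  by (simp add: max_seminorm_def)

lemma
  assumes "finite K"
  shows max_seminorm_nonneg: "0 \<le> max_seminorm K P e"
    and max_seminorm_upper: "k \<in> K \<Longrightarrow> P k (e k) \<le> max_seminorm K P e"
  using assms max_seminorm_le_iff[of K P e "max_seminorm K P e"] by auto

lemma add_subgroup_families: "add_subgroup V \<Longrightarrow> add_subgroup (UNIV \<rightarrow> V)"
  by (auto simp: add_subgroup_def Pi_iff)

lemma sublinear_on_max_seminorm:
  fixes K :: "'k set" and V :: "'a::ab_group_add set"
  assumes K: "finite K" and V: "add_subgroup V" and P: "\<And>k. k \<in> K \<Longrightarrow> sublinear_on V (P k)"
  shows "sublinear_on (UNIV \<rightarrow> V) (max_seminorm K P)"
  unfolding sublinear_on_def
proof (intro conjI ballI add_subgroup_families V)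
  note upper = max_seminorm_upper[OF K] and nonneg = max_seminorm_nonneg[OF K]
  fix e :: "'k \<Rightarrow> 'a" assume e: "e \<in> UNIV \<rightarrow> V"
  show "max_seminorm K P (e + e') \<le> max_seminorm K P e + max_seminorm K P e'" if e': "e' \<in> UNIV \<rightarrow> V" for e'
  proof -
    have "P k (e k + e' k) \<le> max_seminorm K P e + max_seminorm K P e'" if "k \<in> K" for k
      using sublinear_on_add[OF P[OF that], of "e k" "e' k"] e e' upper[OF that, of P e] upper[OF that, of P e']
      by (auto simp: Pi_iff)
    then show ?thesis by (simp add: max_seminorm_le_iff[OF K] nonneg)
  qed
  have double: "P k (e k + e k) = 2 * P k (e k)" if "k \<in> K" for k
    using sublinear_on_double[OF P[OF that]] e by auto
  have "max_seminorm K P (e + e) \<le> 2 * max_seminorm K P e"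
    by (simp add: max_seminorm_le_iff[OF K] nonneg double upper)
  moreover have "max_seminorm K P e \<le> max_seminorm K P (e + e) / 2"
    unfolding max_seminorm_le_iff[OF K]
    using upper[of _ P "e + e"] nonneg[of P "e + e"] by (auto simp: double mult.commute)
  ultimately show "max_seminorm K P (e + e) = 2 * max_seminorm K P e" by simp
qed

definition single :: "'k \<Rightarrow> 'a::zero \<Rightarrow> 'k \<Rightarrow> 'a" where
  "single k x = (\<lambda>j. if j = k then x else 0)"

lemma single_add: "single k (x + y) = single k x + single k (y :: 'a::monoid_add)"
  by (auto simp: single_def)

lemma single_in_families: "0 \<in> V \<Longrightarrow> x \<in> V \<Longrightarrow> single k x \<in> UNIV \<rightarrow> V"
  by (simp add: single_def)

lemma sum_fun_apply: "(\<Sum>a\<in>A. h a) x = (\<Sum>a\<in>A. h a x)"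
  by (induction A rule: infinite_finite_induct) auto

lemma sum_single_apply: "finite K \<Longrightarrow> (\<Sum>k\<in>K. single k (e k)) j = (if j \<in> K then e j else 0)"
  by (simp add: sum_fun_apply single_def)

text \<open>The dual of a finite \<open>\<ell>\<^sup>\<infinity>\<close>-sum is the \<open>\<ell>\<^sup>1\<close>-sum of the duals.\<close>

context
  fixes K :: "'k set" and V :: "'a::ab_group_add set" and sc and P and g :: "('k \<Rightarrow> 'a) \<Rightarrow> real"
  assumes K: "finite K" and P: "\<And>k. k \<in> K \<Longrightarrow> seminormed_space V sc (P k)" and V: "add_subgroup V"
    and g: "additive_on (UNIV \<rightarrow> V) g" and dominated: "\<And>e. e \<in> UNIV \<rightarrow> V \<Longrightarrow> g e \<le> max_seminorm K P e"
begin

lemma additive_le_max_seminorm_eq_sum: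
  assumes e: "e \<in> UNIV \<rightarrow> V"
  shows "g e = (\<Sum>k\<in>K. g (single k (e k)))"
proof -
  note families = add_subgroup_families[OF V]
  note single_in = single_in_families[OF add_subgroup_zero[OF V]]
  define r where "r = e - (\<Sum>k\<in>K. single k (e k))"
  have sum_in: "(\<Sum>k\<in>K. single k (e k)) \<in> UNIV \<rightarrow> V"
    using e by (intro add_subgroup_sum families single_in) auto
  have r: "r \<in> UNIV \<rightarrow> V" unfolding r_def by (rule add_subgroup_diff[OF families e sum_in])
  have "r k = 0" if "k \<in> K" for k
    using that by (simp add: r_def sum_single_apply[OF K])
  then have "max_seminorm K P r \<le> 0" "max_seminorm K P (- r) \<le> 0"
    using sublinear_on_zero[OF seminormed_space.sublinear_N[OF P]] by (simp_all add: max_seminorm_le_iff[OF K])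
  then have "g r = 0"
    using dominated[OF r] dominated[OF add_subgroup_minus[OF families r]] additive_on_minus[OF g families r] by simp
  then have "g e = g (\<Sum>k\<in>K. single k (e k))"
    unfolding r_def additive_on_diff[OF g families e sum_in] by simp
  also have "\<dots> = (\<Sum>k\<in>K. g (single k (e k)))"
    using e by (intro additive_on_sum[OF g families] single_in) auto
  finally show ?thesis .
qed

lemma additive_on_single: "additive_on V (\<lambda>x. g (single k x))"
  using single_in_families[OF add_subgroup_zero[OF V], of _ k]
  by (simp add: additive_on_def single_add additive_on_add[OF g])

lemma dominated_on_single:
  assumes k: "k \<in> K"
  shows "dominated_on V (P k) (\<lambda>x. g (single k x))"
proof (rule dominated_onI[of 1])
  fix x assume x: "x \<in> V"
  have "P j (single k x j) \<le> P k x" if "j \<in> K" for j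
    using sublinear_on_zero[OF seminormed_space.sublinear_N[OF P[OF that]]]
      seminormed_space.N_nonneg[OF P[OF k] x] by (simp add: single_def)
  then have "max_seminorm K P (single k x) \<le> P k x"
    by (simp add: max_seminorm_le_iff[OF K] seminormed_space.N_nonneg[OF P[OF k] x])
  then show "g (single k x) \<le> 1 * P k x"
    using dominated[OF single_in_families[OF add_subgroup_zero[OF V] x, of k]] by simp
qed simp

lemma sum_dual_norm_single_le: "(\<Sum>k\<in>K. dual_norm V (P k) (\<lambda>x. g (single k x))) \<le> 1"
proof -
  define t where "t k = dual_norm V (P k) (\<lambda>x. g (single k x))" for k
  have approx: "(\<Sum>k\<in>K. t k) \<le> 1 + card K * \<delta>" if \<delta>: "0 < \<delta>" for \<delta> :: real
  proof -
    have "\<exists>x\<in>V. P k x \<le> 1 \<and> t k - \<delta> \<le> g (single k x)" if k: "k \<in> K" for k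
      using seminormed_space.dual_norm_approx[OF P[OF k] additive_on_single dominated_on_single[OF k] \<delta>]
      unfolding t_def by blast
    then obtain x where x: "\<And>k. k \<in> K \<Longrightarrow> x k \<in> V" "\<And>k. k \<in> K \<Longrightarrow> P k (x k) \<le> 1"
      "\<And>k. k \<in> K \<Longrightarrow> t k - \<delta> \<le> g (single k (x k))" by metis
    let ?x = "\<lambda>k. if k \<in> K then x k else 0"
    have x_in: "?x \<in> UNIV \<rightarrow> V" using x(1) add_subgroup_zero[OF V] by simp
    have "(\<Sum>k\<in>K. t k - \<delta>) \<le> (\<Sum>k\<in>K. g (single k (?x k)))" using x(3) by (intro sum_mono) simp
    also have "\<dots> = g ?x" by (rule additive_le_max_seminorm_eq_sum[OF x_in, symmetric])
    also have "\<dots> \<le> 1"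
      using dominated[OF x_in] max_seminorm_le_iff[OF K, of P ?x 1] x(2) by simp
    finally show ?thesis by (simp add: sum_subtractf)
  qed
  have "(\<Sum>k\<in>K. t k) \<le> 1 + \<epsilon>" if \<epsilon>: "0 < \<epsilon>" for \<epsilon>
  proof -
    have "card K * (\<epsilon> / (1 + card K)) \<le> \<epsilon>" using \<epsilon> by (simp add: field_simps)
    then show ?thesis using approx[of "\<epsilon> / (1 + card K)"] \<epsilon> by simp
  qed
  then show ?thesis unfolding t_def by (rule field_le_epsilon)
qed

lemma additive_le_max_seminorm_decompose:
  obtains l t where "\<forall>k\<in>K. additive_on V (l k) \<and> 0 \<le> t k \<and> (\<forall>x\<in>V. l k x \<le> t k * P k x)"
    "(\<Sum>k\<in>K. t k) \<le> 1" "\<forall>e\<in>UNIV \<rightarrow> V. g e = (\<Sum>k\<in>K. l k (e k))"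
  using that[of "\<lambda>k x. g (single k x)" "\<lambda>k. dual_norm V (P k) (\<lambda>x. g (single k x))"]
    sum_dual_norm_single_le additive_le_max_seminorm_eq_sum
  by (simp add: additive_on_single dual_norm_nonneg dominated_on_single
      seminormed_space.dual_norm_upper[OF P dominated_on_single])

end

lemma (in seminormed_space) unsolvable_separating_functionals:
  fixes L :: "'k \<Rightarrow> ('i \<Rightarrow> 'a) \<Rightarrow> 'a"
  assumes Q: "finite Q" and P: "\<And>k. k \<in> Q \<Longrightarrow> seminormed_space V sc (P k)"
    and L: "\<And>k v. k \<in> Q \<Longrightarrow> v \<in> UNIV \<rightarrow> V \<Longrightarrow> L k v \<in> V"
    and L_add: "\<And>k v v'. k \<in> Q \<Longrightarrow> v \<in> UNIV \<rightarrow> V \<Longrightarrow> v' \<in> UNIV \<rightarrow> V \<Longrightarrow> L k (v + v') = L k v + L k v'"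
    and z: "\<And>k. k \<in> Q \<Longrightarrow> z k \<in> V" and unsolvable: "\<not> (\<exists>v\<in>UNIV \<rightarrow> V. \<forall>k\<in>Q. P k (z k - L k v) < 1)"
  obtains l t where "\<forall>k\<in>Q. additive_on V (l k) \<and> 0 \<le> t k \<and> (\<forall>x\<in>V. l k x \<le> t k * P k x)"
    "(\<Sum>k\<in>Q. t k) \<le> 1" "1 \<le> (\<Sum>k\<in>Q. l k (z k))" "\<forall>v\<in>UNIV \<rightarrow> V. (\<Sum>k\<in>Q. l k (L k v)) = 0"
proof -
  define tuple where "tuple v k = (if k \<in> Q then L k v else 0)" for v k
  define A where "A = tuple ` (UNIV \<rightarrow> V)"
  define zQ where "zQ k = (if k \<in> Q then z k else 0)" for k
  note families = add_subgroup_families[OF subgroup]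
  have tuple_in: "tuple v \<in> UNIV \<rightarrow> V" if "v \<in> UNIV \<rightarrow> V" for v
    using that L zero_in by (simp add: tuple_def)
  have tuple: "additive_on (UNIV \<rightarrow> V) tuple"
    by (auto simp: additive_on_def fun_eq_iff tuple_def L_add)
  have A: "add_subgroup A"
    unfolding A_def by (rule add_subgroup_image[OF families tuple])
  have A_sub: "A \<subseteq> UNIV \<rightarrow> V" using tuple_in unfolding A_def by blast
  have halves: "\<exists>h\<in>A. h + h = a" if a: "a \<in> A" for a
  proof -
    obtain v where v: "v \<in> UNIV \<rightarrow> V" "a = tuple v" using a by (auto simp: A_def)
    let ?h = "\<lambda>i. sc (1/2) (v i)"
    have h: "?h \<in> UNIV \<rightarrow> V" using v(1) sc_in by auto
    have "?h + ?h = v" using v(1) sc_half by (auto simp: fun_eq_iff)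
    then have "tuple ?h + tuple ?h = a" using additive_on_add[OF tuple h h] v(2) by simp
    then show ?thesis using h by (auto simp: A_def)
  qed
  have far: "1 \<le> max_seminorm Q P (zQ - a)" if a: "a \<in> A" for a
  proof -
    obtain v where v: "v \<in> UNIV \<rightarrow> V" "a = tuple v" using a by (auto simp: A_def)
    obtain k where k: "k \<in> Q" "1 \<le> P k (z k - L k v)" using unsolvable v(1) by (meson not_le)
    then show ?thesis using max_seminorm_upper[OF Q k(1), of P "zQ - a"] by (simp add: v(2) tuple_def zQ_def)
  qed
  have sublinear: "sublinear_on (UNIV \<rightarrow> V) (max_seminorm Q P)"
    by (rule sublinear_on_max_seminorm[OF Q subgroup seminormed_space.sublinear_N[OF P]])
  have nonneg: "0 \<le> max_seminorm Q P e" if "e \<in> UNIV \<rightarrow> V" for e by (rule max_seminorm_nonneg[OF Q])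
  have zQ_in: "zQ \<in> UNIV \<rightarrow> V" using z zero_in by (simp add: zQ_def)
  obtain g where g: "additive_on (UNIV \<rightarrow> V) g" "\<And>e. e \<in> UNIV \<rightarrow> V \<Longrightarrow> g e \<le> max_seminorm Q P e"
    and g_vanishes: "\<And>a. a \<in> A \<Longrightarrow> g a = 0" and g_zQ: "1 \<le> g zQ"
    using separating_additive_functional[OF sublinear nonneg A A_sub halves zQ_in, of 1] far by blast
  obtain l t where l: "\<forall>k\<in>Q. additive_on V (l k) \<and> 0 \<le> t k \<and> (\<forall>x\<in>V. l k x \<le> t k * P k x)"
    "(\<Sum>k\<in>Q. t k) \<le> 1" and g_eq: "\<forall>e\<in>UNIV \<rightarrow> V. g e = (\<Sum>k\<in>Q. l k (e k))"
    by (rule additive_le_max_seminorm_decompose[OF Q P subgroup g])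
  have "(\<Sum>k\<in>Q. l k (L k v)) = 0" if v: "v \<in> UNIV \<rightarrow> V" for v
    using bspec[OF g_eq tuple_in[OF v]] g_vanishes v by (simp add: A_def tuple_def)
  then show ?thesis using that[OF l] g_zQ bspec[OF g_eq zQ_in] by (simp add: zQ_def)
qed

lemma weighted_sum_less_1:
  fixes t \<rho> :: "'k \<Rightarrow> real"
  assumes Q: "finite Q" and t: "\<And>k. k \<in> Q \<Longrightarrow> 0 \<le> t k" "(\<Sum>k\<in>Q. t k) \<le> 1" and \<rho>: "\<And>k. k \<in> Q \<Longrightarrow> \<rho> k < 1"
  shows "(\<Sum>k\<in>Q. t k * \<rho> k) < 1"
proof (cases "\<forall>k\<in>Q. t k = 0")
  case False
  then obtain k where k: "k \<in> Q" "t k \<noteq> 0" by blast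
  then have "t k * \<rho> k < t k * 1" using t(1)[OF k(1)] \<rho>[OF k(1)] by (intro mult_strict_left_mono) auto
  with k(1) have "(\<Sum>k\<in>Q. t k * \<rho> k) < (\<Sum>k\<in>Q. t k)"
    using t(1) \<rho> by (intro sum_strict_mono_ex1 Q) (auto intro: mult_left_le less_imp_le)
  then show ?thesis using t(2) by simp
qed simp

locale bidual_pair = P1: dual_pair V sc N W scW M pr + P2: dual_pair W scW M U scU K pr'
  for V :: "'a::ab_group_add set" and sc N and W :: "'b::ab_group_add set" and scW M pr
    and U :: "'c::ab_group_add set" and scU K pr'
begin

text \<open>\<open>L'\<close> is the second adjoint of the operator \<open>L\<close> on families, only the coordinates in \<open>I\<close>
  of which matter.\<close>

definition second_adjoint :: "'i set \<Rightarrow> (('i \<Rightarrow> 'a) \<Rightarrow> 'a) \<Rightarrow> (('i \<Rightarrow> 'c) \<Rightarrow> 'c) \<Rightarrow> bool" where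
  "second_adjoint I L L' \<longleftrightarrow>
     (\<forall>v\<in>UNIV \<rightarrow> V. L v \<in> V \<and> (\<forall>v'\<in>UNIV \<rightarrow> V. L (v + v') = L v + L v')) \<and>
     (\<forall>w\<in>UNIV \<rightarrow> U. L' w \<in> U) \<and>
     (\<forall>\<phi>\<in>W. \<exists>\<psi>\<in>I \<rightarrow> W. (\<forall>v\<in>UNIV \<rightarrow> V. pr \<phi> (L v) = (\<Sum>i\<in>I. pr (\<psi> i) (v i))) \<and>
        (\<forall>w\<in>UNIV \<rightarrow> U. pr' (L' w) \<phi> = (\<Sum>i\<in>I. pr' (w i) (\<psi> i))))"

lemma
  assumes "second_adjoint I L L'"
  shows second_adjoint_in: "v \<in> UNIV \<rightarrow> V \<Longrightarrow> L v \<in> V"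
    and second_adjoint_add: "v \<in> UNIV \<rightarrow> V \<Longrightarrow> v' \<in> UNIV \<rightarrow> V \<Longrightarrow> L (v + v') = L v + L v'"
    and second_adjoint_in': "w \<in> UNIV \<rightarrow> U \<Longrightarrow> L' w \<in> U"
  using assms by (auto simp: second_adjoint_def)

lemma second_adjointE:
  assumes "second_adjoint I L L'" "\<phi> \<in> W"
  obtains \<psi> where "\<psi> \<in> I \<rightarrow> W" "\<forall>v\<in>UNIV \<rightarrow> V. pr \<phi> (L v) = (\<Sum>i\<in>I. pr (\<psi> i) (v i))"
    "\<forall>w\<in>UNIV \<rightarrow> U. pr' (L' w) \<phi> = (\<Sum>i\<in>I. pr' (w i) (\<psi> i))"
  using assms unfolding second_adjoint_def by blast

lemma second_adjoint_proj:
  assumes "finite I" "i \<in> I"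
  shows "second_adjoint I (\<lambda>v. v i) (\<lambda>w. w i)"
  unfolding second_adjoint_def
proof (intro conjI ballI)
  fix \<phi> assume \<phi>: "\<phi> \<in> W"
  let ?\<psi> = "\<lambda>j. if j = i then \<phi> else 0"
  have "pr (?\<psi> j) (v j) = (if j = i then pr \<phi> (v i) else 0)" if "v \<in> UNIV \<rightarrow> V" for v j
    using that by (simp add: P1.pr_zero_left Pi_iff)
  moreover have "pr' (w j) (?\<psi> j) = (if j = i then pr' (w i) \<phi> else 0)" if "w \<in> UNIV \<rightarrow> U" for w j
    using that by (simp add: P2.pr_zero_right Pi_iff)
  ultimately show "\<exists>\<psi>\<in>I \<rightarrow> W. (\<forall>v\<in>UNIV \<rightarrow> V. pr \<phi> (v i) = (\<Sum>i\<in>I. pr (\<psi> i) (v i))) \<and>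
      (\<forall>w\<in>UNIV \<rightarrow> U. pr' (w i) \<phi> = (\<Sum>i\<in>I. pr' (w i) (\<psi> i)))"
    using assms \<phi> P1.W.zero_in by (intro bexI[of _ ?\<psi>]) simp_all
qed auto

lemma second_adjoint_compose:
  assumes L: "second_adjoint I L L'"
    and T: "\<And>x. x \<in> V \<Longrightarrow> T x \<in> V" "\<And>x y. x \<in> V \<Longrightarrow> y \<in> V \<Longrightarrow> T (x + y) = T x + T y"
    and T': "\<And>\<phi>. \<phi> \<in> W \<Longrightarrow> T' \<phi> \<in> W" and T'': "\<And>u. u \<in> U \<Longrightarrow> T'' u \<in> U"
    and adjoint: "\<And>\<phi> x. \<phi> \<in> W \<Longrightarrow> x \<in> V \<Longrightarrow> pr \<phi> (T x) = pr (T' \<phi>) x"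
      "\<And>u \<phi>. u \<in> U \<Longrightarrow> \<phi> \<in> W \<Longrightarrow> pr' (T'' u) \<phi> = pr' u (T' \<phi>)"
  shows "second_adjoint I (\<lambda>v. T (L v)) (\<lambda>w. T'' (L' w))"
  unfolding second_adjoint_def
proof (intro conjI ballI)
  fix \<phi> assume \<phi>: "\<phi> \<in> W"
  obtain \<psi> where "\<psi> \<in> I \<rightarrow> W" "\<forall>v\<in>UNIV \<rightarrow> V. pr (T' \<phi>) (L v) = (\<Sum>i\<in>I. pr (\<psi> i) (v i))"
    "\<forall>w\<in>UNIV \<rightarrow> U. pr' (L' w) (T' \<phi>) = (\<Sum>i\<in>I. pr' (w i) (\<psi> i))"
    by (rule second_adjointE[OF L T'[OF \<phi>]])
  then show "\<exists>\<psi>\<in>I \<rightarrow> W. (\<forall>v\<in>UNIV \<rightarrow> V. pr \<phi> (T (L v)) = (\<Sum>i\<in>I. pr (\<psi> i) (v i))) \<and>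
      (\<forall>w\<in>UNIV \<rightarrow> U. pr' (T'' (L' w)) \<phi> = (\<Sum>i\<in>I. pr' (w i) (\<psi> i)))"
    by (intro bexI[of _ \<psi>]) (auto simp: adjoint \<phi> second_adjoint_in[OF L] second_adjoint_in'[OF L])
qed (simp_all add: T T'' second_adjoint_in[OF L] second_adjoint_in'[OF L] second_adjoint_add[OF L])

lemma second_adjoint_plus:
  assumes L: "second_adjoint I L L'" and H: "second_adjoint I H H'"
  shows "second_adjoint I (\<lambda>v. L v + H v) (\<lambda>w. L' w + H' w)"
  unfolding second_adjoint_def
proof (intro conjI ballI)
  note L_in = second_adjoint_in[OF L] second_adjoint_in'[OF L]
    and H_in = second_adjoint_in[OF H] second_adjoint_in'[OF H]
  show "L v + H v \<in> V" if "v \<in> UNIV \<rightarrow> V" for v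
    using that by (intro P1.Z.add_in L_in H_in)
  show "L' w + H' w \<in> U" if "w \<in> UNIV \<rightarrow> U" for w
    using that by (intro P2.W.add_in L_in H_in)
  show "L (v + v') + H (v + v') = L v + H v + (L v' + H v')" if "v \<in> UNIV \<rightarrow> V" "v' \<in> UNIV \<rightarrow> V" for v v'
    using that by (simp add: second_adjoint_add[OF L] second_adjoint_add[OF H])
  fix \<phi> assume \<phi>: "\<phi> \<in> W"
  obtain \<psi> where \<psi>: "\<psi> \<in> I \<rightarrow> W" "\<forall>v\<in>UNIV \<rightarrow> V. pr \<phi> (L v) = (\<Sum>i\<in>I. pr (\<psi> i) (v i))"
    "\<forall>w\<in>UNIV \<rightarrow> U. pr' (L' w) \<phi> = (\<Sum>i\<in>I. pr' (w i) (\<psi> i))"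
    by (rule second_adjointE[OF L \<phi>])
  obtain \<theta> where \<theta>: "\<theta> \<in> I \<rightarrow> W" "\<forall>v\<in>UNIV \<rightarrow> V. pr \<phi> (H v) = (\<Sum>i\<in>I. pr (\<theta> i) (v i))"
    "\<forall>w\<in>UNIV \<rightarrow> U. pr' (H' w) \<phi> = (\<Sum>i\<in>I. pr' (w i) (\<theta> i))"
    by (rule second_adjointE[OF H \<phi>])
  show "\<exists>\<psi>\<in>I \<rightarrow> W. (\<forall>v\<in>UNIV \<rightarrow> V. pr \<phi> (L v + H v) = (\<Sum>i\<in>I. pr (\<psi> i) (v i))) \<and>
      (\<forall>w\<in>UNIV \<rightarrow> U. pr' (L' w + H' w) \<phi> = (\<Sum>i\<in>I. pr' (w i) (\<psi> i)))"
  proof (intro bexI[of _ "\<psi> + \<theta>"] conjI ballI)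
    show "\<psi> + \<theta> \<in> I \<rightarrow> W" using \<psi>(1) \<theta>(1) by (simp add: Pi_iff P1.W.add_in)
    show "pr \<phi> (L v + H v) = (\<Sum>i\<in>I. pr ((\<psi> + \<theta>) i) (v i))" if v: "v \<in> UNIV \<rightarrow> V" for v
      using v \<psi> \<theta> P1.pr_add_right[OF \<phi> L_in(1)[OF v] H_in(1)[OF v]]
      by (simp add: P1.pr_add_left Pi_iff sum.distrib)
    show "pr' (L' w + H' w) \<phi> = (\<Sum>i\<in>I. pr' (w i) ((\<psi> + \<theta>) i))" if w: "w \<in> UNIV \<rightarrow> U" for w
      using w \<psi> \<theta> P2.pr_add_left[OF L_in(2)[OF w] H_in(2)[OF w] \<phi>]
      by (simp add: P2.pr_add_right Pi_iff sum.distrib)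
  qed
qed

lemma second_adjoint_minus:
  assumes L: "second_adjoint I L L'"
  shows "second_adjoint I (\<lambda>v. - L v) (\<lambda>w. - L' w)"
  by (rule second_adjoint_compose[OF L, where T' = uminus])
     (simp_all add: P1.Z.minus_in P1.W.minus_in P2.W.minus_in P1.pr_minus_left P1.pr_minus_right
       P2.pr_minus_left P2.pr_minus_right)

lemma second_adjoint_diff:
  assumes L: "second_adjoint I L L'" and H: "second_adjoint I H H'"
  shows "second_adjoint I (\<lambda>v. L v - H v) (\<lambda>w. L' w - H' w)"
  using second_adjoint_plus[OF L second_adjoint_minus[OF H]] by simp

lemma second_adjoint_annihilates:
  assumes I: "finite I" and L: "\<And>k. k \<in> Q \<Longrightarrow> second_adjoint I (L k) (L' k)" and \<phi>: "\<And>k. k \<in> Q \<Longrightarrow> \<phi> k \<in> W"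
    and zero: "\<And>v. v \<in> UNIV \<rightarrow> V \<Longrightarrow> (\<Sum>k\<in>Q. pr (\<phi> k) (L k v)) = 0" and w: "w \<in> UNIV \<rightarrow> U"
  shows "(\<Sum>k\<in>Q. pr' (L' k w) (\<phi> k)) = 0"
proof -
  define adjoint where "adjoint k \<psi> \<longleftrightarrow> (\<forall>i\<in>I. \<psi> i \<in> W) \<and>
      (\<forall>v\<in>UNIV \<rightarrow> V. pr (\<phi> k) (L k v) = (\<Sum>i\<in>I. pr (\<psi> i) (v i))) \<and>
      pr' (L' k w) (\<phi> k) = (\<Sum>i\<in>I. pr' (w i) (\<psi> i))" for k \<psi>
  have "\<exists>\<psi>. adjoint k \<psi>" if k: "k \<in> Q" for k
  proof -
    obtain \<psi> where "\<psi> \<in> I \<rightarrow> W" "\<forall>v\<in>UNIV \<rightarrow> V. pr (\<phi> k) (L k v) = (\<Sum>i\<in>I. pr (\<psi> i) (v i))"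
      "\<forall>w\<in>UNIV \<rightarrow> U. pr' (L' k w) (\<phi> k) = (\<Sum>i\<in>I. pr' (w i) (\<psi> i))"
      by (rule second_adjointE[OF L[OF k] \<phi>[OF k]])
    then have "adjoint k \<psi>" using w by (auto simp: adjoint_def)
    then show ?thesis by blast
  qed
  then obtain \<psi> where "\<And>k. k \<in> Q \<Longrightarrow> adjoint k (\<psi> k)" by metis
  then have \<psi>: "\<And>k i. k \<in> Q \<Longrightarrow> i \<in> I \<Longrightarrow> \<psi> k i \<in> W"
    "\<And>k v. k \<in> Q \<Longrightarrow> v \<in> UNIV \<rightarrow> V \<Longrightarrow> pr (\<phi> k) (L k v) = (\<Sum>i\<in>I. pr (\<psi> k i) (v i))"
    "\<And>k. k \<in> Q \<Longrightarrow> pr' (L' k w) (\<phi> k) = (\<Sum>i\<in>I. pr' (w i) (\<psi> k i))"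
    unfolding adjoint_def by blast+
  have \<psi>_sum: "(\<Sum>k\<in>Q. \<psi> k i) = 0" if i: "i \<in> I" for i
  proof (rule P1.pr_ext[OF P1.W.sum_in P1.W.zero_in])
    fix x assume x: "x \<in> V"
    have v: "single i x \<in> UNIV \<rightarrow> V" by (rule single_in_families[OF P1.Z.zero_in x])
    have "pr (\<phi> k) (L k (single i x)) = pr (\<psi> k i) x" if k: "k \<in> Q" for k
    proof -
      have "pr (\<psi> k j) (single i x j) = (if j = i then pr (\<psi> k i) x else 0)" if "j \<in> I" for j
        using P1.pr_zero_right[OF \<psi>(1)[OF k that]] by (simp add: single_def)
      then show ?thesis using I i by (simp add: \<psi>(2)[OF k v])
    qed
    then show "pr (\<Sum>k\<in>Q. \<psi> k i) x = pr 0 x"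
      using P1.pr_sum_left[OF x, of Q "\<lambda>k. \<psi> k i"] \<psi>(1) i zero[OF v] by (simp add: P1.pr_zero_left[OF x])
  qed (use \<psi>(1) i in auto)
  have "(\<Sum>k\<in>Q. pr' (L' k w) (\<phi> k)) = (\<Sum>i\<in>I. \<Sum>k\<in>Q. pr' (w i) (\<psi> k i))"
    by (simp add: \<psi>(3) sum.swap[of _ I])
  also have "\<dots> = (\<Sum>i\<in>I. pr' (w i) (\<Sum>k\<in>Q. \<psi> k i))"
    using w \<psi>(1) by (intro sum.cong refl P2.pr_sum_right[symmetric]) auto
  also have "\<dots> = 0" using w by (intro sum.neutral) (simp add: \<psi>_sum P2.pr_zero_right Pi_iff)
  finally show ?thesis .
qed

text \<open>Says that \<open>P (z - L' w) < 1\<close> in the bidual, \<open>P\<close> being extended by means of its polar.\<close>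

definition bidual_solves ::
    "'i set \<Rightarrow> ('i \<Rightarrow> 'c) \<Rightarrow> (('i \<Rightarrow> 'a) \<Rightarrow> 'a) \<Rightarrow> (('i \<Rightarrow> 'c) \<Rightarrow> 'c) \<Rightarrow> ('a \<Rightarrow> real) \<Rightarrow> 'a \<Rightarrow> bool" where
  "bidual_solves I w L L' P z \<longleftrightarrow>
     second_adjoint I L L' \<and> seminormed_space V sc P \<and> dominated_on V N P \<and> z \<in> V \<and>
     (\<exists>\<rho><1. \<forall>t\<ge>0. \<forall>\<phi>\<in>W. (\<forall>x\<in>V. pr \<phi> x \<le> t * P x) \<longrightarrow> pr \<phi> z - pr' (L' w) \<phi> \<le> t * \<rho>)"

lemma bidual_solves_imp_solvable:
  assumes I: "finite I" and Q: "finite Q" and w: "w \<in> UNIV \<rightarrow> U"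
    and solves: "\<And>k. k \<in> Q \<Longrightarrow> bidual_solves I w (L k) (L' k) (P k) (z k)"
  shows "\<exists>v\<in>UNIV \<rightarrow> V. \<forall>k\<in>Q. P k (z k - L k v) < 1"
proof (rule ccontr)
  assume unsolvable: "\<not> ?thesis"
  obtain \<rho> where \<rho>: "\<And>k. k \<in> Q \<Longrightarrow> \<rho> k < 1"
    and polar: "\<And>k t \<phi>. k \<in> Q \<Longrightarrow> 0 \<le> t \<Longrightarrow> \<phi> \<in> W \<Longrightarrow> (\<And>x. x \<in> V \<Longrightarrow> pr \<phi> x \<le> t * P k x) \<Longrightarrow>
        pr \<phi> (z k) - pr' (L' k w) \<phi> \<le> t * \<rho> k"
    using solves unfolding bidual_solves_def by metis
  have L: "second_adjoint I (L k) (L' k)" and z: "z k \<in> V"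
    and P: "seminormed_space V sc (P k)" "dominated_on V N (P k)" if "k \<in> Q" for k
    using solves[OF that] by (simp_all add: bidual_solves_def)
  note L_in = second_adjoint_in[OF L]
  obtain l t where functionals: "\<forall>k\<in>Q. additive_on V (l k) \<and> 0 \<le> t k \<and> (\<forall>x\<in>V. l k x \<le> t k * P k x)"
    "(\<Sum>k\<in>Q. t k) \<le> 1" and at_z: "1 \<le> (\<Sum>k\<in>Q. l k (z k))" and annihilates: "\<forall>v\<in>UNIV \<rightarrow> V. (\<Sum>k\<in>Q. l k (L k v)) = 0"
    by (rule P1.Z.unsolvable_separating_functionals[OF Q P(1) L_in second_adjoint_add[OF L] z unsolvable])
  then have l: "additive_on V (l k)" "\<And>x. x \<in> V \<Longrightarrow> l k x \<le> t k * P k x" and t: "0 \<le> t k" if "k \<in> Q" for k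
    using that by auto
  have "dominated_on V N (l k)" if k: "k \<in> Q" for k
  proof -
    obtain C where C: "\<And>x. x \<in> V \<Longrightarrow> P k x \<le> C * N x" using P(2)[OF k] by (auto simp: dominated_on_def)
    have "l k x \<le> (t k * C) * N x" if "x \<in> V" for x
      using l(2)[OF k that] mult_left_mono[OF C[OF that] t[OF k]] by simp
    then show ?thesis by (rule P1.Z.dominated_onI')
  qed
  then obtain \<phi> where \<phi>: "\<And>k. k \<in> Q \<Longrightarrow> \<phi> k \<in> W" "\<And>k x. k \<in> Q \<Longrightarrow> x \<in> V \<Longrightarrow> pr (\<phi> k) x = l k x"
    using P1.represent[OF l(1)] by metis
  have "(\<Sum>k\<in>Q. pr' (L' k w) (\<phi> k)) = 0"
    by (rule second_adjoint_annihilates[OF I L \<phi>(1) _ w]) (simp_all add: \<phi>(2) L_in annihilates)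
  then have "(\<Sum>k\<in>Q. l k (z k)) = (\<Sum>k\<in>Q. pr (\<phi> k) (z k) - pr' (L' k w) (\<phi> k))"
    using z by (simp add: \<phi>(2) sum_subtractf)
  also have "\<dots> \<le> (\<Sum>k\<in>Q. t k * \<rho> k)"
    using \<phi> l(2) t by (intro sum_mono polar) auto
  also have "\<dots> < 1" by (rule weighted_sum_less_1[OF Q t functionals(2) \<rho>])
  finally show False using at_z by simp
qed

lemma bidual_solves_norm:
  assumes L: "second_adjoint I L L'" and w: "w \<in> UNIV \<rightarrow> U" and \<epsilon>: "0 < \<epsilon>"
  shows "bidual_solves I w L L' (\<lambda>x. N x / (K (L' w) + \<epsilon>)) 0"
  unfolding bidual_solves_def
proof (intro conjI exI[of _ "K (L' w) / (K (L' w) + \<epsilon>)"] allI ballI impI L P1.Z.zero_in)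
  let ?c = "K (L' w) + \<epsilon>"
  note L'w = second_adjoint_in'[OF L w]
  have c_pos: "0 < ?c" using P2.W.N_nonneg[OF L'w] \<epsilon> by simp
  show "seminormed_space V sc (\<lambda>x. N x / ?c)" by (rule P1.Z.seminormed_space_divide[OF c_pos])
  show "dominated_on V N (\<lambda>x. N x / ?c)" by (rule P1.Z.dominated_onI'[of _ "1 / ?c"]) simp
  show "K (L' w) / ?c < 1" using c_pos \<epsilon> by simp
  fix t \<phi> assume t: "0 \<le> t" and \<phi>: "\<phi> \<in> W" and dominated: "\<forall>x\<in>V. pr \<phi> x \<le> t * (N x / ?c)"
  have "M \<phi> \<le> t / ?c" using dominated t c_pos by (intro P1.norm_le \<phi>) auto
  from mult_left_mono[OF this P2.W.N_nonneg[OF L'w]]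
  have "pr' (- L' w) \<phi> \<le> t * (K (L' w) / ?c)"
    using P2.pr_le[OF P2.W.minus_in[OF L'w] \<phi>] by (simp add: P2.W.N_minus[OF L'w] mult_ac)
  then show "pr \<phi> 0 - pr' (L' w) \<phi> \<le> t * (K (L' w) / ?c)"
    by (simp add: P1.pr_zero_right[OF \<phi>] P2.pr_minus_left[OF \<phi> L'w])
qed

lemma bidual_solves_eval:
  assumes i: "finite I" "i \<in> I" and w: "w i \<in> U" and \<psi>: "\<psi> \<in> W" and z: "z \<in> V" "pr \<psi> z = pr' (w i) \<psi>"
    and \<epsilon>: "0 < \<epsilon>"
  shows "bidual_solves I w (\<lambda>v. v i) (\<lambda>w. w i) (\<lambda>x. \<bar>pr \<psi> x\<bar> / \<epsilon>) z"
  unfolding bidual_solves_def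
proof (intro conjI exI[of _ 0] allI ballI impI z second_adjoint_proj i)
  show "seminormed_space V sc (\<lambda>x. \<bar>pr \<psi> x\<bar> / \<epsilon>)"
    by (rule seminormed_space.seminormed_space_divide[OF P1.seminormed_space_abs_pr[OF \<psi>] \<epsilon>])
  show "dominated_on V N (\<lambda>x. \<bar>pr \<psi> x\<bar> / \<epsilon>)"
    using divide_right_mono[OF P1.abs_pr_le[OF \<psi>], of _ \<epsilon>] \<epsilon>
    by (intro P1.Z.dominated_onI'[of _ "M \<psi> / \<epsilon>"]) simp
  fix t \<phi> assume \<phi>: "\<phi> \<in> W" and dominated: "\<forall>x\<in>V. pr \<phi> x \<le> t * (\<bar>pr \<psi> x\<bar> / \<epsilon>)"
  obtain a where "\<phi> = scW a \<psi>"
    using P1.pr_le_abs_pr_imp_multiple[OF \<phi> \<psi>, of "t / \<epsilon>"] dominated by auto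
  then show "pr \<phi> z - pr' (w i) \<phi> \<le> t * 0"
    using z \<psi> by (simp add: P1.pr_sc_left P2.pr_sc_right[OF w w])
qed simp

lemma pr_attains_pr':
  assumes u: "u \<in> U" and \<phi>: "\<phi> \<in> W"
  shows "\<exists>x\<in>V. pr \<phi> x = pr' u \<phi>"
  using P1.pr_attains[OF \<phi>, of "pr' u \<phi>"] P2.pr_zero_right[OF u] by blast

theorem Helly:
  fixes L :: "'k \<Rightarrow> ('i \<Rightarrow> 'a) \<Rightarrow> 'a"
  assumes I: "finite I" and Q: "finite Q" and J: "finite J" "J \<subseteq> I \<times> W"
    and L: "\<And>k. k \<in> Q \<Longrightarrow> second_adjoint I (L k) (L' k)" and w: "w \<in> UNIV \<rightarrow> U" and \<epsilon>: "0 < \<epsilon>"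
  shows "\<exists>v\<in>UNIV \<rightarrow> V. (\<forall>k\<in>Q. N (L k v) \<le> K (L' k w) + \<epsilon>) \<and>
    (\<forall>(i, \<phi>)\<in>J. \<bar>pr \<phi> (v i) - pr' (w i) \<phi>\<bar> \<le> \<epsilon>)"
proof -
  have w_in: "w i \<in> U" for i using w by auto
  have "\<forall>j\<in>J. \<exists>z\<in>V. pr (snd j) z = pr' (w (fst j)) (snd j)"
    using J(2) by (intro ballI pr_attains_pr' w_in) auto
  from bchoice[OF this[unfolded Bex_def]] obtain z
    where z: "\<forall>j\<in>J. z j \<in> V \<and> pr (snd j) (z j) = pr' (w (fst j)) (snd j)" ..
  let ?A = "case_sum L (\<lambda>j v. v (fst j))" and ?A' = "case_sum L' (\<lambda>j w. w (fst j))"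
  let ?P = "case_sum (\<lambda>k x. N x / (K (L' k w) + \<epsilon>)) (\<lambda>j x. \<bar>pr (snd j) x\<bar> / \<epsilon>)"
  let ?b = "case_sum (\<lambda>_. 0) z"
  have "\<exists>v\<in>UNIV \<rightarrow> V. \<forall>k\<in>Q <+> J. ?P k (?b k - ?A k v) < 1"
  proof (rule bidual_solves_imp_solvable[where L' = ?A', OF I _ w])
    show "finite (Q <+> J)" using Q J(1) by simp
    fix k assume "k \<in> Q <+> J"
    then consider (norm) q where "k = Inl q" "q \<in> Q"
      | (eval) i \<psi> where "k = Inr (i, \<psi>)" "(i, \<psi>) \<in> J" "i \<in> I" "\<psi> \<in> W"
      using J(2) by auto
    then show "bidual_solves I w (?A k) (?A' k) (?P k) (?b k)"
    proof cases
      case norm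
      then show ?thesis using bidual_solves_norm[OF L w \<epsilon>] by simp
    next
      case eval
      then show ?thesis using bidual_solves_eval[OF I _ w_in _ _ _ \<epsilon>] z by fastforce
    qed
  qed
  then obtain v where v: "v \<in> UNIV \<rightarrow> V" and less: "\<And>k. k \<in> Q <+> J \<Longrightarrow> ?P k (?b k - ?A k v) < 1" by blast
  have "N (L k v) \<le> K (L' k w) + \<epsilon>" if k: "k \<in> Q" for k
  proof -
    have "0 < K (L' k w) + \<epsilon>" using P2.W.N_nonneg[OF second_adjoint_in'[OF L[OF k] w]] \<epsilon> by simp
    then show ?thesis
      using less[OF InlI[OF k]] P1.Z.N_minus[OF second_adjoint_in[OF L[OF k] v]]
      by (simp add: divide_less_eq)
  qed
  moreover have "\<bar>pr \<phi> (v i) - pr' (w i) \<phi>\<bar> \<le> \<epsilon>" if j: "(i, \<phi>) \<in> J" for i \<phi>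
  proof -
    have "\<phi> \<in> W" "v i \<in> V" using j J(2) v by auto
    then show ?thesis
      using less[OF InrI[OF j]] bspec[OF z j] \<epsilon>
      by (simp add: P1.pr_diff_right divide_less_eq abs_minus_commute)
  qed
  ultimately show ?thesis using v by auto
qed

end

section \<open>Means of medians\<close>

definition med3 :: "real \<Rightarrow> real \<Rightarrow> real \<Rightarrow> real" where
  "med3 a b c = max (min a b) (min (max a b) c)"

definition med_mean :: "nat \<Rightarrow> (nat \<Rightarrow> real) \<Rightarrow> real" where
  "med_mean k x = (\<Sum>i<k. \<Sum>j<k. \<Sum>l<k. med3 (x i) (x j) (x l)) / real k ^ 3"

lemma med3_shift: "med3 (a + t) (b + t) (c + t) = med3 a b c + t"
  by (auto simp: med3_def max_def min_def)

lemma abs_med3_le: "\<bar>med3 a b c\<bar> \<le> \<bar>a\<bar> + \<bar>b\<bar> + \<bar>c\<bar>"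
  by (auto simp: med3_def max_def min_def)

lemma of_bool_le_med3:
  "(of_bool (r \<le> med3 a b c) :: real) =
     of_bool (r \<le> a) * of_bool (r \<le> b) + of_bool (r \<le> a) * of_bool (r \<le> c) + of_bool (r \<le> b) * of_bool (r \<le> c)
     - 2 * (of_bool (r \<le> a) * of_bool (r \<le> b) * of_bool (r \<le> c))"
  by (auto simp: med3_def)

lemma med_mean_shift:
  assumes "0 < k"
  shows "med_mean k (\<lambda>i. x i + t) = med_mean k x + t"
proof -
  have "(\<Sum>i<k. \<Sum>j<k. \<Sum>l<k. med3 (x i + t) (x j + t) (x l + t)) =
      (\<Sum>i<k. \<Sum>j<k. \<Sum>l<k. med3 (x i) (x j) (x l)) + real k ^ 3 * t"
    by (simp add: med3_shift sum.distrib power3_eq_cube)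
  then show ?thesis using assms by (simp add: med_mean_def field_simps)
qed

lemma med_mean_zero: "med_mean k (\<lambda>_. 0) = 0"
  by (simp add: med_mean_def med3_def)

lemma abs_med_mean_le:
  assumes k: "0 < k"
  shows "\<bar>med_mean k x\<bar> \<le> 3 / real k * (\<Sum>i<k. \<bar>x i\<bar>)"
proof -
  have "\<bar>\<Sum>i<k. \<Sum>j<k. \<Sum>l<k. med3 (x i) (x j) (x l)\<bar> \<le> (\<Sum>i<k. \<Sum>j<k. \<Sum>l<k. \<bar>med3 (x i) (x j) (x l)\<bar>)"
    by (intro order_trans[OF sum_abs] sum_mono) auto
  also have "\<dots> \<le> (\<Sum>i<k. \<Sum>j<k. \<Sum>l<k. \<bar>x i\<bar> + \<bar>x j\<bar> + \<bar>x l\<bar>)"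
    by (intro sum_mono abs_med3_le)
  also have "\<dots> = 3 * real k ^ 2 * (\<Sum>i<k. \<bar>x i\<bar>)"
    by (simp add: sum.distrib sum_distrib_left[symmetric] power2_eq_square)
  finally have "\<bar>\<Sum>i<k. \<Sum>j<k. \<Sum>l<k. med3 (x i) (x j) (x l)\<bar> / real k ^ 3 \<le>
      3 * real k ^ 2 * (\<Sum>i<k. \<bar>x i\<bar>) / real k ^ 3"
    by (rule divide_right_mono) simp
  also have "\<dots> = 3 / real k * (\<Sum>i<k. \<bar>x i\<bar>)"
    using k by (simp add: power2_eq_square power3_eq_cube)
  finally show ?thesis by (simp add: med_mean_def)
qed

definition smoothstep :: "real \<Rightarrow> real" where
  "smoothstep h = 3 * h\<^sup>2 - 2 * h ^ 3"

lemma Young_ineq: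
  fixes d v \<eta> :: real
  assumes v: "0 \<le> v" "v \<le> 1" and \<eta>: "0 < \<eta>"
  shows "3 * d * v \<le> \<eta> * v + 9 / (4 * \<eta>) * d\<^sup>2"
proof -
  have "0 \<le> (\<eta> * v - 3 * d / 2)\<^sup>2 / \<eta>" using \<eta> by simp
  also have "\<dots> = \<eta> * v\<^sup>2 - 3 * d * v + 9 / (4 * \<eta>) * d\<^sup>2"
    using \<eta> by (simp add: power2_eq_square field_simps)
  also have "\<eta> * v\<^sup>2 \<le> \<eta> * v"
    using \<eta> v by (intro mult_left_mono) (auto simp: power2_eq_square mult_left_le)
  finally show ?thesis by simp
qed

lemma abs_smoothstep_diff_le:
  assumes h: "0 \<le> h" "h \<le> 1" and h': "0 \<le> h'" "h' \<le> 1" and \<eta>: "0 < \<eta>" "\<eta> \<le> 1"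
  shows "\<bar>smoothstep h - smoothstep h'\<bar> \<le> \<eta> * ((h - h\<^sup>2) + (h' - h'\<^sup>2)) + 6 / \<eta> * (h - h')\<^sup>2"
proof -
  define d where "d = \<bar>h - h'\<bar>"
  have d: "0 \<le> d" "d \<le> 1" using h h' by (auto simp: d_def)
  have "0 \<le> t - t\<^sup>2 \<and> t - t\<^sup>2 \<le> 1" if "0 \<le> t" "t \<le> 1" for t :: real
    using that zero_le_power2[of t] mult_left_le[of t t] unfolding power2_eq_square by linarith
  then have v: "0 \<le> h - h\<^sup>2" "h - h\<^sup>2 \<le> 1" "0 \<le> h' - h'\<^sup>2" "h' - h'\<^sup>2 \<le> 1"
    using h h' by auto
  have "smoothstep h - smoothstep h' = (h - h') * (3 * (h - h\<^sup>2) + 3 * (h' - h'\<^sup>2) + (h - h')\<^sup>2)"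
    by (simp add: smoothstep_def power2_eq_square power3_eq_cube algebra_simps)
  then have "\<bar>smoothstep h - smoothstep h'\<bar> = d * (3 * (h - h\<^sup>2) + 3 * (h' - h'\<^sup>2) + d\<^sup>2)"
    using v by (simp add: abs_mult d_def)
  also have "\<dots> = 3 * d * (h - h\<^sup>2) + 3 * d * (h' - h'\<^sup>2) + d * d\<^sup>2" by (simp add: algebra_simps)
  also have "\<dots> \<le> (\<eta> * (h - h\<^sup>2) + 9 / (4 * \<eta>) * d\<^sup>2) + (\<eta> * (h' - h'\<^sup>2) + 9 / (4 * \<eta>) * d\<^sup>2) + 1 * d\<^sup>2"
    using v d \<eta>(1) by (intro add_mono mult_right_mono Young_ineq) auto
  also have "\<dots> \<le> \<eta> * ((h - h\<^sup>2) + (h' - h'\<^sup>2)) + 6 / \<eta> * d\<^sup>2"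
  proof -
    have "9 / (4 * \<eta>) + 9 / (4 * \<eta>) + 1 \<le> 6 / \<eta>" using \<eta> by (simp add: field_simps)
    from mult_right_mono[OF this, of "d\<^sup>2"] show ?thesis by (simp add: algebra_simps)
  qed
  finally show ?thesis by (simp add: d_def)
qed

definition pair_mean :: "nat \<Rightarrow> ('a \<Rightarrow> 'b \<Rightarrow> real) \<Rightarrow> (nat \<Rightarrow> 'a) \<Rightarrow> (nat \<Rightarrow> 'b) \<Rightarrow> real" where
  "pair_mean k D x y = (\<Sum>i<k. \<Sum>j<k. D (x i) (y j)) / (real k)\<^sup>2"

abbreviation mean_dist :: "('a::minus \<Rightarrow> real) \<Rightarrow> nat \<Rightarrow> (nat \<Rightarrow> 'a) \<Rightarrow> (nat \<Rightarrow> 'a) \<Rightarrow> real" where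
  "mean_dist N k \<equiv> pair_mean k (\<lambda>u v. N (u - v))"

lemma pair_mean_cong:
  "(\<And>i j. i < k \<Longrightarrow> j < k \<Longrightarrow> D (x i) (y j) = E (u i) (v j)) \<Longrightarrow> pair_mean k D x y = pair_mean k E u v"
  by (simp add: pair_mean_def)

lemma pair_mean_commute: "(\<And>u v. D u v = D v u) \<Longrightarrow> pair_mean k D x y = pair_mean k D y x"
  unfolding pair_mean_def by (subst sum.swap) simp

lemma pair_mean_le_add:
  assumes "0 < k" and D_le: "\<And>i j. i < k \<Longrightarrow> j < k \<Longrightarrow> D (x i) (y j) \<le> E (u i) (v j) + c"
  shows "pair_mean k D x y \<le> pair_mean k E u v + c"
proof -
  have "(\<Sum>i<k. \<Sum>j<k. D (x i) (y j)) \<le> (\<Sum>i<k. \<Sum>j<k. E (u i) (v j) + c)"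
    by (intro sum_mono D_le) auto
  also have "\<dots> = (\<Sum>i<k. \<Sum>j<k. E (u i) (v j)) + (real k)\<^sup>2 * c"
    by (simp add: sum.distrib power2_eq_square)
  finally show ?thesis using assms(1) by (simp add: pair_mean_def field_simps)
qed

definition upper_fraction :: "nat \<Rightarrow> (nat \<Rightarrow> real) \<Rightarrow> real \<Rightarrow> real" where
  "upper_fraction k x r = (\<Sum>i<k. of_bool (r \<le> x i)) / real k"

lemma upper_fraction_bounds:
  shows "0 \<le> upper_fraction k x r" and "upper_fraction k x r \<le> 1"
proof -
  have "(\<Sum>i<k. of_bool (r \<le> x i)) \<le> (\<Sum>i<k. 1 :: real)" by (intro sum_mono) auto
  then show "upper_fraction k x r \<le> 1" by (auto simp: upper_fraction_def divide_le_eq_1)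
qed (auto simp: upper_fraction_def intro!: divide_nonneg_nonneg sum_nonneg)

lemma sum_of_bool_le: "0 < k \<Longrightarrow> (\<Sum>i<k. of_bool (r \<le> x i)) = real k * upper_fraction k x r"
  by (simp add: upper_fraction_def)

lemma has_integral_of_bool_le:
  fixes a B :: real
  assumes "\<bar>a\<bar> \<le> B"
  shows "((\<lambda>r. of_bool (r \<le> a)) has_integral (a + B)) {- B..B}"
proof -
  have "((\<lambda>r. 1 :: real) has_integral (a + B)) {- B..a}"
    using has_integral_const_real[of "1 :: real" "- B" a] assms by (simp add: abs_le_iff)
  moreover have "{- B..a} \<subseteq> {- B..B}" using assms by auto
  ultimately have "((\<lambda>r. if r \<in> {- B..a} then 1 else 0 :: real) has_integral (a + B)) {- B..B}"
    by (subst has_integral_restrict)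
  then show ?thesis by (rule has_integral_eq[rotated]) auto
qed

lemma has_integral_med_mean:
  assumes k: "0 < k" and B: "\<And>i. i < k \<Longrightarrow> \<bar>x i\<bar> \<le> B"
  shows "((\<lambda>r. smoothstep (upper_fraction k x r)) has_integral (med_mean k x + B)) {- B..B}"
proof -
  let ?f = "\<lambda>r. (\<Sum>i<k. \<Sum>j<k. \<Sum>l<k. of_bool (r \<le> med3 (x i) (x j) (x l))) / real k ^ 3"
  have "\<bar>med3 (x i) (x j) (x l)\<bar> \<le> B" if "i < k" "j < k" "l < k" for i j l
    using B[OF that(1)] B[OF that(2)] B[OF that(3)] by (auto simp: med3_def max_def min_def)
  then have "(?f has_integral (\<Sum>i<k. \<Sum>j<k. \<Sum>l<k. med3 (x i) (x j) (x l) + B) / real k ^ 3) {- B..B}"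
    by (intro has_integral_divide has_integral_sum has_integral_of_bool_le) auto
  moreover have "(\<Sum>i<k. \<Sum>j<k. \<Sum>l<k. med3 (x i) (x j) (x l) + B) / real k ^ 3 = med_mean k x + B"
    using k by (simp add: med_mean_def sum.distrib field_simps power3_eq_cube)
  moreover have "?f r = smoothstep (upper_fraction k x r)" for r
  proof -
    let ?b = "\<lambda>i. of_bool (r \<le> x i) :: real"
    have "(\<Sum>i<k. \<Sum>j<k. \<Sum>l<k. of_bool (r \<le> med3 (x i) (x j) (x l))) =
        (\<Sum>i<k. \<Sum>j<k. \<Sum>l<k. ?b i * ?b j) + (\<Sum>i<k. \<Sum>j<k. \<Sum>l<k. ?b i * ?b l)
        + (\<Sum>i<k. \<Sum>j<k. \<Sum>l<k. ?b j * ?b l) - 2 * (\<Sum>i<k. \<Sum>j<k. \<Sum>l<k. ?b i * ?b j * ?b l)"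
      unfolding of_bool_le_med3 sum.distrib sum_subtractf sum_distrib_left ..
    also have "\<dots> = real k ^ 3 * smoothstep (upper_fraction k x r)"
      by (simp only: sum_distrib_left[symmetric] sum_distrib_right[symmetric] sum_of_bool_le[OF k]
            sum_constant card_lessThan)
         (simp add: smoothstep_def power2_eq_square power3_eq_cube algebra_simps)
    finally show ?thesis using k by simp
  qed
  ultimately show ?thesis by simp
qed

lemma has_integral_mean_dist:
  assumes k: "0 < k" and B: "\<And>i. i < k \<Longrightarrow> \<bar>x i\<bar> \<le> B" "\<And>i. i < k \<Longrightarrow> \<bar>z i\<bar> \<le> B"
  shows "((\<lambda>r. upper_fraction k x r + upper_fraction k z r - 2 * (upper_fraction k x r * upper_fraction k z r))
    has_integral mean_dist abs k x z) {- B..B}"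
proof -
  define between :: "real \<Rightarrow> real \<Rightarrow> real \<Rightarrow> real"
    where "between a b r = of_bool (r \<le> a) + of_bool (r \<le> b) - 2 * (of_bool (r \<le> a) * of_bool (r \<le> b))" for a b r
  have between: "(between a b has_integral \<bar>a - b\<bar>) {- B..B}" if "\<bar>a\<bar> \<le> B" "\<bar>b\<bar> \<le> B" for a b
  proof -
    have "((\<lambda>r. of_bool (r \<le> max a b) - of_bool (r \<le> min a b)) has_integral (max a b + B) - (min a b + B)) {- B..B}"
      using that by (intro has_integral_diff has_integral_of_bool_le) auto
    moreover have "of_bool (r \<le> max a b) - of_bool (r \<le> min a b) = between a b r" for r
      by (auto simp: between_def max_def min_def)
    moreover have "(max a b + B) - (min a b + B) = \<bar>a - b\<bar>" by auto
    ultimately show ?thesis by simp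
  qed
  have "((\<lambda>r. pair_mean k (\<lambda>a b. between a b r) x z) has_integral mean_dist abs k x z) {- B..B}"
    unfolding pair_mean_def using B by (intro has_integral_divide has_integral_sum between) auto
  moreover have "pair_mean k (\<lambda>a b. between a b r) x z =
      upper_fraction k x r + upper_fraction k z r - 2 * (upper_fraction k x r * upper_fraction k z r)" for r
  proof -
    have "(\<Sum>i<k. \<Sum>j<k. between (x i) (z j) r) = (\<Sum>i<k. \<Sum>j<k. of_bool (r \<le> x i)) +
        (\<Sum>i<k. \<Sum>j<k. of_bool (r \<le> z j)) - 2 * (\<Sum>i<k. \<Sum>j<k. of_bool (r \<le> x i) * of_bool (r \<le> z j))"
      unfolding between_def sum.distrib sum_subtractf sum_distrib_left ..
    also have "\<dots> = (real k)\<^sup>2 *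
        (upper_fraction k x r + upper_fraction k z r - 2 * (upper_fraction k x r * upper_fraction k z r))"
      by (simp only: sum_distrib_left[symmetric] sum_distrib_right[symmetric] sum_of_bool_le[OF k]
            sum_constant card_lessThan)
         (simp add: power2_eq_square algebra_simps)
    finally show ?thesis using k by (simp add: pair_mean_def)
  qed
  ultimately show ?thesis by simp
qed

text \<open>By the two integral formulas, this is an integrated form of \<open>abs_smoothstep_diff_le\<close>.\<close>

lemma abs_med_mean_diff_le:
  assumes k: "0 < k" and \<eta>: "0 < \<eta>" "\<eta> \<le> 1"
  shows "\<bar>med_mean k x - med_mean k z\<bar> \<le> \<eta> / 2 * (mean_dist abs k x x + mean_dist abs k z z)
    + 6 / \<eta> * (mean_dist abs k z x - (mean_dist abs k x x + mean_dist abs k z z) / 2)"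
    (is "_ \<le> ?R")
proof -
  define B where "B = (\<Sum>i<k. \<bar>x i\<bar> + \<bar>z i\<bar>)"
  have B: "\<bar>x i\<bar> \<le> B" "\<bar>z i\<bar> \<le> B" if "i < k" for i
    using that member_le_sum[of i "{..<k}" "\<lambda>i. \<bar>x i\<bar> + \<bar>z i\<bar>"] by (auto simp: B_def)
  define h where "h = upper_fraction k x"
  define h' where "h' = upper_fraction k z"
  define d where "d r = smoothstep (h r) - smoothstep (h' r)" for r
  define rhs where "rhs r = \<eta> / 2 * ((h r + h r - 2 * (h r * h r)) + (h' r + h' r - 2 * (h' r * h' r))) +
    6 / \<eta> * ((h' r + h r - 2 * (h' r * h r)) -
      ((h r + h r - 2 * (h r * h r)) + (h' r + h' r - 2 * (h' r * h' r))) / 2)" for r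
  have "(d has_integral (med_mean k x + B) - (med_mean k z + B)) {- B..B}"
    unfolding d_def h_def h'_def using k B by (intro has_integral_diff has_integral_med_mean)
  then have d_integral: "(d has_integral (med_mean k x - med_mean k z)) {- B..B}" by simp
  have rhs_integral: "(rhs has_integral ?R) {- B..B}"
    unfolding rhs_def h_def h'_def using k B
    by (intro has_integral_add has_integral_diff has_integral_divide has_integral_mult_right has_integral_mean_dist)
  have abs_le: "\<bar>d r\<bar> \<le> rhs r" for r
  proof -
    have "rhs r = \<eta> * ((h r - (h r)\<^sup>2) + (h' r - (h' r)\<^sup>2)) + 6 / \<eta> * (h r - h' r)\<^sup>2"
      using \<eta> by (simp add: rhs_def field_simps power2_eq_square)
    then show ?thesis
      unfolding d_def h_def h'_def
      using abs_smoothstep_diff_le[OF upper_fraction_bounds upper_fraction_bounds \<eta>] by simp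
  qed
  have "med_mean k x - med_mean k z \<le> ?R"
    by (rule has_integral_le[OF d_integral rhs_integral]) (use abs_le in \<open>auto simp: abs_le_iff\<close>)
  moreover have "- (med_mean k x - med_mean k z) \<le> ?R"
    by (rule has_integral_le[OF has_integral_neg[OF d_integral] rhs_integral]) (use abs_le in \<open>auto simp: abs_le_iff\<close>)
  ultimately show ?thesis by linarith
qed

section \<open>Approximate means\<close>

definition discrepancy :: "('a::minus \<Rightarrow> real) \<Rightarrow> real \<Rightarrow> nat \<Rightarrow> (nat \<Rightarrow> 'a) \<Rightarrow> (nat \<Rightarrow> 'a) \<Rightarrow> real" where
  "discrepancy N \<eta> k x z = \<eta> * mean_dist N k x x + 6 / \<eta> * (mean_dist N k z x - mean_dist N k x x)"

text \<open>A quantitative substitute for a barycentre of the \<open>x i\<close> that is almost fixed by the affine maps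
  \<open>y \<mapsto> a g y + b g\<close> as soon as these almost preserve the uniform distribution on the \<open>x i\<close>, measured
  by the energy distance.  In an \<open>\<ell>\<^sup>1\<close> space of which the \<open>a g\<close> permute the coordinates, the mean of
  the medians of all triples has this property; the formulation is chosen so that it passes to biduals.\<close>

definition approx_mean :: "'a::ab_group_add set \<Rightarrow> ('a \<Rightarrow> real) \<Rightarrow> ('g \<Rightarrow> 'a \<Rightarrow> 'a) \<Rightarrow> bool" where
  "approx_mean V N a \<longleftrightarrow> (\<forall>(k::nat) x F b \<eta> \<epsilon> R.
     0 < k \<longrightarrow> x \<in> UNIV \<rightarrow> V \<longrightarrow> (\<forall>i<k. N (x i) \<le> R) \<longrightarrow> finite F \<longrightarrow> b \<in> UNIV \<rightarrow> V \<longrightarrow>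
     0 < \<eta> \<longrightarrow> \<eta> \<le> 1 \<longrightarrow> 0 < \<epsilon> \<longrightarrow>
     (\<exists>y\<in>V. N y \<le> 3 * R + \<epsilon> \<and>
       (\<forall>g\<in>F. N (a g y + b g - y) \<le> discrepancy N \<eta> k x (\<lambda>i. a g (x i) + b g) + \<epsilon>)))"

lemma has_sum_sum:
  fixes f :: "'i \<Rightarrow> 'a \<Rightarrow> 'b::topological_comm_monoid_add"
  assumes "\<And>i. i \<in> I \<Longrightarrow> (f i has_sum s i) A"
  shows "((\<lambda>x. \<Sum>i\<in>I. f i x) has_sum (\<Sum>i\<in>I. s i)) A"
  using assms by (induction I rule: infinite_finite_induct) (auto intro: has_sum_add)

lemma has_sum_diff:
  fixes f g :: "'a \<Rightarrow> real"
  assumes "(f has_sum s) A" "(g has_sum t) A"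
  shows "((\<lambda>x. f x - g x) has_sum (s - t)) A"
  using has_sum_add[OF assms(1) has_sum_uminusI[OF assms(2)]] by simp

lemma has_sum_pair_mean:
  assumes "\<And>i j. i < k \<Longrightarrow> j < k \<Longrightarrow> ((\<lambda>w. d w (x i) (y j)) has_sum D (x i) (y j)) A"
  shows "((\<lambda>w. pair_mean k (d w) x y) has_sum pair_mean k D x y) A"
  unfolding pair_mean_def divide_inverse
  using assms by (intro has_sum_cmult_left has_sum_sum) auto

locale l1_coordinates = seminormed_space V sc N
  for V :: "'a::ab_group_add set" and sc N +
  fixes coord :: "'a \<Rightarrow> 'w \<Rightarrow> real" and \<Omega> :: "'w set"
  assumes coord_add: "x \<in> V \<Longrightarrow> y \<in> V \<Longrightarrow> coord (x + y) w = coord x w + coord y w"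
    and coord_outside: "x \<in> V \<Longrightarrow> w \<notin> \<Omega> \<Longrightarrow> coord x w = 0"
    and coord_has_sum: "x \<in> V \<Longrightarrow> ((\<lambda>w. \<bar>coord x w\<bar>) has_sum N x) UNIV"
    and coord_surj: "(\<And>w. w \<notin> \<Omega> \<Longrightarrow> f w = 0) \<Longrightarrow> (\<lambda>w. \<bar>f w\<bar>) summable_on UNIV \<Longrightarrow> \<exists>x\<in>V. coord x = f"
begin

lemma coord_diff: "x \<in> V \<Longrightarrow> y \<in> V \<Longrightarrow> coord (x - y) w = coord x w - coord y w"
  using coord_add[OF diff_in, of x y y] by simp

lemma has_sum_mean_dist:
  assumes "x \<in> UNIV \<rightarrow> V" "z \<in> UNIV \<rightarrow> V"
  shows "((\<lambda>w. mean_dist abs k (\<lambda>i. coord (x i) w) (\<lambda>i. coord (z i) w)) has_sum mean_dist N k x z) UNIV"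
proof -
  have "((\<lambda>w. \<bar>coord (x i) w - coord (z j) w\<bar>) has_sum N (x i - z j)) UNIV" for i j
    using coord_has_sum[OF diff_in, of "x i" "z j"] assms by (simp add: coord_diff Pi_iff)
  then have "((\<lambda>w. pair_mean k (\<lambda>u v. \<bar>coord u w - coord v w\<bar>) x z) has_sum mean_dist N k x z) UNIV"
    by (rule has_sum_pair_mean)
  then show ?thesis by (simp add: pair_mean_def)
qed

lemma ex_med_mean:
  assumes k: "0 < k" and x: "x \<in> UNIV \<rightarrow> V" and R: "\<And>i. i < k \<Longrightarrow> N (x i) \<le> R"
  obtains y where "y \<in> V" "\<And>w. coord y w = med_mean k (\<lambda>i. coord (x i) w)" "N y \<le> 3 * R"
proof -
  let ?f = "\<lambda>w. med_mean k (\<lambda>i. coord (x i) w)"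
  have bound: "\<bar>?f w\<bar> \<le> 3 / real k * (\<Sum>i<k. \<bar>coord (x i) w\<bar>)" for w
    by (rule abs_med_mean_le[OF k])
  have bound_has_sum: "((\<lambda>w. 3 / real k * (\<Sum>i<k. \<bar>coord (x i) w\<bar>)) has_sum (3 / real k * (\<Sum>i<k. N (x i)))) UNIV"
    using x by (intro has_sum_cmult_right has_sum_sum coord_has_sum) auto
  have summable: "(\<lambda>w. \<bar>?f w\<bar>) summable_on UNIV"
    by (rule summable_on_comparison_test[OF has_sum_imp_summable[OF bound_has_sum] bound]) auto
  have "?f w = 0" if "w \<notin> \<Omega>" for w
    using coord_outside[OF _ that] x by (simp add: Pi_iff med_mean_zero)
  then obtain y where y: "y \<in> V" "coord y = ?f" using coord_surj[OF _ summable] by blast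
  have "N y \<le> 3 / real k * (\<Sum>i<k. N (x i))"
    by (rule has_sum_mono[OF coord_has_sum[OF y(1)] bound_has_sum]) (unfold y(2), rule bound)
  also have "\<dots> \<le> 3 / real k * (\<Sum>i<k. R)" using R by (intro mult_left_mono sum_mono) auto
  also have "\<dots> = 3 * R" using k by simp
  finally show ?thesis using that y by simp
qed

lemma norm_med_mean_diff_le:
  assumes k: "0 < k" and \<eta>: "0 < \<eta>" "\<eta> \<le> 1" and x: "x \<in> UNIV \<rightarrow> V" and z: "z \<in> UNIV \<rightarrow> V"
    and isometric: "\<And>i j. N (z i - z j) = N (x i - x j)"
    and u: "u \<in> V" "\<And>w. coord u w = med_mean k (\<lambda>i. coord (z i) w) - med_mean k (\<lambda>i. coord (x i) w)"
  shows "N u \<le> discrepancy N \<eta> k x z"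
proof -
  let ?xx = "mean_dist N k x x" and ?zz = "mean_dist N k z z" and ?zx = "mean_dist N k z x"
  let ?d = "\<lambda>x z w. mean_dist abs k (\<lambda>i. coord (x i) w) (\<lambda>i. coord (z i) w)"
  let ?bound = "\<lambda>w. \<eta> / 2 * (?d x x w + ?d z z w) + 6 / \<eta> * (?d z x w - 1 / 2 * (?d x x w + ?d z z w))"
  have bound_has_sum: "(?bound has_sum (\<eta> / 2 * (?xx + ?zz) + 6 / \<eta> * (?zx - 1 / 2 * (?xx + ?zz)))) UNIV"
    by (intro has_sum_add has_sum_diff has_sum_cmult_right has_sum_mean_dist x z)
  have "\<bar>coord u w\<bar> \<le> ?bound w" for w
    using abs_med_mean_diff_le[OF k \<eta>, of "\<lambda>i. coord (x i) w" "\<lambda>i. coord (z i) w"]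
    by (simp add: u(2) abs_minus_commute)
  then have "N u \<le> \<eta> / 2 * (?xx + ?zz) + 6 / \<eta> * (?zx - 1 / 2 * (?xx + ?zz))"
    by (rule has_sum_mono[OF coord_has_sum[OF u(1)] bound_has_sum])
  also have "?zz = ?xx" by (rule pair_mean_cong) (rule isometric)
  finally show ?thesis by (simp add: discrepancy_def)
qed

theorem approx_mean_l1:
  fixes a :: "'g \<Rightarrow> 'a \<Rightarrow> 'a" and \<tau> :: "'g \<Rightarrow> 'w \<Rightarrow> 'w"
  assumes a: "\<And>g x. x \<in> V \<Longrightarrow> a g x \<in> V"
    and a_add: "\<And>g x y. x \<in> V \<Longrightarrow> y \<in> V \<Longrightarrow> a g (x + y) = a g x + a g y"
    and a_iso: "\<And>g x. x \<in> V \<Longrightarrow> N (a g x) = N x"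
    and a_coord: "\<And>g x w. x \<in> V \<Longrightarrow> coord (a g x) w = coord x (\<tau> g w)"
  shows "approx_mean V N a"
  unfolding approx_mean_def
proof (intro allI impI)
  fix k :: nat and x :: "nat \<Rightarrow> 'a" and F :: "'g set" and b :: "'g \<Rightarrow> 'a" and \<eta> \<epsilon> R :: real
  assume k: "0 < k" and x: "x \<in> UNIV \<rightarrow> V" and R: "\<forall>i<k. N (x i) \<le> R" and b: "b \<in> UNIV \<rightarrow> V"
    and \<eta>: "0 < \<eta>" "\<eta> \<le> 1" and \<epsilon>: "0 < \<epsilon>"
  have x_in: "x i \<in> V" and b_in: "b g \<in> V" for i g using x b by auto
  obtain y where y: "y \<in> V" "\<And>w. coord y w = med_mean k (\<lambda>i. coord (x i) w)" "N y \<le> 3 * R"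
    using ex_med_mean[OF k x] R by blast
  have "N (a g y + b g - y) \<le> discrepancy N \<eta> k x (\<lambda>i. a g (x i) + b g)" for g
  proof (rule norm_med_mean_diff_le[OF k \<eta> x])
    show "(\<lambda>i. a g (x i) + b g) \<in> UNIV \<rightarrow> V" using a b_in x_in add_in by simp
    show "N (a g (x i) + b g - (a g (x j) + b g)) = N (x i - x j)" for i j
      using a_add[OF diff_in x_in, OF x_in x_in, of g i j j] a_iso[OF diff_in, OF x_in x_in, of g i j] by simp
    show "a g y + b g - y \<in> V" by (intro diff_in add_in a y(1) b_in)
    show "coord (a g y + b g - y) w =
        med_mean k (\<lambda>i. coord (a g (x i) + b g) w) - med_mean k (\<lambda>i. coord (x i) w)" for w
      by (simp add: coord_diff coord_add add_in a a_coord x_in b_in y(1,2) med_mean_shift[OF k])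
  qed
  then show "\<exists>y\<in>V. N y \<le> 3 * R + \<epsilon> \<and>
      (\<forall>g\<in>F. N (a g y + b g - y) \<le> discrepancy N \<eta> k x (\<lambda>i. a g (x i) + b g) + \<epsilon>)"
    using y(1,3) \<epsilon> by (intro bexI[of _ y] conjI ballI) (auto intro: add_increasing2)
qed

end

lemma discrepancy_le_add:
  assumes k: "0 < k" and \<eta>: "0 < \<eta>" "\<eta> \<le> 1" and \<delta>: "0 \<le> \<delta>"
    and upper: "\<And>i j. i < k \<Longrightarrow> j < k \<Longrightarrow> N (z i - x j) \<le> N' (z' i - x' j) + \<delta>"
    and lower: "\<And>i j. i < k \<Longrightarrow> j < k \<Longrightarrow> N' (x' i - x' j) \<le> N (x i - x j) + 3 * \<delta>"
  shows "discrepancy N \<eta> k x z \<le> discrepancy N' \<eta> k x' z' + 24 / \<eta> * \<delta>"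
proof -
  define A A' where "A = mean_dist N k x x" and "A' = mean_dist N' k x' x'"
  define B B' where "B = mean_dist N k z x" and "B' = mean_dist N' k z' x'"
  have "1 \<le> 1 / \<eta>" using \<eta> by simp
  then have coeff: "0 \<le> 6 / \<eta> - \<eta>" "6 / \<eta> - \<eta> \<le> 6 / \<eta>" using \<eta> by linarith+
  have "B \<le> B' + \<delta>" unfolding B_def B'_def using k upper by (rule pair_mean_le_add)
  then have "6 / \<eta> * (B - B') \<le> 6 / \<eta> * \<delta>" using \<eta> by (intro mult_left_mono) auto
  moreover have "A' \<le> A + 3 * \<delta>" unfolding A_def A'_def using k lower by (rule pair_mean_le_add)
  then have "(6 / \<eta> - \<eta>) * (A' - A) \<le> 6 / \<eta> * (3 * \<delta>)"
    using coeff \<delta> by (intro order_trans[OF mult_left_mono mult_right_mono]) auto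
  moreover have "\<eta> * A + 6 / \<eta> * (B - A) - (\<eta> * A' + 6 / \<eta> * (B' - A')) =
      (6 / \<eta> - \<eta>) * (A' - A) + 6 / \<eta> * (B - B')"
    by (simp add: algebra_simps diff_divide_distrib)
  ultimately show ?thesis unfolding discrepancy_def A_def A'_def B_def B'_def by simp
qed

lemma (in dual_pair) displacement_bound_compact:
  fixes T :: "'g \<Rightarrow> 'b \<Rightarrow> 'b" and T' :: "'g \<Rightarrow> 'a \<Rightarrow> 'a"
  assumes T: "\<And>g \<phi>. \<phi> \<in> W \<Longrightarrow> T g \<phi> \<in> W" and T': "\<And>g x. x \<in> V \<Longrightarrow> T' g x \<in> V"
    and adjoint: "\<And>g \<phi> x. \<phi> \<in> W \<Longrightarrow> x \<in> V \<Longrightarrow> pr (T g \<phi>) x = pr \<phi> (T' g x)"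
    and b: "b \<in> UNIV \<rightarrow> W" and c_nonneg: "\<And>g. g \<in> F \<Longrightarrow> 0 \<le> c g"
    and finite: "\<And>J \<epsilon>. finite J \<Longrightarrow> J \<subseteq> F \<times> V \<Longrightarrow> 0 < \<epsilon> \<Longrightarrow>
      \<exists>\<phi>\<in>W. M \<phi> \<le> R \<and> (\<forall>(g, x)\<in>J. pr \<phi> (T' g x - x) + pr (b g) x \<le> c g * N x + \<epsilon>)"
  obtains \<phi> where "\<phi> \<in> W" "M \<phi> \<le> R" "\<forall>g\<in>F. M (T g \<phi> + b g - \<phi>) \<le> c g"
proof -
  define constraint where "constraint = (\<lambda>(g, x). (T' g x - x, c g * N x - pr (b g) x))"
  obtain \<phi> where \<phi>: "\<phi> \<in> W" "M \<phi> \<le> R" and constraints: "\<And>z d. (z, d) \<in> constraint ` (F \<times> V) \<Longrightarrow> pr \<phi> z \<le> d"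
  proof (rule weak_star_finite_intersection[of "constraint ` (F \<times> V)" R])
    show "z \<in> V" if "(z, d) \<in> constraint ` (F \<times> V)" for z d
      using that T' Z.diff_in by (auto simp: constraint_def)
    fix G \<epsilon> assume "finite G" "G \<subseteq> constraint ` (F \<times> V)" and \<epsilon>: "0 < (\<epsilon> :: real)"
    then obtain J where J: "finite J" "J \<subseteq> F \<times> V" and G: "G = constraint ` J"
      using finite_subset_image by metis
    obtain \<phi> where "\<phi> \<in> W" "M \<phi> \<le> R" "\<forall>(g, x)\<in>J. pr \<phi> (T' g x - x) + pr (b g) x \<le> c g * N x + \<epsilon>"
      using finite[OF J \<epsilon>] by blast
    then show "\<exists>\<phi>\<in>W. M \<phi> \<le> R \<and> (\<forall>(z, d)\<in>G. pr \<phi> z \<le> d + \<epsilon>)"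
      by (intro bexI[of _ \<phi>]) (force simp: G constraint_def)+
  qed blast
  have "M (T g \<phi> + b g - \<phi>) \<le> c g" if g: "g \<in> F" for g
  proof (rule norm_le[OF _ c_nonneg[OF g]])
    have b_in: "b g \<in> W" using b by auto
    show "T g \<phi> + b g - \<phi> \<in> W" by (intro W.diff_in W.add_in T \<phi>(1) b_in)
    fix x assume x: "x \<in> V"
    have "pr (T g \<phi> + b g - \<phi>) x = pr \<phi> (T' g x - x) + pr (b g) x"
      using \<phi>(1) x b_in by (simp add: T T' W.add_in pr_diff_left pr_diff_right pr_add_left adjoint)
    also have "\<dots> \<le> c g * N x"
      using constraints[of "T' g x - x" "c g * N x - pr (b g) x"] g x by (force simp: constraint_def)
    finally show "pr (T g \<phi> + b g - \<phi>) x \<le> c g * N x" .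
  qed
  with \<phi> show ?thesis using that[of \<phi>] by blast
qed

locale bidual_action = bidual_pair V sc N W scW M pr U scU K pr'
  for V :: "'a::ab_group_add set" and sc and N and W :: "'b::ab_group_add set" and scW M pr
    and U :: "'c::ab_group_add set" and scU K pr' +
  fixes a :: "'g \<Rightarrow> 'a \<Rightarrow> 'a" and a' :: "'g \<Rightarrow> 'b \<Rightarrow> 'b" and a'' :: "'g \<Rightarrow> 'c \<Rightarrow> 'c"
  assumes a_in: "x \<in> V \<Longrightarrow> a g x \<in> V"
    and a_add: "x \<in> V \<Longrightarrow> y \<in> V \<Longrightarrow> a g (x + y) = a g x + a g y"
    and a'_in: "\<phi> \<in> W \<Longrightarrow> a' g \<phi> \<in> W"
    and a''_in: "u \<in> U \<Longrightarrow> a'' g u \<in> U"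
    and pr_a: "\<phi> \<in> W \<Longrightarrow> x \<in> V \<Longrightarrow> pr \<phi> (a g x) = pr (a' g \<phi>) x"
    and pr'_a'': "u \<in> U \<Longrightarrow> \<phi> \<in> W \<Longrightarrow> pr' (a'' g u) \<phi> = pr' u (a' g \<phi>)"
begin

lemma Helly_affine:
  fixes x :: "nat \<Rightarrow> 'c" and b :: "'g \<Rightarrow> 'c"
  assumes F: "finite F" and X: "finite X" "X \<subseteq> {..<k} \<times> W" and J: "finite J" "J \<subseteq> F \<times> W"
    and x: "x \<in> UNIV \<rightarrow> U" and b: "b \<in> UNIV \<rightarrow> U" and \<delta>: "0 < \<delta>"
  obtains x' b' where "x' \<in> UNIV \<rightarrow> V" "b' \<in> UNIV \<rightarrow> V" "\<forall>i<k. N (x' i) \<le> K (x i) + \<delta>"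
    "\<forall>g\<in>F. \<forall>i<k. \<forall>j<k. N (a g (x' i) + b' g - x' j) \<le> K (a'' g (x i) + b g - x j) + \<delta>"
    "\<forall>(i, \<phi>)\<in>X. \<bar>pr \<phi> (x' i) - pr' (x i) \<phi>\<bar> \<le> \<delta>" "\<forall>(g, \<phi>)\<in>J. \<bar>pr \<phi> (b' g) - pr' (b g) \<phi>\<bar> \<le> \<delta>"
proof -
  define I where "I = {..<k} <+> F"
  define Q where "Q = {..<k} <+> F \<times> {..<k} \<times> {..<k}"
  define E where "E = map_prod Inl id ` X \<union> map_prod Inr id ` J"
  define w where "w = case_sum x b"
  define L :: "nat + 'g \<times> nat \<times> nat \<Rightarrow> (nat + 'g \<Rightarrow> 'a) \<Rightarrow> 'a" where
    "L = case_sum (\<lambda>i v. v (Inl i)) (\<lambda>(g, i, j) v. a g (v (Inl i)) + v (Inr g) - v (Inl j))"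
  define L'' :: "nat + 'g \<times> nat \<times> nat \<Rightarrow> (nat + 'g \<Rightarrow> 'c) \<Rightarrow> 'c" where
    "L'' = case_sum (\<lambda>i w. w (Inl i)) (\<lambda>(g, i, j) w. a'' g (w (Inl i)) + w (Inr g) - w (Inl j))"
  have in_Q: "Inl i \<in> Q" "g \<in> F \<Longrightarrow> j < k \<Longrightarrow> Inr (g, i, j) \<in> Q" if "i < k" for g i j
    using that by (auto simp: Q_def)
  have in_E: "(i, \<phi>) \<in> X \<Longrightarrow> (Inl i, \<phi>) \<in> E" "(g, \<phi>) \<in> J \<Longrightarrow> (Inr g, \<phi>) \<in> E" for i g \<phi>
    by (force simp: E_def)+
  have proj: "second_adjoint I (\<lambda>v. v i) (\<lambda>w. w i)" if "i \<in> I" for i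
    using second_adjoint_proj[OF _ that] F by (simp add: I_def)
  have affine: "second_adjoint I (\<lambda>v. a g (v (Inl i)) + v (Inr g) - v (Inl j))
      (\<lambda>w. a'' g (w (Inl i)) + w (Inr g) - w (Inl j))" if "g \<in> F" "i < k" "j < k" for g i j
    using that
    by (intro second_adjoint_diff second_adjoint_plus proj second_adjoint_compose[OF proj, where T' = "a' g"])
       (auto simp: I_def a_in a_add a'_in a''_in pr_a pr'_a'')
  have "\<exists>v\<in>UNIV \<rightarrow> V. (\<forall>q\<in>Q. N (L q v) \<le> K (L'' q w) + \<delta>) \<and>
      (\<forall>(i, \<phi>)\<in>E. \<bar>pr \<phi> (v i) - pr' (w i) \<phi>\<bar> \<le> \<delta>)"
  proof (rule Helly[where I = I])
    show "finite I" "finite Q" "finite E" using F X(1) J(1) by (simp_all add: I_def Q_def E_def)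
    show "E \<subseteq> I \<times> W" using X(2) J(2) by (auto simp: E_def I_def)
    show "w \<in> UNIV \<rightarrow> U" using x b by (simp add: w_def Pi_iff split: sum.split)
    show "second_adjoint I (L q) (L'' q)" if "q \<in> Q" for q
      using that affine by (auto simp: Q_def L_def L''_def intro!: proj) (auto simp: I_def)
  qed (rule \<delta>)
  then obtain v where v: "v \<in> UNIV \<rightarrow> V" and norms: "\<forall>q\<in>Q. N (L q v) \<le> K (L'' q w) + \<delta>"
    and evals: "\<forall>(i, \<phi>)\<in>E. \<bar>pr \<phi> (v i) - pr' (w i) \<phi>\<bar> \<le> \<delta>" by blast
  show ?thesis
  proof (rule that[of "v \<circ> Inl" "v \<circ> Inr"])
    show "\<forall>i<k. N ((v \<circ> Inl) i) \<le> K (x i) + \<delta>"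
      using bspec[OF norms in_Q(1)] by (simp add: L_def L''_def w_def)
    show "\<forall>g\<in>F. \<forall>i<k. \<forall>j<k. N (a g ((v \<circ> Inl) i) + (v \<circ> Inr) g - (v \<circ> Inl) j)
        \<le> K (a'' g (x i) + b g - x j) + \<delta>"
      using bspec[OF norms in_Q(2)] by (simp add: L_def L''_def w_def)
    show "\<forall>(i, \<phi>)\<in>X. \<bar>pr \<phi> ((v \<circ> Inl) i) - pr' (x i) \<phi>\<bar> \<le> \<delta>"
      using bspec[OF evals in_E(1)] by (auto simp: w_def)
    show "\<forall>(g, \<phi>)\<in>J. \<bar>pr \<phi> ((v \<circ> Inr) g) - pr' (b g) \<phi>\<bar> \<le> \<delta>"
      using bspec[OF evals in_E(2)] by (auto simp: w_def)
  qed (use v in auto)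
qed

text \<open>The bound from below results from evaluation at functionals almost norming the \<open>x i - x j\<close>.\<close>

lemma approx_affine_family:
  fixes x :: "nat \<Rightarrow> 'c" and b :: "'g \<Rightarrow> 'c"
  assumes F: "finite F" and J: "finite J" "J \<subseteq> F \<times> W" and x: "x \<in> UNIV \<rightarrow> U" and b: "b \<in> UNIV \<rightarrow> U"
    and \<delta>: "0 < \<delta>"
  obtains x' b' where "x' \<in> UNIV \<rightarrow> V" "b' \<in> UNIV \<rightarrow> V" "\<forall>i<k. N (x' i) \<le> K (x i) + \<delta>"
    "\<forall>g\<in>F. \<forall>i<k. \<forall>j<k. N (a g (x' i) + b' g - x' j) \<le> K (a'' g (x i) + b g - x j) + \<delta>"
    "\<forall>i<k. \<forall>j<k. K (x i - x j) \<le> N (x' i - x' j) + 3 * \<delta>"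
    "\<forall>(g, \<phi>)\<in>J. \<bar>pr \<phi> (b' g) - pr' (b g) \<phi>\<bar> \<le> \<delta>"
proof -
  have x_in: "x i \<in> U" for i using x by auto
  have "\<exists>\<psi>. \<psi> \<in> W \<and> M \<psi> \<le> 1 \<and> K (x i - x j) - \<delta> \<le> pr' (x i - x j) \<psi>" for i j
    using P2.norm_approx[OF P2.W.diff_in[OF x_in x_in] \<delta>] by metis
  then obtain \<psi> where \<psi>: "\<psi> i j \<in> W" "M (\<psi> i j) \<le> 1" "K (x i - x j) - \<delta> \<le> pr' (x i - x j) (\<psi> i j)" for i j
    by metis
  define X where "X = (\<lambda>(i, j). (i, \<psi> i j)) ` ({..<k} \<times> {..<k}) \<union> (\<lambda>(i, j). (j, \<psi> i j)) ` ({..<k} \<times> {..<k})"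
  have X: "finite X" "X \<subseteq> {..<k} \<times> W" using \<psi>(1) by (auto simp: X_def)
  have in_X: "(i, \<psi> i j) \<in> X" "(j, \<psi> i j) \<in> X" if "i < k" "j < k" for i j
    using that by (auto simp: X_def)
  obtain x' b' where x': "x' \<in> UNIV \<rightarrow> V" and b': "b' \<in> UNIV \<rightarrow> V" "\<forall>i<k. N (x' i) \<le> K (x i) + \<delta>"
      "\<forall>g\<in>F. \<forall>i<k. \<forall>j<k. N (a g (x' i) + b' g - x' j) \<le> K (a'' g (x i) + b g - x j) + \<delta>"
    and evals: "\<forall>(i, \<phi>)\<in>X. \<bar>pr \<phi> (x' i) - pr' (x i) \<phi>\<bar> \<le> \<delta>"
    and J': "\<forall>(g, \<phi>)\<in>J. \<bar>pr \<phi> (b' g) - pr' (b g) \<phi>\<bar> \<le> \<delta>"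
    by (rule Helly_affine[OF F X J x b \<delta>])
  have "K (x i - x j) \<le> N (x' i - x' j) + 3 * \<delta>" if ij: "i < k" "j < k" for i j
  proof -
    have x'_in: "x' i \<in> V" "x' j \<in> V" using x' by auto
    note diff_in = P1.Z.diff_in[OF x'_in]
    have "pr' (x i - x j) (\<psi> i j) \<le> pr (\<psi> i j) (x' i - x' j) + 2 * \<delta>"
      using bspec[OF evals in_X(1)[OF ij]] bspec[OF evals in_X(2)[OF ij]]
      by (simp add: P2.pr_diff_left[OF \<psi>(1) x_in x_in] P1.pr_diff_right[OF \<psi>(1) x'_in])
    also have "pr (\<psi> i j) (x' i - x' j) \<le> M (\<psi> i j) * N (x' i - x' j)" by (rule P1.pr_le[OF \<psi>(1) diff_in])
    also have "\<dots> \<le> 1 * N (x' i - x' j)" by (rule mult_right_mono[OF \<psi>(2) P1.Z.N_nonneg[OF diff_in]])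
    finally show ?thesis using \<psi>(3)[of i j] by simp
  qed
  with x' b' J' show ?thesis using that[of x' b'] by blast
qed

lemma canonical_embedding:
  assumes y: "y \<in> V"
  obtains u where "u \<in> U" "\<forall>\<phi>\<in>W. pr' u \<phi> = pr \<phi> y" "K u \<le> N y"
proof -
  have pr_bound: "pr \<phi> y \<le> N y * M \<phi>" if "\<phi> \<in> W" for \<phi> using P1.pr_le[OF that y] by (simp add: mult.commute)
  obtain u where u: "u \<in> U" "\<forall>\<phi>\<in>W. pr' u \<phi> = pr \<phi> y"
    using P2.represent[OF P1.additive_left[OF y] P1.W.dominated_onI'[OF pr_bound]] by blast
  have "K u \<le> N y" using u pr_bound by (intro P2.norm_le P1.Z.N_nonneg[OF y]) auto
  with u show ?thesis by (rule that)
qed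

lemma approx_mean_bidual_finite:
  fixes x :: "nat \<Rightarrow> 'c" and b :: "'g \<Rightarrow> 'c"
  assumes mean: "approx_mean V N a" and k: "0 < k" and x: "x \<in> UNIV \<rightarrow> U" and R: "\<forall>i<k. K (x i) \<le> R"
    and F: "finite F" and b: "b \<in> UNIV \<rightarrow> U" and \<eta>: "0 < \<eta>" "\<eta> \<le> 1" and \<epsilon>: "0 < \<epsilon>"
    and J: "finite J" "J \<subseteq> F \<times> W" and \<epsilon>': "0 < \<epsilon>'"
  obtains y b' where "y \<in> V" "b' \<in> UNIV \<rightarrow> V" "N y \<le> 3 * R + \<epsilon>"
    "\<forall>g\<in>F. N (a g y + b' g - y) \<le> discrepancy K \<eta> k x (\<lambda>i. a'' g (x i) + b g) + \<epsilon>"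
    "\<forall>(g, \<phi>)\<in>J. \<bar>pr \<phi> (b' g) - pr' (b g) \<phi>\<bar> \<le> \<epsilon>'"
proof -
  define \<delta> where "\<delta> = min \<epsilon>' (min (\<epsilon> / 6) (\<epsilon> * \<eta> / 48))"
  have \<delta>: "0 < \<delta>" using \<epsilon> \<epsilon>' \<eta> by (simp add: \<delta>_def)
  have \<delta>_le: "\<delta> \<le> \<epsilon>'" "\<delta> \<le> \<epsilon> / 6" "\<delta> \<le> \<epsilon> * \<eta> / 48" by (simp_all add: \<delta>_def min_le_iff_disj)
  obtain x' b' where x': "x' \<in> UNIV \<rightarrow> V" and b': "b' \<in> UNIV \<rightarrow> V" and norms: "\<forall>i<k. N (x' i) \<le> K (x i) + \<delta>"
    and upper: "\<forall>g\<in>F. \<forall>i<k. \<forall>j<k. N (a g (x' i) + b' g - x' j) \<le> K (a'' g (x i) + b g - x j) + \<delta>"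
    and lower: "\<forall>i<k. \<forall>j<k. K (x i - x j) \<le> N (x' i - x' j) + 3 * \<delta>"
    and evals: "\<forall>(g, \<phi>)\<in>J. \<bar>pr \<phi> (b' g) - pr' (b g) \<phi>\<bar> \<le> \<delta>"
    by (rule approx_affine_family[OF F J x b \<delta>, of k])
  have "\<forall>i<k. N (x' i) \<le> R + \<delta>" using norms R by force
  with mean obtain y where y: "y \<in> V" "N y \<le> 3 * (R + \<delta>) + \<epsilon> / 2"
    "\<forall>g\<in>F. N (a g y + b' g - y) \<le> discrepancy N \<eta> k x' (\<lambda>i. a g (x' i) + b' g) + \<epsilon> / 2"
    using k x' F b' \<eta> half_gt_zero[OF \<epsilon>] unfolding approx_mean_def by metis
  have "N y \<le> 3 * R + \<epsilon>" using y(2) \<delta>_le(2) by simp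
  moreover have "N (a g y + b' g - y) \<le> discrepancy K \<eta> k x (\<lambda>i. a'' g (x i) + b g) + \<epsilon>" if g: "g \<in> F" for g
  proof -
    have "discrepancy N \<eta> k x' (\<lambda>i. a g (x' i) + b' g) \<le> discrepancy K \<eta> k x (\<lambda>i. a'' g (x i) + b g) + 24 / \<eta> * \<delta>"
      using upper g lower \<delta> by (intro discrepancy_le_add k \<eta>) auto
    also have "24 / \<eta> * \<delta> \<le> \<epsilon> / 2" using \<delta>_le(3) \<eta> by (simp add: field_simps)
    finally show ?thesis using bspec[OF y(3) g] by simp
  qed
  moreover have "\<forall>(g, \<phi>)\<in>J. \<bar>pr \<phi> (b' g) - pr' (b g) \<phi>\<bar> \<le> \<epsilon>'" using evals \<delta>_le(1) by force
  ultimately show ?thesis using that[of y b'] y(1) b' by blast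
qed

lemma pr'_displacement_le:
  assumes y: "y \<in> V" and b': "b' \<in> V" and u: "\<forall>\<phi>\<in>W. pr' u \<phi> = pr \<phi> y" and \<phi>: "\<phi> \<in> W"
    and norm: "N (a g y + b' - y) \<le> c" and eval: "\<bar>pr \<phi> b' - pr' b \<phi>\<bar> \<le> \<epsilon>"
  shows "pr' u (a' g \<phi> - \<phi>) + pr' b \<phi> \<le> c * M \<phi> + \<epsilon>"
proof -
  note sum_in = P1.Z.add_in[OF a_in[OF y] b']
  have "pr' u (a' g \<phi> - \<phi>) = pr \<phi> (a g y + b' - y) - pr \<phi> b'"
    using u \<phi> by (simp add: P1.W.diff_in a'_in P1.pr_diff_left y a_in b' sum_in
        P1.pr_diff_right P1.pr_add_right pr_a)
  also have "pr \<phi> (a g y + b' - y) \<le> M \<phi> * N (a g y + b' - y)"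
    by (rule P1.pr_le[OF \<phi> P1.Z.diff_in[OF sum_in y]])
  also have "\<dots> \<le> M \<phi> * c" by (intro mult_left_mono norm P1.W.N_nonneg \<phi>)
  finally show ?thesis using eval by (simp add: mult.commute abs_le_iff)
qed

theorem approx_mean_bidual:
  assumes mean: "approx_mean V N a"
  shows "approx_mean U K a''"
  unfolding approx_mean_def
proof (intro allI impI)
  fix k :: nat and x :: "nat \<Rightarrow> 'c" and F :: "'g set" and b :: "'g \<Rightarrow> 'c" and \<eta> \<epsilon> R :: real
  assume k: "0 < k" and x: "x \<in> UNIV \<rightarrow> U" and R: "\<forall>i<k. K (x i) \<le> R" and F: "finite F"
    and b: "b \<in> UNIV \<rightarrow> U" and \<eta>: "0 < \<eta>" "\<eta> \<le> 1" and \<epsilon>: "0 < \<epsilon>"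
  define c where "c g = discrepancy K \<eta> k x (\<lambda>i. a'' g (x i) + b g) + \<epsilon>" for g
  note finite_approx = approx_mean_bidual_finite[OF mean k x R F b \<eta> \<epsilon>, folded c_def]
  have c_nonneg: "0 \<le> c g" if g: "g \<in> F" for g
  proof -
    obtain y b' where y: "y \<in> V" and b': "b' \<in> UNIV \<rightarrow> V" and "N y \<le> 3 * R + \<epsilon>"
      and displacement: "\<forall>g\<in>F. N (a g y + b' g - y) \<le> c g" and "\<forall>(g, \<phi>)\<in>{}. \<bar>pr \<phi> (b' g) - pr' (b g) \<phi>\<bar> \<le> 1"
      by (rule finite_approx[of "{}" 1]) simp_all
    have "a g y + b' g - y \<in> V" using b' by (intro P1.Z.diff_in P1.Z.add_in a_in y) auto
    then show ?thesis using bspec[OF displacement g] P1.Z.N_nonneg order_trans by blast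
  qed
  obtain u where u: "u \<in> U" "K u \<le> 3 * R + \<epsilon>" and fixed: "\<forall>g\<in>F. K (a'' g u + b g - u) \<le> c g"
  proof (rule P2.displacement_bound_compact[of a'' a' b F c "3 * R + \<epsilon>"])
    fix J \<epsilon>' assume J: "finite J" "J \<subseteq> F \<times> W" and \<epsilon>': "0 < (\<epsilon>' :: real)"
    obtain y b' where y: "y \<in> V" and b': "b' \<in> UNIV \<rightarrow> V" and Ny: "N y \<le> 3 * R + \<epsilon>"
      and fixed: "\<forall>g\<in>F. N (a g y + b' g - y) \<le> c g" and evals: "\<forall>(g, \<phi>)\<in>J. \<bar>pr \<phi> (b' g) - pr' (b g) \<phi>\<bar> \<le> \<epsilon>'"
      by (rule finite_approx[OF J \<epsilon>'])
    obtain u where u: "u \<in> U" "\<forall>\<phi>\<in>W. pr' u \<phi> = pr \<phi> y" "K u \<le> N y"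
      by (rule canonical_embedding[OF y])
    have "pr' u (a' g \<phi> - \<phi>) + pr' (b g) \<phi> \<le> c g * M \<phi> + \<epsilon>'" if j: "(g, \<phi>) \<in> J" for g \<phi>
      using j J(2) b' fixed evals by (intro pr'_displacement_le[OF y _ u(2)]) auto
    then show "\<exists>u\<in>U. K u \<le> 3 * R + \<epsilon> \<and>
        (\<forall>(g, \<phi>)\<in>J. pr' u (a' g \<phi> - \<phi>) + pr' (b g) \<phi> \<le> c g * M \<phi> + \<epsilon>')"
      using u(1,3) Ny by (intro bexI[of _ u]) auto
  qed (use a'_in a''_in pr'_a'' b c_nonneg in auto)
  then show "\<exists>y\<in>U. K y \<le> 3 * R + \<epsilon> \<and>
      (\<forall>g\<in>F. K (a'' g y + b g - y) \<le> discrepancy K \<eta> k x (\<lambda>i. a'' g (x i) + b g) + \<epsilon>)"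
    unfolding c_def by blast
qed

end

section \<open>Common fixed points\<close>

lemma sum_lessThan_add:
  "(\<Sum>i<m + n. f i) = (\<Sum>i<m. f i) + (\<Sum>i<n. f (m + i) :: 'a::comm_monoid_add)" for m n :: nat
  by (induction n) (auto simp: add.assoc)

lemma pair_mean_append:
  fixes x y :: "nat \<Rightarrow> 'a" and k :: nat
  defines "xy \<equiv> \<lambda>i. if i < k then x i else y (i - k)"
  shows "pair_mean (k + k) D xy xy =
    (pair_mean k D x x + pair_mean k D x y + pair_mean k D y x + pair_mean k D y y) / 4"
  by (simp add: pair_mean_def xy_def sum_lessThan_add sum.distrib power2_eq_square add_divide_distrib)

text \<open>Families almost maximising the mean of \<open>D\<close> qualify, because joining such a family with a
  translate cannot increase the maximum.\<close>

lemma almost_invariant_family: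
  fixes D :: "'g::semigroup_mult \<Rightarrow> 'g \<Rightarrow> real"
  assumes commute: "\<And>s t. D s t = D t s" and invariant: "\<And>g s t. D (g * s) (g * t) = D s t"
    and bounded: "\<And>s t. D s t \<le> B" and \<delta>: "0 < \<delta>"
  obtains k t where "0 < k" "\<forall>g. pair_mean k D (\<lambda>i. g * t i) t \<le> pair_mean k D t t + \<delta>"
proof -
  define S where "S = {pair_mean k D t t | k t. 0 < k}"
  have "pair_mean k D t t \<le> B" if "0 < k" for k t
  proof -
    have "pair_mean k D t t \<le> pair_mean k (\<lambda>_ _. 0) t t + B"
      using that bounded by (intro pair_mean_le_add) simp_all
    then show ?thesis by (simp add: pair_mean_def)
  qed
  then have bdd: "bdd_above S" by (auto simp: S_def intro!: bdd_aboveI[of _ B])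
  have "S \<noteq> {}" unfolding S_def using zero_less_one[where 'a = nat] by blast
  moreover have "Sup S - \<delta> / 2 < Sup S" using \<delta> by simp
  ultimately obtain m where "m \<in> S" "Sup S - \<delta> / 2 < m" using less_cSupE by blast
  then obtain k t where k: "0 < k" and near: "Sup S - \<delta> / 2 < pair_mean k D t t" by (auto simp: S_def)
  have "pair_mean k D (\<lambda>i. g * t i) t \<le> pair_mean k D t t + \<delta>" for g
  proof -
    let ?gt = "\<lambda>i. g * t i" and ?joined = "\<lambda>i. if i < k then t i else g * t (i - k)"
    have "pair_mean (k + k) D ?joined ?joined \<le> Sup S"
      using k by (intro cSup_upper bdd) (auto simp: S_def)
    moreover have "pair_mean k D ?gt ?gt = pair_mean k D t t"
      by (rule pair_mean_cong) (rule invariant)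
    ultimately show ?thesis
      using near pair_mean_commute[of D, OF commute, of k t ?gt] pair_mean_append[of k D t ?gt] by simp
  qed
  with k show ?thesis using that by blast
qed

lemma (in dual_pair) exists_fixed_point_if_almost_fixed:
  fixes a :: "'g \<Rightarrow> 'b \<Rightarrow> 'b" and a' :: "'g \<Rightarrow> 'a \<Rightarrow> 'a"
  assumes a: "\<And>g \<phi>. \<phi> \<in> W \<Longrightarrow> a g \<phi> \<in> W" and a': "\<And>g x. x \<in> V \<Longrightarrow> a' g x \<in> V"
    and adjoint: "\<And>g \<phi> x. \<phi> \<in> W \<Longrightarrow> x \<in> V \<Longrightarrow> pr (a g \<phi>) x = pr \<phi> (a' g x)"
    and c_maps: "c \<in> UNIV \<rightarrow> W"
    and almost_fixed: "\<And>F \<epsilon>. finite F \<Longrightarrow> 0 < \<epsilon> \<Longrightarrow> \<exists>y\<in>W. M y \<le> R \<and> (\<forall>g\<in>F. M (a g y + c g - y) \<le> \<epsilon>)"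
  shows "\<exists>y\<in>W. \<forall>g. a g y + c g = y"
proof -
  have c_in: "c g \<in> W" for g using c_maps by auto
  have displacement_in: "a g y + c g - y \<in> W" if "y \<in> W" for g y
    by (intro W.diff_in W.add_in a c_in that)
  obtain y where y: "y \<in> W" and "M y \<le> R" and fixed: "\<forall>g\<in>UNIV. M (a g y + c g - y) \<le> 0"
  proof (rule displacement_bound_compact[of a a' c UNIV "\<lambda>_. 0" R])
    fix J :: "('g \<times> 'a) set" and \<epsilon> :: real assume J: "finite J" "J \<subseteq> UNIV \<times> V" and \<epsilon>: "0 < \<epsilon>"
    define s where "s = 1 + (\<Sum>j\<in>J. N (snd j))"
    have N_nonneg: "0 \<le> N (snd j)" if "j \<in> J" for j using that J(2) by (intro Z.N_nonneg) auto
    have s: "1 \<le> s" using sum_nonneg[of J "\<lambda>j. N (snd j)"] N_nonneg by (simp add: s_def)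
    have N_le: "N x \<le> s" if "(g, x) \<in> J" for g x
      using member_le_sum[OF that, of "\<lambda>j. N (snd j)"] N_nonneg J(1) by (simp add: s_def)
    obtain y where y: "y \<in> W" "M y \<le> R" "\<forall>g\<in>fst ` J. M (a g y + c g - y) \<le> \<epsilon> / s"
      using almost_fixed[of "fst ` J" "\<epsilon> / s"] J(1) \<epsilon> s by auto
    have "pr y (a' g x - x) + pr (c g) x \<le> \<epsilon>" if j: "(g, x) \<in> J" for g x
    proof -
      have x: "x \<in> V" using j J(2) by auto
      have "pr y (a' g x - x) + pr (c g) x = pr (a g y + c g - y) x"
        using y(1) x by (simp add: a a' c_in W.add_in pr_diff_left pr_diff_right pr_add_left adjoint)
      also have "\<dots> \<le> M (a g y + c g - y) * N x" by (rule pr_le[OF displacement_in[OF y(1)] x])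
      also have "\<dots> \<le> \<epsilon> / s * s"
        using y(3) j N_le[OF j] \<epsilon> s Z.N_nonneg[OF x] by (intro mult_mono) force+
      finally show ?thesis using s by simp
    qed
    then show "\<exists>y\<in>W. M y \<le> R \<and> (\<forall>(g, x)\<in>J. pr y (a' g x - x) + pr (c g) x \<le> 0 * N x + \<epsilon>)"
      using y(1,2) by auto
  qed (use a a' adjoint c_maps in auto)
  have "M (a g y + c g - y) = 0" for g
    using fixed W.N_nonneg[OF displacement_in[OF y]] by (intro antisym) auto
  then have "a g y + c g - y = 0" for g by (rule norm_eq_0D[OF displacement_in[OF y]])
  then show ?thesis using y by auto
qed

lemma (in dual_pair) almost_fixed_point:
  fixes a :: "'g::semigroup_mult \<Rightarrow> 'b \<Rightarrow> 'b"
  assumes mean: "approx_mean W M a"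
    and a_add: "\<And>g \<phi> \<psi>. \<phi> \<in> W \<Longrightarrow> \<psi> \<in> W \<Longrightarrow> a g (\<phi> + \<psi>) = a g \<phi> + a g \<psi>"
    and a_iso: "\<And>g \<phi>. \<phi> \<in> W \<Longrightarrow> M (a g \<phi>) = M \<phi>"
    and c_maps: "c \<in> UNIV \<rightarrow> W" and cocycle: "\<And>g t. a g (c t) + c g = c (g * t)" and R: "\<And>g. M (c g) \<le> R"
    and F: "finite F" and \<epsilon>: "0 < \<epsilon>" "\<epsilon> \<le> 1"
  shows "\<exists>y\<in>W. M y \<le> 3 * R + 1 \<and> (\<forall>g\<in>F. M (a g y + c g - y) \<le> \<epsilon>)"
proof -
  have c_in: "c g \<in> W" for g using c_maps by auto
  have R_nonneg: "0 \<le> R" using W.N_nonneg[OF c_in] R order_trans by blast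
  define D where "D s t = M (c s - c t)" for s t
  have D_le: "D s t \<le> 2 * R" for s t
    unfolding D_def using W.N_diff[OF c_in[of s] c_in[of t]] R[of s] R[of t] by simp
  define \<eta> where "\<eta> = \<epsilon> / (8 * (R + 1))"
  have \<eta>: "0 < \<eta>" "\<eta> \<le> 1" "\<eta> * (2 * R) \<le> \<epsilon> / 4" using \<epsilon> R_nonneg by (simp_all add: \<eta>_def field_simps)
  obtain k t where k: "0 < k" and t: "\<forall>g. pair_mean k D (\<lambda>i. g * t i) t \<le> pair_mean k D t t + \<eta> * \<epsilon> / 24"
  proof (rule almost_invariant_family[of D "2 * R" "\<eta> * \<epsilon> / 24"])
    show "D s t = D t s" for s t unfolding D_def by (rule W.N_minus_commute[OF c_in c_in])
    show "D (g * s) (g * t) = D s t" for g s t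
      using a_add[OF W.diff_in c_in, OF c_in c_in, of g s t t] a_iso[OF W.diff_in, OF c_in c_in, of g s t]
      unfolding D_def cocycle[symmetric] by simp
  qed (use D_le \<eta> \<epsilon> in auto)
  obtain y where y: "y \<in> W" "M y \<le> 3 * R + \<epsilon> / 2"
    "\<forall>g\<in>F. M (a g y + c g - y) \<le> discrepancy M \<eta> k (\<lambda>i. c (t i)) (\<lambda>i. a g (c (t i)) + c g) + \<epsilon> / 2"
    using mean[unfolded approx_mean_def, rule_format, of k "\<lambda>i. c (t i)" R F c \<eta> "\<epsilon> / 2"] k c_in R F \<eta> \<epsilon> by auto
  have discrepancy_le: "discrepancy M \<eta> k (\<lambda>i. c (t i)) (\<lambda>i. a g (c (t i)) + c g) \<le> \<epsilon> / 2" for g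
  proof -
    have "pair_mean k D t t \<le> pair_mean k (\<lambda>_ _. 0) t t + 2 * R"
      using k D_le by (intro pair_mean_le_add) simp_all
    then have "\<eta> * pair_mean k D t t \<le> \<eta> * (2 * R)" using \<eta> by (intro mult_left_mono) (auto simp: pair_mean_def)
    moreover have "pair_mean k D (\<lambda>i. g * t i) t - pair_mean k D t t \<le> \<eta> * \<epsilon> / 24"
      using spec[OF t, of g] by simp
    then have "6 / \<eta> * (pair_mean k D (\<lambda>i. g * t i) t - pair_mean k D t t) \<le> 6 / \<eta> * (\<eta> * \<epsilon> / 24)"
      using \<eta> by (intro mult_left_mono) auto
    moreover have "6 / \<eta> * (\<eta> * \<epsilon> / 24) = \<epsilon> / 4" using \<eta> by simp
    ultimately have "\<eta> * pair_mean k D t t + 6 / \<eta> * (pair_mean k D (\<lambda>i. g * t i) t - pair_mean k D t t) \<le> \<epsilon> / 2"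
      using \<eta>(3) by linarith
    then show ?thesis by (simp add: discrepancy_def cocycle D_def pair_mean_def)
  qed
  have "M (a g y + c g - y) \<le> \<epsilon>" if "g \<in> F" for g
    using bspec[OF y(3) that] discrepancy_le[of g] by linarith
  moreover have "M y \<le> 3 * R + 1" using y(2) \<epsilon> by linarith
  ultimately show ?thesis using y(1) by blast
qed

theorem (in dual_pair) affine_fixed_point:
  fixes a :: "'g::semigroup_mult \<Rightarrow> 'b \<Rightarrow> 'b" and a' :: "'g \<Rightarrow> 'a \<Rightarrow> 'a"
  assumes "approx_mean W M a"
    and "\<And>g \<phi>. \<phi> \<in> W \<Longrightarrow> a g \<phi> \<in> W" and "\<And>g \<phi> \<psi>. \<phi> \<in> W \<Longrightarrow> \<psi> \<in> W \<Longrightarrow> a g (\<phi> + \<psi>) = a g \<phi> + a g \<psi>"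
    and "\<And>g \<phi>. \<phi> \<in> W \<Longrightarrow> M (a g \<phi>) = M \<phi>" and "\<And>g x. x \<in> V \<Longrightarrow> a' g x \<in> V"
    and "\<And>g \<phi> x. \<phi> \<in> W \<Longrightarrow> x \<in> V \<Longrightarrow> pr (a g \<phi>) x = pr \<phi> (a' g x)"
    and "c \<in> UNIV \<rightarrow> W" and "\<And>g t. a g (c t) + c g = c (g * t)" and "\<And>g. M (c g) \<le> R"
  shows "\<exists>y\<in>W. \<forall>g. a g y + c g = y"
proof (rule exists_fixed_point_if_almost_fixed[where R = "3 * R + 1", OF assms(2,5,6,7)])
  fix F :: "'g set" and \<epsilon> :: real assume "finite F" "0 < \<epsilon>"
  then have "\<exists>y\<in>W. M y \<le> 3 * R + 1 \<and> (\<forall>g\<in>F. M (a g y + c g - y) \<le> min \<epsilon> 1)"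
    by (intro almost_fixed_point assms) auto
  then show "\<exists>y\<in>W. M y \<le> 3 * R + 1 \<and> (\<forall>g\<in>F. M (a g y + c g - y) \<le> \<epsilon>)" by auto
qed

section \<open>Complex spaces and their duals\<close>

definition real_scale :: "(complex \<Rightarrow> 'a \<Rightarrow> 'a) \<Rightarrow> real \<Rightarrow> 'a \<Rightarrow> 'a" where
  "real_scale sm c = sm (complex_of_real c)"

definition equivalent_norms :: "'a set \<Rightarrow> ('a \<Rightarrow> real) \<Rightarrow> ('a \<Rightarrow> real) \<Rightarrow> bool" where
  "equivalent_norms V N N' \<longleftrightarrow> (\<exists>C>0. \<forall>x\<in>V. N x \<le> C * N' x \<and> N' x \<le> C * N x)"

definition bounded_operator ::
  "'a::ab_group_add set \<Rightarrow> (complex \<Rightarrow> 'a \<Rightarrow> 'a) \<Rightarrow> ('a \<Rightarrow> real) \<Rightarrow> real \<Rightarrow> ('a \<Rightarrow> 'a) \<Rightarrow> bool" where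
  "bounded_operator V sm N B T \<longleftrightarrow> 0 \<le> B \<and> (\<forall>x\<in>V. T x \<in> V \<and> N (T x) \<le> B * N x \<and>
     (\<forall>c. T (sm c x) = sm c (T x)) \<and> (\<forall>y\<in>V. T (x + y) = T x + T y))"

lemma bounded_operatorD:
  assumes "bounded_operator V sm N B T" "x \<in> V"
  shows "T x \<in> V" "N (T x) \<le> B * N x" "T (sm c x) = sm c (T x)"
    "y \<in> V \<Longrightarrow> T (x + y) = T x + T y"
  using assms by (simp_all add: bounded_operator_def)

locale complex_space =
  fixes V :: "'a::ab_group_add set" and sm :: "complex \<Rightarrow> 'a \<Rightarrow> 'a" and N :: "'a \<Rightarrow> real"
  assumes "0 \<in> V"
    and "x \<in> V \<Longrightarrow> y \<in> V \<Longrightarrow> x + y \<in> V"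
    and sm_in: "x \<in> V \<Longrightarrow> sm c x \<in> V"
    and sm_add_right: "x \<in> V \<Longrightarrow> y \<in> V \<Longrightarrow> sm c (x + y) = sm c x + sm c y"
    and sm_add_left: "x \<in> V \<Longrightarrow> sm (c + d) x = sm c x + sm d x"
    and sm_sm: "x \<in> V \<Longrightarrow> sm c (sm d x) = sm (c * d) x"
    and sm_one: "x \<in> V \<Longrightarrow> sm 1 x = x"
    and "x \<in> V \<Longrightarrow> y \<in> V \<Longrightarrow> N (x + y) \<le> N x + N y"
    and N_of_real: "x \<in> V \<Longrightarrow> N (sm (of_real a) x) = \<bar>a\<bar> * N x"
    and N_ii: "x \<in> V \<Longrightarrow> N (sm \<i> x) = N x"
begin

sublocale seminormed_space V "real_scale sm" N
  using complex_space_axioms by unfold_locales (simp_all add: complex_space_def real_scale_def)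

lemma sm_minus_one: "x \<in> V \<Longrightarrow> sm (- 1) x = - x"
  using sc_minus_one by (simp add: real_scale_def)

lemma sm_diff_right: "x \<in> V \<Longrightarrow> y \<in> V \<Longrightarrow> sm c (x - y) = sm c x - sm c y"
  using sm_add_right[OF diff_in, of x y y c] by (simp add: eq_diff_eq)

lemma sm_split: "x \<in> V \<Longrightarrow> sm c x = real_scale sm (Re c) x + real_scale sm (Im c) (sm \<i> x)"
  by (simp add: real_scale_def sm_sm flip: sm_add_left) (simp add: mult.commute flip: complex_eq)

lemma bounded_operator_diff:
  assumes S: "bounded_operator V sm N A S" and T: "bounded_operator V sm N B T"
  shows "bounded_operator V sm N (A + B) (\<lambda>x. S x - T x)"
  unfolding bounded_operator_def
proof (intro conjI ballI allI)
  show "0 \<le> A + B" using S T by (simp add: bounded_operator_def)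
  fix x assume x: "x \<in> V"
  note Sx = bounded_operatorD[OF S x] and Tx = bounded_operatorD[OF T x]
  show "S x - T x \<in> V" by (rule diff_in[OF Sx(1) Tx(1)])
  show "N (S x - T x) \<le> (A + B) * N x"
    using N_diff[OF Sx(1) Tx(1)] Sx(2) Tx(2) by (simp add: distrib_right)
  show "S (sm c x) - T (sm c x) = sm c (S x - T x)" for c
    by (simp add: Sx(3) Tx(3) sm_diff_right[OF Sx(1) Tx(1)])
  show "S (x + y) - T (x + y) = S x - T x + (S y - T y)" if "y \<in> V" for y
    by (simp add: Sx(4)[OF that] Tx(4)[OF that])
qed

lemma bounded_operator_scale: "bounded_operator V sm N (\<bar>Re c\<bar> + \<bar>Im c\<bar>) (sm c)"
  unfolding bounded_operator_def
proof (intro conjI ballI allI)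
  fix x assume x: "x \<in> V"
  show "N (sm c x) \<le> (\<bar>Re c\<bar> + \<bar>Im c\<bar>) * N x"
    unfolding sm_split[OF x, of c]
    using N_add[OF sc_in[OF x] sc_in[OF sm_in[OF x]], of "Re c" "Im c" \<i>] N_sc[OF x] N_sc[OF sm_in[OF x]]
    by (simp add: N_ii[OF x] distrib_right)
qed (simp_all add: sm_in sm_sm sm_add_right mult.commute)

lemma bfun_equivalent_norms:
  assumes "equivalent_norms V N N'"
  shows "bfun V sm N' l \<longleftrightarrow> bfun V sm N l"
proof -
  obtain C where C: "0 < C" "\<And>x. x \<in> V \<Longrightarrow> N x \<le> C * N' x" "\<And>x. x \<in> V \<Longrightarrow> N' x \<le> C * N x"
    using assms by (auto simp: equivalent_norms_def)
  have nonneg: "0 \<le> N' x" if "x \<in> V" for x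
    using order_trans[OF N_nonneg[OF that] C(2)[OF that]] C(1) by (simp add: zero_le_mult_iff)
  have transfer: "\<exists>K. \<forall>x\<in>V. norm (l x) \<le> K * Q x"
    if bound: "\<forall>x\<in>V. norm (l x) \<le> K * P x" and P: "\<And>x. x \<in> V \<Longrightarrow> P x \<le> C * Q x" "\<And>x. x \<in> V \<Longrightarrow> 0 \<le> P x"
    for P Q :: "'a \<Rightarrow> real" and K
  proof (intro exI ballI)
    fix x assume x: "x \<in> V"
    have "norm (l x) \<le> \<bar>K\<bar> * P x"
      using bound x mult_right_mono[OF abs_ge_self[of K] P(2)[OF x]] by fastforce
    also have "\<dots> \<le> \<bar>K\<bar> * (C * Q x)" by (intro mult_left_mono P x) simp
    finally show "norm (l x) \<le> \<bar>K\<bar> * C * Q x" by (simp add: mult.assoc)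
  qed
  have "(\<exists>K. \<forall>x\<in>V. norm (l x) \<le> K * N' x) \<longleftrightarrow> (\<exists>K. \<forall>x\<in>V. norm (l x) \<le> K * N x)"
    using transfer[of _ N' N] transfer[of _ N N'] C(2,3) nonneg N_nonneg by blast
  then show ?thesis by (simp add: bfun_def)
qed

lemma bfun_bound:
  assumes "bfun V sm N l"
  obtains K where "0 \<le> K" "\<And>x. x \<in> V \<Longrightarrow> norm (l x) \<le> K * N x"
proof -
  obtain K where "\<And>x. x \<in> V \<Longrightarrow> norm (l x) \<le> K * N x" using assms unfolding bfun_def by blast
  then have "norm (l x) \<le> \<bar>K\<bar> * N x" if "x \<in> V" for x
    using that mult_right_mono[OF abs_ge_self[of K] N_nonneg[OF that]] by fastforce
  then show ?thesis using that[of "\<bar>K\<bar>"] by simp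
qed

lemma bfun_comp:
  assumes l: "bfun V sm N l" and T: "bounded_operator V sm N B T"
  shows "bfun V sm N (\<lambda>x. l (T x))"
proof -
  obtain K where K: "0 \<le> K" "\<And>x. x \<in> V \<Longrightarrow> norm (l x) \<le> K * N x" by (rule bfun_bound[OF l]) blast
  have "norm (l (T x)) \<le> K * B * N x" if x: "x \<in> V" for x
    using order_trans[OF K(2) mult_left_mono[OF _ K(1)]] bounded_operatorD[OF T x] by (simp add: mult.assoc)
  then show ?thesis
    using l bounded_operatorD[OF T] unfolding bfun_def by auto
qed

lemma bfun_complexification:
  assumes l: "additive_on V l" "dominated_on V N l"
  shows "bfun V sm N (\<lambda>x. Complex (l x) (- l (sm \<i> x)))"
  unfolding bfun_def
proof (intro conjI ballI allI exI)
  have l_sm: "l (sm c x) = Re c * l x + Im c * l (sm \<i> x)" if "x \<in> V" for c x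
    using that by (simp add: sm_split[of x c] additive_on_add[OF l(1)] sc_in sm_in additive_dominated_sc[OF l])
  fix x assume x: "x \<in> V"
  show "Complex (l (sm c x)) (- l (sm \<i> (sm c x))) = c * Complex (l x) (- l (sm \<i> x))" for c
    by (simp add: sm_sm[OF x] l_sm[OF x, of c] l_sm[OF x, of "\<i> * c"] complex_eq_iff)
  show "Complex (l (x + y)) (- l (sm \<i> (x + y))) = Complex (l x) (- l (sm \<i> x)) + Complex (l y) (- l (sm \<i> y))"
    if "y \<in> V" for y
    using x that by (simp add: sm_add_right sm_in additive_on_add[OF l(1)] complex_eq_iff)
  have abs_l: "\<bar>l y\<bar> \<le> dual_norm V N l * N x" if "y \<in> V" "N y = N x" for y
    using dual_norm_upper[OF l(2) that(1)] dual_norm_upper[OF l(2) minus_in[OF that(1)]] that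
    by (simp add: additive_on_minus[OF l(1) subgroup] N_minus abs_le_iff)
  show "norm (Complex (l x) (- l (sm \<i> x))) \<le> (2 * dual_norm V N l) * N x"
    using cmod_le[of "Complex (l x) (- l (sm \<i> x))"] abs_l[OF x] abs_l[OF sm_in[OF x] N_ii[OF x]] by simp
qed

end

locale complex_dual = Z: complex_space V sm N
  for V :: "'a::ab_group_add set" and sm and N +
  fixes W :: "'b::ab_group_add set" and smW :: "complex \<Rightarrow> 'b \<Rightarrow> 'b" and M :: "'b \<Rightarrow> real"
    and pr :: "'b \<Rightarrow> 'a \<Rightarrow> complex"
  assumes W_add: "\<phi> \<in> W \<Longrightarrow> \<psi> \<in> W \<Longrightarrow> \<phi> + \<psi> \<in> W" and W_sm: "\<phi> \<in> W \<Longrightarrow> smW c \<phi> \<in> W"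
    and pr_add: "\<phi> \<in> W \<Longrightarrow> \<psi> \<in> W \<Longrightarrow> x \<in> V \<Longrightarrow> pr (\<phi> + \<psi>) x = pr \<phi> x + pr \<psi> x"
    and pr_sm: "\<phi> \<in> W \<Longrightarrow> x \<in> V \<Longrightarrow> pr (smW c \<phi>) x = c * pr \<phi> x"
    and pr_bfun: "\<phi> \<in> W \<Longrightarrow> bfun V sm N (pr \<phi>)"
    and pr_ex1: "bfun V sm N l \<Longrightarrow> \<exists>!\<phi>. \<phi> \<in> W \<and> (\<forall>x\<in>V. pr \<phi> x = l x)"
    and norm_eq: "M \<phi> = dual_norm V N (\<lambda>x. Re (pr \<phi> x))"
begin

lemma pr_arg_add: "\<phi> \<in> W \<Longrightarrow> x \<in> V \<Longrightarrow> y \<in> V \<Longrightarrow> pr \<phi> (x + y) = pr \<phi> x + pr \<phi> y"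
  and pr_arg_sm: "\<phi> \<in> W \<Longrightarrow> x \<in> V \<Longrightarrow> pr \<phi> (sm c x) = c * pr \<phi> x"
  using pr_bfun by (simp_all add: bfun_def)

lemma pr_eqI: "\<phi> \<in> W \<Longrightarrow> \<psi> \<in> W \<Longrightarrow> (\<And>x. x \<in> V \<Longrightarrow> pr \<phi> x = pr \<psi> x) \<Longrightarrow> \<phi> = \<psi>"
  using pr_ex1[OF pr_bfun] by metis

sublocale Re: dual_pair V "real_scale sm" N W "real_scale smW" M "\<lambda>\<phi> x. Re (pr \<phi> x)"
  unfolding norm_eq[abs_def]
proof (rule dual_pair_dual_norm)
  show "seminormed_space V (real_scale sm) N" by unfold_locales
  fix \<phi> assume \<phi>: "\<phi> \<in> W"
  show "dominated_on V N (\<lambda>x. Re (pr \<phi> x))"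
    using Z.bfun_bound[OF pr_bfun[OF \<phi>]] complex_Re_le_cmod order_trans by (metis (no_types, lifting) dominated_onI)
  fix \<psi> assume \<psi>: "\<psi> \<in> W" and Re_eq: "\<And>x. x \<in> V \<Longrightarrow> Re (pr \<phi> x) = Re (pr \<psi> x)"
  show "\<phi> = \<psi>"
  proof (rule pr_eqI[OF \<phi> \<psi>])
    fix x assume x: "x \<in> V"
    show "pr \<phi> x = pr \<psi> x"
      using Re_eq[OF x] Re_eq[OF Z.sm_in[OF x], of \<i>] by (simp add: pr_arg_sm \<phi> \<psi> x complex_eq_iff)
  qed
next
  fix l assume "additive_on V l" "dominated_on V N l"
  from pr_ex1[OF Z.bfun_complexification[OF this]] obtain \<phi>
    where \<phi>: "\<phi> \<in> W" "\<forall>x\<in>V. pr \<phi> x = Complex (l x) (- l (sm \<i> x))" by blast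
  then show "\<exists>\<phi>\<in>W. \<forall>x\<in>V. Re (pr \<phi> x) = l x" by (intro bexI[of _ \<phi>]) auto
qed (simp_all add: W_add W_sm pr_add pr_sm real_scale_def additive_on_def pr_arg_add)

lemma norm_ii_le:
  assumes \<phi>: "\<phi> \<in> W"
  shows "M (smW \<i> \<phi>) \<le> M \<phi>"
proof (rule Re.norm_le[OF W_sm[OF \<phi>] Re.W.N_nonneg[OF \<phi>]])
  show "Re (pr (smW \<i> \<phi>) x) \<le> M \<phi> * N x" if x: "x \<in> V" for x
    using Re.pr_le[OF \<phi> Z.sm_in[OF x], of \<i>] by (simp add: pr_sm[OF \<phi> x] pr_arg_sm[OF \<phi> x] Z.N_ii[OF x])
qed

sublocale W: complex_space W smW M
proof
  fix \<phi> assume \<phi>: "\<phi> \<in> W"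
  show "smW c (\<phi> + \<psi>) = smW c \<phi> + smW c \<psi>" if "\<psi> \<in> W" for c \<psi>
    using \<phi> that by (intro pr_eqI W_add W_sm) (simp_all add: pr_add pr_sm W_add W_sm algebra_simps)
  show "smW (c + d) \<phi> = smW c \<phi> + smW d \<phi>" for c d
    using \<phi> by (intro pr_eqI W_add W_sm) (simp_all add: pr_add pr_sm W_sm algebra_simps)
  show sm_sm: "smW c (smW d \<phi>) = smW (c * d) \<phi>" for c d
    using \<phi> by (intro pr_eqI W_sm) (simp_all add: pr_sm W_sm)
  show "M (smW (complex_of_real a) \<phi>) = \<bar>a\<bar> * M \<phi>" for a
    using Re.W.N_sc[OF \<phi>] by (simp add: real_scale_def)
  have "M \<phi> = M (smW \<i> (smW \<i> \<phi>))"
    using Re.W.N_sc[OF \<phi>, of "- 1"] by (simp add: sm_sm real_scale_def)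
  then show "M (smW \<i> \<phi>) = M \<phi>" using norm_ii_le[OF \<phi>] norm_ii_le[OF W_sm[OF \<phi>], of \<i>] by simp
qed (use Re.W.zero_in Re.W.N_add Re.W.sc_one W_add W_sm in \<open>simp_all add: real_scale_def\<close>)

lemma norm_pr_le:
  assumes \<phi>: "\<phi> \<in> W" and x: "x \<in> V"
  shows "norm (pr \<phi> x) \<le> 2 * (M \<phi> * N x)"
proof -
  have "Im (pr \<phi> x) = - Re (pr \<phi> (sm \<i> x))" by (simp add: pr_arg_sm[OF \<phi> x])
  then show ?thesis
    using cmod_le[of "pr \<phi> x"] Re.abs_pr_le[OF \<phi> x] Re.abs_pr_le[OF \<phi> Z.sm_in[OF x], of \<i>] Z.N_ii[OF x]
    by simp
qed

lemma norm_le_if_unit_ball: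
  assumes \<phi>: "\<phi> \<in> W" and C: "0 < C" "\<And>x. x \<in> V \<Longrightarrow> nv x \<le> C * N x"
    and unit_ball: "\<And>x. x \<in> V \<Longrightarrow> nv x \<le> 1 \<Longrightarrow> norm (pr \<phi> x) \<le> R"
  shows "M \<phi> \<le> C * R"
proof (rule field_le_epsilon)
  fix \<delta> :: real assume "0 < \<delta>"
  then obtain x where x: "x \<in> V" "N x \<le> 1" "M \<phi> - \<delta> \<le> Re (pr \<phi> x)" using Re.norm_approx[OF \<phi>] by blast
  let ?x = "real_scale sm (1 / C) x"
  have in_V: "?x \<in> V" by (rule Z.sc_in[OF x(1)])
  have "nv ?x \<le> 1" using C(2)[OF in_V] C(1) x by (simp add: Z.N_sc)
  then have "Re (pr \<phi> ?x) \<le> R" using unit_ball[OF in_V] complex_Re_le_cmod order_trans by blast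
  then have "Re (pr \<phi> x) \<le> C * R" using C(1) by (simp add: Re.pr_sc_right[OF \<phi> \<phi> x(1)] field_simps)
  then show "M \<phi> \<le> C * R + \<delta>" using x(3) by simp
qed

lemma equivalent_norms_dual:
  assumes "equivalent_norms V N nv"
    and nvW: "\<And>\<phi>. \<phi> \<in> W \<Longrightarrow> nvW \<phi> = Sup {norm (pr \<phi> x) | x. x \<in> V \<and> nv x \<le> 1}"
  shows "equivalent_norms W M nvW"
proof -
  obtain C where C: "0 < C" "\<And>x. x \<in> V \<Longrightarrow> N x \<le> C * nv x" "\<And>x. x \<in> V \<Longrightarrow> nv x \<le> C * N x"
    using assms(1) by (auto simp: equivalent_norms_def)
  have "M \<phi> \<le> (2 * C) * nvW \<phi> \<and> nvW \<phi> \<le> (2 * C) * M \<phi>" if \<phi>: "\<phi> \<in> W" for \<phi>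
  proof -
    let ?S = "{norm (pr \<phi> x) | x. x \<in> V \<and> nv x \<le> 1}"
    have upper: "norm (pr \<phi> x) \<le> (2 * C) * M \<phi>" if x: "x \<in> V" "nv x \<le> 1" for x
    proof -
      have "N x \<le> C * 1" using C(2)[OF x(1)] mult_left_mono[OF x(2), of C] C(1) by linarith
      from mult_left_mono[OF this Re.W.N_nonneg[OF \<phi>]] norm_pr_le[OF \<phi> x(1)]
      show ?thesis by (simp add: mult_ac)
    qed
    then have "bdd_above ?S" by (auto intro!: bdd_aboveI[of _ "(2 * C) * M \<phi>"])
    then have le_Sup: "norm (pr \<phi> x) \<le> nvW \<phi>" if "x \<in> V" "nv x \<le> 1" for x
      unfolding nvW[OF \<phi>] using that by (intro cSup_upper) auto
    have zero: "0 \<in> V" "nv 0 \<le> 1" using C(3)[OF Z.zero_in] Z.zero_in by (simp_all add: Z.N_zero)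
    have "nvW \<phi> \<le> (2 * C) * M \<phi>" unfolding nvW[OF \<phi>] using zero upper by (intro cSup_least) auto
    moreover have "M \<phi> \<le> C * nvW \<phi>" using norm_le_if_unit_ball[OF \<phi> C(1,3)] le_Sup by blast
    moreover have "0 \<le> nvW \<phi>" using le_Sup[OF zero] norm_ge_zero order_trans by blast
    then have "C * nvW \<phi> \<le> (2 * C) * nvW \<phi>" using C(1) by simp
    ultimately show ?thesis by simp
  qed
  then show ?thesis unfolding equivalent_norms_def using C(1) by (intro exI[of _ "2 * C"]) auto
qed

definition adj :: "('a \<Rightarrow> 'a) \<Rightarrow> 'b \<Rightarrow> 'b" where
  "adj T \<phi> = (THE \<psi>. \<psi> \<in> W \<and> (\<forall>x\<in>V. pr \<psi> x = pr \<phi> (T x)))"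

lemma adj_eqI: "\<psi> \<in> W \<Longrightarrow> (\<And>x. x \<in> V \<Longrightarrow> pr \<psi> x = pr \<phi> (T x)) \<Longrightarrow> adj T \<phi> = \<psi>"
  unfolding adj_def by (rule the_equality) (auto intro: pr_eqI)

context
  fixes B T
  assumes T: "bounded_operator V sm N B T"
begin

lemma
  assumes "\<phi> \<in> W"
  shows adj_in: "adj T \<phi> \<in> W" and pr_adj: "x \<in> V \<Longrightarrow> pr (adj T \<phi>) x = pr \<phi> (T x)"
  unfolding adj_def using theI'[OF pr_ex1[OF Z.bfun_comp[OF pr_bfun[OF assms] T]]] by auto

lemma bounded_operator_adj: "bounded_operator W smW M B (adj T)"
  unfolding bounded_operator_def
proof (intro conjI ballI allI)
  show B: "0 \<le> B" using T by (simp add: bounded_operator_def)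
  fix \<phi> assume \<phi>: "\<phi> \<in> W"
  show "adj T \<phi> \<in> W" by (rule adj_in[OF \<phi>])
  show "adj T (smW c \<phi>) = smW c (adj T \<phi>)" for c
    using \<phi> bounded_operatorD[OF T] by (intro adj_eqI) (simp_all add: W_sm pr_sm adj_in pr_adj)
  show "adj T (\<phi> + \<psi>) = adj T \<phi> + adj T \<psi>" if "\<psi> \<in> W" for \<psi>
    using \<phi> that bounded_operatorD[OF T] by (intro adj_eqI) (simp_all add: W_add pr_add adj_in pr_adj)
  show "M (adj T \<phi>) \<le> B * M \<phi>"
  proof (rule Re.norm_le[OF adj_in[OF \<phi>]])
    fix x assume x: "x \<in> V"
    note Tx = bounded_operatorD[OF T x]
    have "Re (pr (adj T \<phi>) x) \<le> M \<phi> * N (T x)" using Re.pr_le[OF \<phi> Tx(1)] by (simp add: pr_adj[OF \<phi> x])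
    also have "\<dots> \<le> M \<phi> * (B * N x)" by (intro mult_left_mono Tx(2) Re.W.N_nonneg[OF \<phi>])
    finally show "Re (pr (adj T \<phi>) x) \<le> B * M \<phi> * N x" by (simp add: mult_ac)
  qed (simp add: B Re.W.N_nonneg[OF \<phi>])
qed

end

end

section \<open>Pushforwards and convolution\<close>

lemma infsum_fibres:
  fixes f :: "'a \<Rightarrow> 'c::banach"
  assumes "f summable_on {t. h t \<in> B}"
  shows "infsum (\<lambda>u. infsum f {t. h t = u}) B = infsum f {t. h t \<in> B}"
    and "(\<lambda>u. infsum f {t. h t = u}) summable_on B"
proof -
  let ?S = "Sigma B (\<lambda>u. {t. h t = u})"
  have bij: "bij_betw snd ?S {t. h t \<in> B}"
    by (rule bij_betwI[of _ _ _ "\<lambda>t. (h t, t)"]) auto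
  have summable: "(\<lambda>p. f (snd p)) summable_on ?S"
    using summable_on_reindex_bij_betw[OF bij, of f] assms by simp
  have "infsum (\<lambda>u. infsum f {t. h t = u}) B = infsum (\<lambda>p. f (snd p)) ?S"
    using infsum_Sigma_banach[OF summable] by simp
  also have "\<dots> = infsum f {t. h t \<in> B}" by (rule infsum_reindex_bij_betw[OF bij])
  finally show "infsum (\<lambda>u. infsum f {t. h t = u}) B = infsum f {t. h t \<in> B}" .
  have "(\<lambda>(u, t). f t) summable_on ?S" using summable by (simp add: case_prod_unfold)
  from summable_on_Sigma_banach[OF this]
  show "(\<lambda>u. infsum f {t. h t = u}) summable_on B" by simp
qed

lemma l1_summable:
  assumes "f \<in> l1"
  shows "(\<lambda>u. norm (f u)) summable_on A" "f summable_on A"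
proof -
  show "(\<lambda>u. norm (f u)) summable_on A"
    using assms unfolding l1_def by (auto intro: summable_on_subset_banach)
  then show "f summable_on A" by (rule abs_summable_summable)
qed

interpretation l1: complex_space l1 "\<lambda>c f u. c * f u" l1norm
proof
  show "0 \<in> l1" by (simp add: l1_def)
  fix f :: "'a \<Rightarrow> complex" assume f: "f \<in> l1"
  note summable = l1_summable(1)[OF f, of UNIV]
  show "(\<lambda>u. c * f u) \<in> l1" for c using summable by (simp add: l1_def norm_mult summable_on_cmult_right)
  show "l1norm (\<lambda>u. of_real a * f u) = \<bar>a\<bar> * l1norm f" for a
    by (simp add: l1norm_def norm_mult infsum_cmult_right')
  show "l1norm (\<lambda>u. \<i> * f u) = l1norm f" by (simp add: l1norm_def norm_mult)
  fix g :: "'a \<Rightarrow> complex" assume g: "g \<in> l1"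
  note summable_add = summable_on_add[OF summable l1_summable(1)[OF g]]
  have "(\<lambda>u. norm (f u + g u)) summable_on UNIV"
    by (rule summable_on_comparison_test[OF summable_add norm_triangle_ineq]) auto
  then show "f + g \<in> l1" by (simp add: l1_def)
  have "l1norm (f + g) \<le> infsum (\<lambda>u. norm (f u) + norm (g u)) UNIV"
    using \<open>(\<lambda>u. norm (f u + g u)) summable_on UNIV\<close> summable_add norm_triangle_ineq
    unfolding l1norm_def plus_fun_apply by (rule infsum_mono)
  also have "\<dots> = l1norm f + l1norm g"
    unfolding l1norm_def by (rule infsum_add[OF summable l1_summable(1)[OF g]])
  finally show "l1norm (f + g) \<le> l1norm f + l1norm g" .
qed (simp_all add: fun_eq_iff algebra_simps)

abbreviation l1_operator :: "real \<Rightarrow> (('s \<Rightarrow> complex) \<Rightarrow> 's \<Rightarrow> complex) \<Rightarrow> bool" where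
  "l1_operator \<equiv> bounded_operator l1 (\<lambda>c f u. c * f u) l1norm"

lemma l1norm_eq_0D: "f \<in> l1 \<Longrightarrow> l1norm f \<le> 0 \<Longrightarrow> f = 0"
  using nonneg_infsum_le_0D[of "\<lambda>u. norm (f u)" UNIV] by (auto simp: l1_def l1norm_def fun_eq_iff)

lemma delta_l1: "delta s \<in> l1" "l1norm (delta s) = 1"
proof -
  have "((\<lambda>u. norm (delta s u)) has_sum 1) {s}"
    by (rule has_sum_finiteI) (auto simp: delta_def)
  then have norm_has_sum: "((\<lambda>u. norm (delta s u)) has_sum 1) UNIV"
    by (rule has_sum_cong_neutral[THEN iffD1, rotated 3]) (auto simp: delta_def)
  show "delta s \<in> l1" using has_sum_imp_summable[OF norm_has_sum] by (simp add: l1_def)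
  show "l1norm (delta s) = 1" using infsumI[OF norm_has_sum] by (simp add: l1norm_def)
qed

lemma l1_tail_small:
  assumes f: "f \<in> l1" and \<epsilon>: "0 < \<epsilon>"
  obtains A where "finite A" "l1norm (\<lambda>u. f u - (if u \<in> A then f u else 0)) < \<epsilon>"
proof -
  let ?n = "\<lambda>u. norm (f u)"
  obtain A where A: "finite A" "dist (sum ?n A) (infsum ?n UNIV) \<le> \<epsilon> / 2"
    using infsum_finite_approximation[OF l1_summable(1)[OF f, of UNIV], of "\<epsilon> / 2"] \<epsilon> by auto
  have "l1norm (\<lambda>u. f u - (if u \<in> A then f u else 0)) = infsum ?n (UNIV - A)"
    unfolding l1norm_def by (rule infsum_cong_neutral) auto
  also have "\<dots> = infsum ?n UNIV - sum ?n A"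
    using infsum_Diff[OF l1_summable(1)[OF f, of UNIV] l1_summable(1)[OF f, of A]] A(1) by simp
  also have "\<dots> < \<epsilon>" using A(2) \<epsilon> unfolding dist_real_def by linarith
  finally show ?thesis using that A(1) by blast
qed

lemma l1_additive_vanishes:
  fixes T :: "('s \<Rightarrow> complex) \<Rightarrow> 'v::ab_group_add"
  assumes f: "f \<in> l1" and add: "\<And>f g. f \<in> l1 \<Longrightarrow> g \<in> l1 \<Longrightarrow> T (f + g) = T f + T g"
    and delta: "\<And>c s. T (\<lambda>u. c * delta s u) = 0" and bound: "\<And>f. f \<in> l1 \<Longrightarrow> N (T f) \<le> C * l1norm f"
  shows "N (T f) \<le> 0"
proof (rule field_le_epsilon)
  fix \<epsilon> :: real assume \<epsilon>: "0 < \<epsilon>"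
  define B where "B = max C 1"
  have B: "0 < B" "C \<le> B" by (auto simp: B_def)
  define trunc where "trunc A = (\<lambda>u. if u \<in> A then f u else 0)" for A
  have trunc: "trunc A \<in> l1 \<and> T (trunc A) = 0" if "finite A" for A
    using that
  proof (induction A)
    case empty
    have "trunc {} = 0" by (simp add: trunc_def fun_eq_iff)
    moreover have "T 0 = 0" using add[OF l1.zero_in l1.zero_in] by simp
    ultimately show ?case using l1.zero_in by metis
  next
    case (insert a A)
    have "trunc (insert a A) = trunc A + (\<lambda>u. f a * delta a u)"
      using insert.hyps by (auto simp: trunc_def fun_eq_iff delta_def)
    moreover have "T (trunc A + (\<lambda>u. f a * delta a u)) = 0"
      using add[OF _ l1.sm_in[OF delta_l1(1)]] insert.IH delta by simp
    ultimately show ?case using insert.IH l1.add_in[OF _ l1.sm_in[OF delta_l1(1)]] by metis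
  qed
  obtain A where A: "finite A" "l1norm (f - trunc A) < \<epsilon> / B"
    using l1_tail_small[OF f, of "\<epsilon> / B"] \<epsilon> B(1) by (auto simp: trunc_def fun_diff_def)
  note trunc_A = conjunct1[OF trunc[OF A(1)]] conjunct2[OF trunc[OF A(1)]]
  have diff_l1: "f - trunc A \<in> l1" by (rule l1.diff_in[OF f trunc_A(1)])
  have "T f = T (f - trunc A)" using add[OF trunc_A(1) diff_l1] trunc_A(2) by simp
  then have "N (T f) \<le> C * l1norm (f - trunc A)" using bound[OF diff_l1] by simp
  also have "\<dots> \<le> B * (\<epsilon> / B)" using A(2) B l1.N_nonneg[OF diff_l1] by (intro mult_mono) auto
  finally show "N (T f) \<le> 0 + \<epsilon>" using B(1) by simp
qed

definition push :: "('a \<Rightarrow> 'b) \<Rightarrow> ('a \<Rightarrow> complex) \<Rightarrow> 'b \<Rightarrow> complex" where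
  "push h f = (\<lambda>u. infsum f {t. h t = u})"

lemma push_l1:
  assumes f: "f \<in> l1"
  shows "push h f \<in> l1" "l1norm (push h f) \<le> l1norm f"
proof -
  let ?n = "\<lambda>u. norm (f u)"
  have summable: "?n summable_on {t. h t \<in> UNIV}" using l1_summable[OF f] by simp
  note F = infsum_fibres[OF summable]
  have norm_push_le: "norm (push h f u) \<le> infsum ?n {t. h t = u}" for u
    unfolding push_def by (rule norm_infsum_bound[OF l1_summable(1)[OF f]])
  have push_summable: "(\<lambda>u. norm (push h f u)) summable_on UNIV"
    by (rule summable_on_comparison_test[OF F(2) norm_push_le]) auto
  then show "push h f \<in> l1" by (simp add: l1_def)
  have "l1norm (push h f) \<le> infsum (\<lambda>u. infsum ?n {t. h t = u}) UNIV"
    unfolding l1norm_def by (rule infsum_mono[OF push_summable F(2) norm_push_le])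
  then show "l1norm (push h f) \<le> l1norm f" using F(1) by (simp add: l1norm_def)
qed

lemma push_push: "f \<in> l1 \<Longrightarrow> push k (push h f) = push (\<lambda>t. k (h t)) f"
  unfolding push_def using infsum_fibres(1)[of f h] l1_summable(2) by (fastforce simp: fun_eq_iff)

lemma push_add: "f \<in> l1 \<Longrightarrow> g \<in> l1 \<Longrightarrow> push h (f + g) = push h f + push h g"
  unfolding push_def fun_eq_iff plus_fun_apply by (intro allI infsum_add l1_summable)

lemma push_scale: "push h (\<lambda>u. c * f u) = (\<lambda>u. c * push h f u)"
  unfolding push_def by (intro ext infsum_cmult_right')

lemma l1_operator_push: "l1_operator 1 (push h)"
  by (simp add: bounded_operator_def push_l1 push_add push_scale)

lemma push_delta: "push h (delta s) = delta (h s)"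
proof
  fix u
  have "infsum (delta s) {t. h t = u} = infsum (delta s) (if h s = u then {s} else {})"
    by (rule infsum_cong_neutral) (auto simp: delta_def split: if_splits)
  then show "push h (delta s) u = delta (h s) u"
    by (auto simp: push_def delta_def)
qed

lemma push_supp: "u \<notin> range h \<Longrightarrow> push h f u = 0"
proof -
  assume "u \<notin> range h"
  then have "{t. h t = u} = {}" by auto
  then show ?thesis by (simp add: push_def)
qed

lemma push_id_on:
  assumes "\<And>u. u \<notin> R \<Longrightarrow> f u = 0" "\<And>u. u \<in> R \<Longrightarrow> h u = u" "\<And>u. h u \<in> R"
  shows "push h f = f"
proof
  fix u
  have "infsum f {t. h t = u} = infsum f (if u \<in> R then {u} else {})"
    using assms by (intro infsum_cong_neutral) (auto split: if_splits, metis)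
  then show "push h f u = f u" using assms(1)[of u] by (auto simp: push_def)
qed

lemma push_const:
  assumes "\<And>t. \<alpha> t \<noteq> 0 \<Longrightarrow> h t = v"
  shows "push h \<alpha> = (\<lambda>u. infsum \<alpha> UNIV * delta v u)"
proof
  fix u
  have "infsum \<alpha> {t. h t = u} = infsum \<alpha> (if u = v then UNIV else {})"
    using assms by (intro infsum_cong_neutral) (auto split: if_splits)
  then show "push h \<alpha> u = infsum \<alpha> UNIV * delta v u" by (simp add: push_def delta_def)
qed

definition tensor :: "('a \<Rightarrow> complex) \<Rightarrow> ('b \<Rightarrow> complex) \<Rightarrow> 'a \<times> 'b \<Rightarrow> complex" where
  "tensor f g = (\<lambda>(s, t). f s * g t)"

lemma tensor_l1:
  assumes f: "f \<in> l1" and g: "g \<in> l1"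
  shows "tensor f g \<in> l1" "l1norm (tensor f g) = l1norm f * l1norm g"
proof -
  have inner_sum: "infsum (\<lambda>y. norm (tensor f g (x, y))) UNIV = norm (f x) * l1norm g" for x
    by (simp add: tensor_def norm_mult l1norm_def infsum_cmult_right')
  have summable: "(\<lambda>p. norm (tensor f g p)) summable_on (UNIV \<times> UNIV)"
    unfolding Infinite_Sum.abs_summable_on_Sigma_iff inner_sum
    using l1_summable(1)[OF g, of UNIV] l1_summable(1)[OF f, of UNIV] l1.N_nonneg[OF g]
    by (auto simp: tensor_def norm_mult intro!: summable_on_cmult_right summable_on_cmult_left)
  then show "tensor f g \<in> l1" by (simp add: l1_def)
  have "l1norm (tensor f g) = infsum (\<lambda>x. infsum (\<lambda>y. norm (tensor f g (x, y))) UNIV) UNIV"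
    using infsum_Sigma_banach[OF summable] by (simp add: l1norm_def)
  also have "\<dots> = l1norm f * l1norm g"
    unfolding inner_sum by (simp add: infsum_cmult_left' l1norm_def)
  finally show "l1norm (tensor f g) = l1norm f * l1norm g" .
qed

lemma conv_eq_push: "conv f g = push (\<lambda>(s, t). s * t) (tensor f g)"
  unfolding conv_def push_def tensor_def by (auto simp: case_prod_unfold)

lemma conv_l1:
  assumes "f \<in> l1" "g \<in> l1"
  shows "conv f g \<in> l1" "l1norm (conv f g) \<le> l1norm f * l1norm g"
  using push_l1[OF tensor_l1(1)[OF assms], of "\<lambda>(s, t). s * t"] tensor_l1(2)[OF assms]
  by (auto simp: conv_eq_push)

lemma l1_operator_conv_left:
  fixes f :: "'s::semigroup_mult \<Rightarrow> complex"
  assumes f: "f \<in> l1"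
  shows "l1_operator (l1norm f) (conv f)"
proof -
  have "tensor f (g + g') = tensor f g + tensor f g'"
    and "tensor f (\<lambda>u. c * g u) = (\<lambda>p. c * tensor f g p)" for g g' :: "'s \<Rightarrow> complex" and c
    by (auto simp: tensor_def fun_eq_iff algebra_simps)
  then show ?thesis
    using conv_l1[OF f] l1.N_nonneg[OF f]
    by (simp add: bounded_operator_def conv_eq_push push_add push_scale tensor_l1(1) f)
qed

lemma l1_operator_conv_right:
  fixes f :: "'s::semigroup_mult \<Rightarrow> complex"
  assumes f: "f \<in> l1"
  shows "l1_operator (l1norm f) (\<lambda>g. conv g f)"
proof -
  have "tensor (g + g') f = tensor g f + tensor g' f"
    and "tensor (\<lambda>u. c * g u) f = (\<lambda>p. c * tensor g f p)" for g g' :: "'s \<Rightarrow> complex" and c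
    by (auto simp: tensor_def fun_eq_iff algebra_simps)
  then show ?thesis
    using conv_l1[OF _ f] l1.N_nonneg[OF f]
    by (simp add: bounded_operator_def conv_eq_push push_add push_scale tensor_l1(1) f mult.commute)
qed

lemma tensor_delta_left:
  fixes s :: 'a and f :: "'b \<Rightarrow> complex"
  shows "tensor (delta s) f = push (Pair s) f"
proof
  fix p :: "'a \<times> 'b"
  obtain a t where p: "p = (a, t)" by (cases p)
  have "{t'. (s, t') = (a, t)} = (if a = s then {t} else {})" by auto
  then show "tensor (delta s) f p = push (Pair s) f p"
    by (simp add: p tensor_def push_def delta_def)
qed

lemma tensor_delta_right:
  fixes s :: 'a and f :: "'b \<Rightarrow> complex"
  shows "tensor f (delta s) = push (\<lambda>t. (t, s)) f"
proof
  fix p :: "'b \<times> 'a"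
  obtain t a where p: "p = (t, a)" by (cases p)
  have "{t'. (t', s) = (t, a)} = (if a = s then {t} else {})" by auto
  then show "tensor f (delta s) p = push (\<lambda>t. (t, s)) f p"
    by (simp add: p tensor_def push_def delta_def)
qed

lemma conv_delta_left: "f \<in> l1 \<Longrightarrow> conv (delta s) f = push (\<lambda>t. s * t) f"
  by (simp add: conv_eq_push tensor_delta_left push_push)

lemma conv_delta_right: "f \<in> l1 \<Longrightarrow> conv f (delta s) = push (\<lambda>t. t * s) f"
  by (simp add: conv_eq_push tensor_delta_right push_push)

lemma conv_delta_delta: "conv (delta s) (delta t) = delta (s * t)"
  by (simp add: conv_delta_left delta_l1 push_delta)

section \<open>Inverse semigroups\<close>

definition star :: "'s::semigroup_mult \<Rightarrow> 's" where
  "star s = (THE t. s * t * s = s \<and> t * s * t = t)"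

context
  assumes inv: "inverse_semigroup TYPE('s::semigroup_mult)"
begin

lemma star_inverse: "s * star s * s = s" "star s * s * star s = star s" for s :: 's
  using theI'[of "\<lambda>t. s * t * s = s \<and> t * s * t = t"] inv
  unfolding star_def inverse_semigroup_def by blast+

lemma star_unique: "s * t * s = s \<Longrightarrow> t * s * t = t \<Longrightarrow> star s = t" for s :: 's
  using inv star_inverse[of s] unfolding inverse_semigroup_def by metis

lemma star_star: "star (star s) = s" for s :: 's
  by (rule star_unique) (simp_all add: star_inverse)

lemma star_idems: "s * star s \<in> idems" "star s * s \<in> idems" for s :: 's
  unfolding idems_def using star_inverse[of s] by (simp_all add: mult.assoc[symmetric])

lemma idems_mult:
  fixes e f :: 's
  assumes e: "e \<in> idems" and f: "f \<in> idems"
  shows "e * f \<in> idems"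
proof -
  have e_idem: "e * e = e" "\<And>z. e * (e * z) = e * z" and f_idem: "f * f = f" "\<And>z. f * (f * z) = f * z"
    using e f by (auto simp: idems_def mult.assoc[symmetric])
  define x where "x = star (e * f)"
  have inverse_ef: "e * (f * (x * (e * f))) = e * f" and inverse_x: "x * (e * (f * x)) = x"
    using star_inverse[of "e * f"] by (simp_all add: x_def mult.assoc)
  have inverse_x_mult: "x * (e * (f * (x * z))) = x * z" for z
    using arg_cong[OF inverse_x, of "\<lambda>w. w * z"] by (simp add: mult.assoc)
  have "star (e * f) = f * x * e"
    by (rule star_unique) (simp_all add: mult.assoc e_idem f_idem inverse_ef inverse_x_mult)
  then have x: "x = f * (x * e)" by (simp add: x_def mult.assoc)
  have "x * x = f * (x * e) * (f * (x * e))" by (rule arg_cong2[OF x x])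
  also have "\<dots> = f * (x * e)" by (simp add: mult.assoc inverse_x_mult)
  also have "\<dots> = x" by (rule x[symmetric])
  finally have x_idem: "x * x = x" .
  have "star x = x" by (rule star_unique) (simp_all add: x_idem)
  then have "x = e * f" unfolding x_def by (simp add: star_star)
  then show ?thesis using x_idem by (simp add: idems_def)
qed

lemma idems_commute:
  fixes e f :: 's
  assumes e: "e \<in> idems" and f: "f \<in> idems"
  shows "e * f = f * e"
proof -
  have e_idem: "e * e = e" "\<And>z. e * (e * z) = e * z" and f_idem: "f * f = f" "\<And>z. f * (f * z) = f * z"
    using e f by (auto simp: idems_def mult.assoc[symmetric])
  have ef_idem: "e * (f * (e * f)) = e * f" using idems_mult[OF e f] by (simp add: idems_def mult.assoc)
  have fe_idem: "f * (e * (f * e)) = f * e" using idems_mult[OF f e] by (simp add: idems_def mult.assoc)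
  have "star (e * f) = f * e" by (rule star_unique) (simp_all add: mult.assoc e_idem f_idem ef_idem fe_idem)
  moreover have "star (e * f) = e * f" by (rule star_unique) (simp_all add: mult.assoc e_idem f_idem ef_idem)
  ultimately show ?thesis by simp
qed

lemma star_mult: "star (s * t) = star t * star s" for s t :: 's
proof (rule star_unique)
  note commute = idems_commute[OF star_idems(2)[of s] star_idems(1)[of t]]
  have "s * t * (star t * star s) * (s * t) = s * ((t * star t) * (star s * s)) * t"
    by (simp add: mult.assoc)
  also have "\<dots> = (s * star s * s) * (t * star t * t)" unfolding commute[symmetric] by (simp add: mult.assoc)
  finally show "s * t * (star t * star s) * (s * t) = s * t" by (simp add: star_inverse)
  have "star t * star s * (s * t) * (star t * star s) = star t * ((star s * s) * (t * star t)) * star s"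
    by (simp add: mult.assoc)
  also have "\<dots> = (star t * t * star t) * (star s * s * star s)" unfolding commute by (simp add: mult.assoc)
  finally show "star t * star s * (s * t) * (star t * star s) = star t * star s" by (simp add: star_inverse)
qed

end

section \<open>The quotient by the ideal\<close>

lemma Jideal_iff_approx: "f \<in> Jideal \<longleftrightarrow> f \<in> l1 \<and> (\<forall>\<epsilon>>0. \<exists>g\<in>Jspan. l1norm (f - g) < \<epsilon>)"
  by (simp add: Jideal_def fun_diff_def)

lemma Jspan_induct [consumes 1, case_names zero add]:
  assumes "f \<in> Jspan" and zero: "P 0"
    and add: "\<And>f c s e t. e \<in> idems \<Longrightarrow> f \<in> l1 \<Longrightarrow> P f \<Longrightarrow>
      P (f + (\<lambda>u. c * (delta (s * e * t) - delta (s * t)) u))"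
  shows "P f"
proof -
  define partial where
    "partial m c s e t = (\<lambda>u. \<Sum>i<m. c i * (delta (s i * e i * t i) - delta (s i * t i)) u)"
    for m :: nat and c and s e t :: "nat \<Rightarrow> 'a"
  obtain m c s e t where e: "\<forall>i<m. e i \<in> idems" and f: "f = partial m c s e t"
    using assms(1) unfolding Jspan_def mem_Collect_eq partial_def minus_apply by blast
  have "partial m c s e t \<in> l1 \<and> P (partial m c s e t)"
    using e
  proof (induction m)
    case 0
    have "partial 0 c s e t = 0" by (simp add: partial_def fun_eq_iff)
    then show ?case using zero l1.zero_in by metis
  next
    case (Suc m)
    let ?d = "\<lambda>u. c m * (delta (s m * e m * t m) - delta (s m * t m)) u"
    have "partial (Suc m) c s e t = partial m c s e t + ?d" by (simp add: partial_def fun_eq_iff)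
    moreover have "?d \<in> l1" by (intro l1.sm_in l1.diff_in delta_l1)
    ultimately show ?case using Suc add[of "e m"] l1.add_in by (metis less_Suc_eq)
  qed
  then show ?thesis by (simp add: f)
qed

lemma Jspan_l1: "f \<in> Jspan \<Longrightarrow> f \<in> l1"
  by (induction rule: Jspan_induct) (blast intro: l1.zero_in l1.add_in l1.sm_in l1.diff_in delta_l1)+

lemma push_Jspan:
  assumes "f \<in> Jspan" and h: "\<And>s e t. e \<in> idems \<Longrightarrow> h (s * e * t) = h (s * t)"
  shows "push h f = 0"
  using assms(1)
proof (induction rule: Jspan_induct)
  case zero
  then show ?case by (simp add: push_def fun_eq_iff)
next
  case (add f c s e t)
  let ?d = "delta (s * e * t) - delta (s * t)"
  have diff_l1: "?d \<in> l1" by (intro l1.diff_in delta_l1)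
  have "push h ?d + push h (delta (s * t)) = push h (?d + delta (s * t))"
    by (rule push_add[OF diff_l1 delta_l1(1), symmetric])
  then have "push h ?d = 0" by (simp add: push_delta h[OF add.hyps(1)])
  then have "push h (\<lambda>u. c * ?d u) = 0" by (simp only: push_scale) (simp add: fun_eq_iff)
  then show ?case using push_add[OF add.hyps(2) l1.sm_in[OF diff_l1]] add.IH by (metis add_0)
qed

lemma push_Jideal:
  assumes f: "f \<in> Jideal" and h: "\<And>s e t. e \<in> idems \<Longrightarrow> h (s * e * t) = h (s * t)"
  shows "push h f = 0"
proof (rule l1norm_eq_0D)
  have f_l1: "f \<in> l1" using f by (simp add: Jideal_iff_approx)
  show "push h f \<in> l1" by (rule push_l1(1)[OF f_l1])
  show "l1norm (push h f) \<le> 0"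
  proof (rule field_le_epsilon)
    fix \<epsilon> :: real assume "0 < \<epsilon>"
    then obtain g where g: "g \<in> Jspan" and less: "l1norm (f - g) < \<epsilon>"
      using f by (auto simp: Jideal_iff_approx)
    have diff_l1: "f - g \<in> l1" by (rule l1.diff_in[OF f_l1 Jspan_l1[OF g]])
    have "push h f = push h (f - g)"
      using push_add[OF diff_l1 Jspan_l1[OF g], of h] push_Jspan[OF g h] by simp
    then show "l1norm (push h f) \<le> 0 + \<epsilon>" using push_l1(2)[OF diff_l1, of h] less by simp
  qed
qed

locale quotient_tower =
  fixes L :: nat and q :: "('s::semigroup_mult \<Rightarrow> complex) \<Rightarrow> 'v::ab_group_add"
    and sm :: "complex \<Rightarrow> 'v \<Rightarrow> 'v" and V :: "nat \<Rightarrow> 'v set"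
    and pr :: "nat \<Rightarrow> 'v \<Rightarrow> 'v \<Rightarrow> complex" and nv :: "nat \<Rightarrow> 'v \<Rightarrow> real"
  assumes inv: "inverse_semigroup TYPE('s)" and tower: "dual_tower L q sm V pr nv"
begin

lemma q_in: "f \<in> l1 \<Longrightarrow> q f \<in> V 0"
  and q_surj: "x \<in> V 0 \<Longrightarrow> \<exists>f\<in>l1. q f = x"
  and q_eq_iff: "f \<in> l1 \<Longrightarrow> g \<in> l1 \<Longrightarrow> q f = q g \<longleftrightarrow> f - g \<in> Jideal"
  and q_add: "f \<in> l1 \<Longrightarrow> g \<in> l1 \<Longrightarrow> q (f + g) = q f + q g"
  and q_scale: "f \<in> l1 \<Longrightarrow> q (\<lambda>u. c * f u) = sm c (q f)"
  and nv_q: "f \<in> l1 \<Longrightarrow> nv 0 (q f) = Inf {l1norm (f + j) | j. j \<in> Jideal}"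
  using tower by (simp_all add: dual_tower_def fun_diff_def plus_fun_def)

lemma q_additive: "additive_on l1 q"
  by (simp add: additive_on_def q_add)

lemmas q_zero = additive_on_zero[OF q_additive l1.subgroup]
  and q_minus = additive_on_minus[OF q_additive l1.subgroup]
  and q_diff = additive_on_diff[OF q_additive l1.subgroup]

lemma Jideal_iff: "f \<in> Jideal \<longleftrightarrow> f \<in> l1 \<and> q f = 0"
  using q_eq_iff[OF _ l1.zero_in, of f] by (auto simp: q_zero Jideal_iff_approx)

lemma nv_q_le:
  assumes f: "f \<in> l1"
  shows "nv 0 (q f) \<le> l1norm f"
  unfolding nv_q[OF f]
proof (rule cInf_lower)
  show "l1norm f \<in> {l1norm (f + j) | j. j \<in> Jideal}"
    by (intro CollectI exI[of _ 0]) (simp add: Jideal_iff l1.zero_in q_zero)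
  show "bdd_below {l1norm (f + j) | j. j \<in> Jideal}"
    using f by (intro bdd_belowI[of _ 0]) (auto simp: Jideal_iff intro!: l1.N_nonneg l1.add_in)
qed

lemma q_eq_0D:
  assumes f: "f \<in> l1" and nv: "nv 0 (q f) \<le> 0"
  shows "q f = 0"
proof -
  have "\<exists>h\<in>Jspan. l1norm (f - h) < \<epsilon>" if \<epsilon>: "0 < \<epsilon>" for \<epsilon>
  proof -
    have "{l1norm (f + j) | j. j \<in> Jideal} \<noteq> {}" using l1.zero_in by (auto simp: Jideal_iff q_zero)
    then obtain j where j: "j \<in> Jideal" "l1norm (f + j) < \<epsilon> / 2"
      using cInf_lessD[of "{l1norm (f + j) | j. j \<in> Jideal}" "\<epsilon> / 2"] nv \<epsilon> unfolding nv_q[OF f] by auto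
    then have "- j \<in> Jideal" by (simp add: Jideal_iff l1.minus_in q_minus)
    then obtain h where h: "h \<in> Jspan" "l1norm (- j - h) < \<epsilon> / 2" and "- j \<in> l1"
      using \<epsilon> unfolding Jideal_iff_approx by (auto dest: spec[of _ "\<epsilon> / 2"])
    have "f + j \<in> l1" using f j(1) by (simp add: Jideal_iff l1.add_in)
    from l1.N_add[OF this l1.diff_in[OF \<open>- j \<in> l1\<close> Jspan_l1[OF h(1)]]]
    have "l1norm (f - h) \<le> l1norm (f + j) + l1norm (- j - h)" by simp
    then show ?thesis using h j(2) by (intro bexI[of _ h]) simp_all
  qed
  then have "f \<in> Jideal" by (simp add: Jideal_iff_approx f)
  then show ?thesis by (simp add: Jideal_iff)
qed

lemma q_operator_vanishes:
  assumes A: "l1_operator C A" and delta: "\<And>s. q (A (delta s)) = 0" and f: "f \<in> l1"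
  shows "q (A f) = 0"
proof (rule q_eq_0D)
  note A = bounded_operatorD[OF A]
  show "A f \<in> l1" by (rule A(1)[OF f])
  show "nv 0 (q (A f)) \<le> 0"
  proof (rule l1_additive_vanishes[OF f, where T = "\<lambda>f. q (A f)"])
    show "q (A (f + g)) = q (A f) + q (A g)" if "f \<in> l1" "g \<in> l1" for f g
      using that by (simp add: A q_add)
    show "q (A (\<lambda>u. c * delta s u)) = 0" for c s
      using q_scale[OF l1.zero_in, of c] by (simp add: A(3) q_scale A(1) delta_l1(1) delta q_zero flip: zero_fun_def)
    show "nv 0 (q (A f)) \<le> C * l1norm f" if "f \<in> l1" for f
      using nv_q_le[OF A(1)[OF that]] A(2)[OF that] by simp
  qed
qed

text \<open>A choice of representatives of the classes of the maximal group image of the semigroup,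
  whose congruence identifies \<open>s\<close> and \<open>t\<close> iff \<open>delta s - delta t\<close> lies in \<open>J\<close>.\<close>

definition rep :: "'s \<Rightarrow> 's" where
  "rep s = (SOME t. q (delta t) = q (delta s))"

lemma q_delta_rep: "q (delta (rep s)) = q (delta s)"
  unfolding rep_def by (rule someI[of _ s]) simp

lemma rep_eq_iff: "rep s = rep t \<longleftrightarrow> q (delta s) = q (delta t)"
  using q_delta_rep unfolding rep_def by metis

lemma rep_rep: "rep (rep s) = rep s"
  by (simp add: rep_eq_iff q_delta_rep)

lemma rep_middle:
  assumes e: "e \<in> idems"
  shows "rep (s * e * t) = rep (s * t)"
proof -
  let ?d = "\<lambda>u. delta (s * e * t) u - delta (s * t) u"
  have "?d \<in> Jspan"
    unfolding Jspan_def using e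
    by (intro CollectI exI[of _ 1] exI[of _ "\<lambda>_. 1"] exI[of _ "\<lambda>_. s"] exI[of _ "\<lambda>_. e"] exI[of _ "\<lambda>_. t"]) simp
  moreover from this have "?d \<in> l1" by (rule Jspan_l1)
  ultimately have "?d \<in> Jideal" by (auto simp: Jideal_iff_approx l1.N_zero intro!: bexI)
  then show ?thesis by (simp add: rep_eq_iff q_eq_iff delta_l1 fun_diff_def)
qed

lemma rep_idem_right:
  assumes e: "e \<in> idems"
  shows "rep (s * e) = rep s"
proof -
  have "s * e = s * (star s * s * e)" using star_inverse(1)[OF inv, of s] by (simp flip: mult.assoc)
  also have "star s * s * e = e * (star s * s)" by (rule idems_commute[OF inv star_idems(2)[OF inv] e])
  also have "s * \<dots> = s * e * (star s * s)" by (simp only: mult.assoc)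
  finally have "rep (s * e) = rep (s * e * (star s * s))" by (rule arg_cong)
  also have "\<dots> = rep (s * (star s * s))" by (rule rep_middle[OF e])
  finally show ?thesis using star_inverse(1)[OF inv, of s] by (simp add: mult.assoc)
qed

lemma rep_idem_left:
  assumes e: "e \<in> idems"
  shows "rep (e * s) = rep s"
proof -
  have "e * s = e * (s * star s) * s" using star_inverse(1)[OF inv, of s] by (simp add: mult.assoc)
  also have "e * (s * star s) = s * star s * e" by (rule idems_commute[OF inv e star_idems(1)[OF inv]])
  finally have "rep (e * s) = rep (s * star s * s)" by (simp only: rep_middle[OF e])
  then show ?thesis by (simp only: star_inverse(1)[OF inv])
qed

lemma push_rep_Jideal: "f \<in> Jideal \<Longrightarrow> push rep f = 0"
  by (rule push_Jideal[OF _ rep_middle])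

lemma q_push_rep:
  assumes f: "f \<in> l1"
  shows "q (push rep f) = q f"
proof -
  have operator: "l1_operator (1 + 1) (\<lambda>f. push rep f - f)"
    using l1.bounded_operator_diff[OF l1_operator_push l1.bounded_operator_scale[of 1]] by simp
  have "q (push rep f - f) = 0"
    by (rule q_operator_vanishes[OF operator _ f]) (simp add: push_delta q_diff delta_l1 q_delta_rep)
  then show ?thesis by (simp add: q_diff push_l1 f)
qed

lemma q_eq_push_iff:
  assumes f: "f \<in> l1" and g: "g \<in> l1"
  shows "q f = q g \<longleftrightarrow> push rep f = push rep g"
proof
  assume "q f = q g"
  then have "push rep (f - g) = 0" using push_rep_Jideal q_eq_iff[OF f g] by blast
  then show "push rep f = push rep g" using push_add[OF l1.diff_in[OF f g] g, of rep] by simp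
qed (metis q_push_rep f g)

definition lift :: "'v \<Rightarrow> 's \<Rightarrow> complex" where
  "lift x = (SOME f. f \<in> l1 \<and> q f = x)"

definition coords :: "'v \<Rightarrow> 's \<Rightarrow> complex" where
  "coords x = push rep (lift x)"

lemma
  assumes "x \<in> V 0"
  shows lift_l1: "lift x \<in> l1" and q_lift: "q (lift x) = x"
  unfolding lift_def using someI_ex[of "\<lambda>f. f \<in> l1 \<and> q f = x"] q_surj[OF assms] by auto

lemma coords_q: "f \<in> l1 \<Longrightarrow> coords (q f) = push rep f"
  unfolding coords_def using q_in q_eq_push_iff lift_l1 q_lift by metis

lemma coords_l1: "x \<in> V 0 \<Longrightarrow> coords x \<in> l1"
  by (simp add: coords_def lift_l1 push_l1)

lemma q_coords: "x \<in> V 0 \<Longrightarrow> q (coords x) = x"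
  by (simp add: coords_def lift_l1 q_lift q_push_rep)

lemma coords_add: "x \<in> V 0 \<Longrightarrow> y \<in> V 0 \<Longrightarrow> coords (x + y) = coords x + coords y"
  using coords_q[OF l1.add_in[OF lift_l1 lift_l1]] by (simp add: q_add q_lift lift_l1 push_add coords_def)

lemma coords_sm: "x \<in> V 0 \<Longrightarrow> coords (sm c x) = (\<lambda>u. c * coords x u)"
  using coords_q[OF l1.sm_in[OF lift_l1], of x c] by (simp add: q_scale q_lift lift_l1 push_scale coords_def)

lemma coords_supp: "u \<notin> range rep \<Longrightarrow> coords x u = 0"
  unfolding coords_def by (rule push_supp)

lemma coords_surj: "f \<in> l1 \<Longrightarrow> (\<And>u. u \<notin> range rep \<Longrightarrow> f u = 0) \<Longrightarrow> coords (q f) = f"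
  unfolding coords_q by (rule push_id_on[of "range rep"]) (auto simp: rep_rep)

lemma nv_coords:
  assumes x: "x \<in> V 0"
  shows "nv 0 x = l1norm (coords x)"
proof (rule antisym)
  note coords_x = coords_l1[OF x]
  show "nv 0 x \<le> l1norm (coords x)" using nv_q_le[OF coords_x] by (simp add: q_coords[OF x])
  have "l1norm (coords x) \<le> Inf {l1norm (coords x + j) | j. j \<in> Jideal}"
  proof (rule cInf_greatest)
    show "{l1norm (coords x + j) | j. j \<in> Jideal} \<noteq> {}" using l1.zero_in by (auto simp: Jideal_iff q_zero)
    fix t assume "t \<in> {l1norm (coords x + j) | j. j \<in> Jideal}"
    then obtain j where j: "j \<in> Jideal" "t = l1norm (coords x + j)" by auto
    then have j_l1: "j \<in> l1" by (simp add: Jideal_iff)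
    have "push rep (coords x + j) = coords x"
      using coords_q[OF coords_x] by (simp add: push_add[OF coords_x j_l1] push_rep_Jideal[OF j(1)] q_coords[OF x])
    then show "l1norm (coords x) \<le> t" using push_l1(2)[OF l1.add_in[OF coords_x j_l1], of rep] j(2) by simp
  qed
  also have "\<dots> = nv 0 x" using nv_q[OF coords_x] by (simp add: q_coords[OF x])
  finally show "l1norm (coords x) \<le> nv 0 x" .
qed

end

section \<open>Norms on the dual tower\<close>

lemma has_sum_bool_split:
  fixes g h :: "'a \<Rightarrow> real"
  assumes "g summable_on UNIV" "h summable_on UNIV"
  shows "((\<lambda>(u, b). if b then g u else h u) has_sum (infsum g UNIV + infsum h UNIV)) UNIV"
proof -
  let ?f = "\<lambda>(u, b). if b then g u else h u"
  have "(?f has_sum infsum g UNIV) (range (\<lambda>u. (u, True)))"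
    using assms(1) by (subst has_sum_reindex) (auto simp: inj_on_def o_def)
  moreover have "(?f has_sum infsum h UNIV) (range (\<lambda>u. (u, False)))"
    using assms(2) by (subst has_sum_reindex) (auto simp: inj_on_def o_def)
  ultimately have "(?f has_sum (infsum g UNIV + infsum h UNIV)) (range (\<lambda>u. (u, True)) \<union> range (\<lambda>u. (u, False)))"
    by (rule has_sum_Un_disjoint) auto
  moreover have "range (\<lambda>u. (u, True)) \<union> range (\<lambda>u. (u, False)) = (UNIV :: ('a \<times> bool) set)"
    by (auto simp: image_iff)
  ultimately show ?thesis by simp
qed

context quotient_tower
begin

definition real_coords :: "'v \<Rightarrow> 's \<times> bool \<Rightarrow> real" where
  "real_coords x = (\<lambda>(u, b). if b then Re (coords x u) else Im (coords x u))"

text \<open>\<open>real_norm k\<close> is a norm on \<open>V k\<close> as a real vector space, equivalent to \<open>nv k\<close>.  At level \<open>0\<close> real and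
  imaginary parts are separated, so that \<open>V 0\<close> becomes a real \<open>\<ell>\<^sup>1\<close> space.\<close>

primrec real_norm :: "nat \<Rightarrow> 'v \<Rightarrow> real" where
  "real_norm 0 x = (\<Sum>\<^sub>\<infinity>w. \<bar>real_coords x w\<bar>)"
| "real_norm (Suc k) \<phi> = dual_norm (V k) (real_norm k) (\<lambda>x. Re (pr k \<phi> x))"

declare real_norm.simps [simp del]

context
  fixes x assumes x: "x \<in> V 0"
begin

lemma coords_summable:
  "(\<lambda>u. \<bar>Re (coords x u)\<bar>) summable_on UNIV" "(\<lambda>u. \<bar>Im (coords x u)\<bar>) summable_on UNIV"
  by (rule summable_on_comparison_test[OF l1_summable(1)[OF coords_l1[OF x]]];
      simp add: abs_Re_le_cmod abs_Im_le_cmod)+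

lemma real_coords_has_sum: "((\<lambda>w. \<bar>real_coords x w\<bar>) has_sum real_norm 0 x) UNIV"
  and real_norm_0: "real_norm 0 x = (\<Sum>\<^sub>\<infinity>u. \<bar>Re (coords x u)\<bar>) + (\<Sum>\<^sub>\<infinity>u. \<bar>Im (coords x u)\<bar>)"
proof -
  have "(\<lambda>w. \<bar>real_coords x w\<bar>) = (\<lambda>(u, b). if b then \<bar>Re (coords x u)\<bar> else \<bar>Im (coords x u)\<bar>)"
    by (auto simp: real_coords_def fun_eq_iff)
  then have has_sum: "((\<lambda>w. \<bar>real_coords x w\<bar>) has_sum ((\<Sum>\<^sub>\<infinity>u. \<bar>Re (coords x u)\<bar>) + (\<Sum>\<^sub>\<infinity>u. \<bar>Im (coords x u)\<bar>))) UNIV"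
    using has_sum_bool_split[OF coords_summable] by simp
  then show "real_norm 0 x = (\<Sum>\<^sub>\<infinity>u. \<bar>Re (coords x u)\<bar>) + (\<Sum>\<^sub>\<infinity>u. \<bar>Im (coords x u)\<bar>)"
    by (simp add: real_norm.simps infsumI)
  with has_sum show "((\<lambda>w. \<bar>real_coords x w\<bar>) has_sum real_norm 0 x) UNIV" by simp
qed

lemma real_coords_summable: "(\<lambda>w. \<bar>real_coords x w\<bar>) summable_on UNIV"
  using real_coords_has_sum by (rule has_sum_imp_summable)

lemma real_norm_0_le: "real_norm 0 x \<le> 2 * nv 0 x"
  and nv_0_le: "nv 0 x \<le> real_norm 0 x"
proof -
  note summable = l1_summable(1)[OF coords_l1[OF x], of UNIV]
  have "(\<Sum>\<^sub>\<infinity>u. \<bar>Re (coords x u)\<bar>) \<le> l1norm (coords x)" "(\<Sum>\<^sub>\<infinity>u. \<bar>Im (coords x u)\<bar>) \<le> l1norm (coords x)"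
    unfolding l1norm_def by (rule infsum_mono[OF _ summable];
        simp add: coords_summable abs_Re_le_cmod abs_Im_le_cmod)+
  then show "real_norm 0 x \<le> 2 * nv 0 x" by (simp add: real_norm_0 nv_coords[OF x])
  have "l1norm (coords x) \<le> (\<Sum>\<^sub>\<infinity>u. \<bar>Re (coords x u)\<bar> + \<bar>Im (coords x u)\<bar>)"
    unfolding l1norm_def by (rule infsum_mono[OF summable summable_on_add[OF coords_summable] cmod_le])
  also have "\<dots> = real_norm 0 x" unfolding real_norm_0 by (rule infsum_add[OF coords_summable])
  finally show "nv 0 x \<le> real_norm 0 x" by (simp add: nv_coords[OF x])
qed

end

lemma real_coords_add: "x \<in> V 0 \<Longrightarrow> y \<in> V 0 \<Longrightarrow> real_coords (x + y) w = real_coords x w + real_coords y w"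
  by (cases w) (simp add: real_coords_def coords_add)

lemma real_coords_supp: "w \<notin> range rep \<times> UNIV \<Longrightarrow> real_coords x w = 0"
  using coords_supp by (cases w) (auto simp: real_coords_def)

lemma real_coords_surj:
  assumes supp: "\<And>w. w \<notin> range rep \<times> UNIV \<Longrightarrow> f w = 0" and summable: "(\<lambda>w. \<bar>f w\<bar>) summable_on UNIV"
  shows "\<exists>x\<in>V 0. real_coords x = f"
proof -
  define F where "F u = Complex (f (u, True)) (f (u, False))" for u
  have slice: "(\<lambda>u. \<bar>f (u, b)\<bar>) summable_on UNIV" for b
    using summable_on_reindex[of "\<lambda>u. (u, b)" UNIV "\<lambda>w. \<bar>f w\<bar>"]
      summable_on_subset_banach[OF summable, of "range (\<lambda>u. (u, b))"]
    by (simp add: inj_on_def o_def)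
  have "(\<lambda>u. norm (F u)) summable_on UNIV"
    by (rule summable_on_comparison_test[OF summable_on_add[OF slice[of True] slice[of False]]])
       (auto simp: F_def intro: order_trans[OF cmod_le])
  then have F: "F \<in> l1" by (simp add: l1_def)
  have "coords (q F) = F" using F supp by (intro coords_surj) (auto simp: F_def Complex_eq_0)
  then have "real_coords (q F) = f" by (auto simp: real_coords_def F_def fun_eq_iff)
  then show ?thesis using q_in[OF F] by blast
qed

lemma complex_space_0: "complex_space (V 0) sm (real_norm 0)"
proof
  show "0 \<in> V 0" using q_in[OF l1.zero_in] by (simp add: q_zero)
  fix x assume x: "x \<in> V 0"
  then obtain f where f: "f \<in> l1" "q f = x" using q_surj by blast
  have sm_q: "sm c x = q (\<lambda>u. c * f u)" for c using q_scale[OF f(1)] by (simp add: f(2))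
  show "sm c x \<in> V 0" for c by (simp add: sm_q q_in l1.sm_in f(1))
  show "sm (c + d) x = sm c x + sm d x" for c d
    by (simp add: sm_q l1.sm_add_left q_add l1.sm_in f(1))
  show "sm c (sm d x) = sm (c * d) x" for c d
    by (simp add: sm_q mult.assoc flip: q_scale[OF l1.sm_in[OF f(1)]])
  show "sm 1 x = x" by (simp add: sm_q f(2))
  have "real_coords (sm (of_real a) x) w = a * real_coords x w" for a w
    using x by (cases w) (simp add: real_coords_def coords_sm)
  then show "real_norm 0 (sm (of_real a) x) = \<bar>a\<bar> * real_norm 0 x" for a
    by (simp add: real_norm.simps abs_mult infsum_cmult_right')
  show "real_norm 0 (sm \<i> x) = real_norm 0 x"
    using x \<open>sm \<i> x \<in> V 0\<close> by (simp add: real_norm_0 coords_sm)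
  fix y assume y: "y \<in> V 0"
  then obtain g where g: "g \<in> l1" "q g = y" using q_surj by blast
  note fg = l1.add_in[OF f(1) g(1)]
  have q_fg: "q (f + g) = x + y" by (simp add: q_add f g)
  then show xy: "x + y \<in> V 0" using q_in[OF fg] by simp
  show "sm c (x + y) = sm c x + sm c y" for c
    using q_scale[OF fg, of c] q_scale[OF g(1), of c] q_add[OF l1.sm_in[OF f(1)] l1.sm_in[OF g(1)], of c c]
    unfolding l1.sm_add_right[OF f(1) g(1)] by (simp add: q_fg sm_q g(2))
  have "real_norm 0 (x + y) \<le> (\<Sum>\<^sub>\<infinity>w. \<bar>real_coords x w\<bar> + \<bar>real_coords y w\<bar>)"
    unfolding real_norm.simps(1)
    by (intro infsum_mono summable_on_add real_coords_summable x y xy) (simp add: real_coords_add[OF x y])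
  also have "\<dots> = real_norm 0 x + real_norm 0 y"
    unfolding real_norm.simps(1) by (rule infsum_add[OF real_coords_summable[OF x] real_coords_summable[OF y]])
  finally show "real_norm 0 (x + y) \<le> real_norm 0 x + real_norm 0 y" .
qed

lemma equivalent_norms_0: "equivalent_norms (V 0) (real_norm 0) (nv 0)"
proof -
  have "nv 0 x \<le> 2 * real_norm 0 x" if "x \<in> V 0" for x
    using nv_0_le[OF that] infsum_nonneg[of UNIV "\<lambda>w. \<bar>real_coords x w\<bar>"] by (simp add: real_norm.simps)
  then show ?thesis unfolding equivalent_norms_def using real_norm_0_le by (intro exI[of _ 2]) auto
qed

lemma complex_dual_Suc:
  assumes k: "k < L" and "complex_space (V k) sm (real_norm k)" and "equivalent_norms (V k) (real_norm k) (nv k)"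
  shows "complex_dual (V k) sm (real_norm k) (V (Suc k)) sm (real_norm (Suc k)) (pr k)"
proof -
  interpret complex_space "V k" sm "real_norm k" by fact
  show ?thesis
  proof
    fix \<phi> assume \<phi>: "\<phi> \<in> V (Suc k)"
    show "bfun (V k) sm (real_norm k) (pr k \<phi>)"
      using tower k \<phi> by (simp add: dual_tower_def flip: bfun_equivalent_norms[OF assms(3)])
    show "sm c \<phi> \<in> V (Suc k)" for c
      using tower k \<phi> by (simp add: dual_tower_def)
    show "pr k (sm c \<phi>) x = c * pr k \<phi> x" if "x \<in> V k" for c x
      using tower k \<phi> that by (simp add: dual_tower_def)
    fix \<psi> assume \<psi>: "\<psi> \<in> V (Suc k)"
    show "\<phi> + \<psi> \<in> V (Suc k)" using tower k \<phi> \<psi> by (simp add: dual_tower_def)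
    show "pr k (\<phi> + \<psi>) x = pr k \<phi> x + pr k \<psi> x" if "x \<in> V k" for x
      using tower k \<phi> \<psi> that by (simp add: dual_tower_def)
  next
    fix l assume "bfun (V k) sm (real_norm k) l"
    then show "\<exists>!\<phi>. \<phi> \<in> V (Suc k) \<and> (\<forall>x\<in>V k. pr k \<phi> x = l x)"
      using tower k by (simp add: dual_tower_def flip: bfun_equivalent_norms[OF assms(3)])
  qed (rule real_norm.simps(2))
qed

lemma complex_space_and_equivalent_norms:
  "k \<le> L \<Longrightarrow> complex_space (V k) sm (real_norm k) \<and> equivalent_norms (V k) (real_norm k) (nv k)"
proof (induction k)
  case 0
  show ?case using complex_space_0 equivalent_norms_0 by blast
next
  case (Suc k)
  then have k: "k < L" by simp
  interpret complex_dual "V k" sm "real_norm k" "V (Suc k)" sm "real_norm (Suc k)" "pr k"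
    using Suc k by (intro complex_dual_Suc) auto
  have "nv (Suc k) \<phi> = Sup {norm (pr k \<phi> x) | x. x \<in> V k \<and> nv k x \<le> 1}" if "\<phi> \<in> V (Suc k)" for \<phi>
    using tower k that by (simp add: dual_tower_def)
  then show ?case using equivalent_norms_dual Suc W.complex_space_axioms by auto
qed

lemma complex_space_level: "k \<le> L \<Longrightarrow> complex_space (V k) sm (real_norm k)"
  and equivalent_norms_level: "k \<le> L \<Longrightarrow> equivalent_norms (V k) (real_norm k) (nv k)"
  using complex_space_and_equivalent_norms by auto

lemma complex_dual_level: "k < L \<Longrightarrow> complex_dual (V k) sm (real_norm k) (V (Suc k)) sm (real_norm (Suc k)) (pr k)"
  by (intro complex_dual_Suc complex_space_level equivalent_norms_level) auto

end

section \<open>Module actions on the dual tower\<close>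

context quotient_tower
begin

lemmas pr_eqI = complex_dual.pr_eqI[OF complex_dual_level]
  and pr_add = complex_dual.pr_add[OF complex_dual_level]
  and pr_sm = complex_dual.pr_sm[OF complex_dual_level]
  and pr_arg_add = complex_dual.pr_arg_add[OF complex_dual_level]
  and pr_arg_sm = complex_dual.pr_arg_sm[OF complex_dual_level]
  and V_sm = complex_space.sm_in[OF complex_space_level]

lemma V_add: "k \<le> L \<Longrightarrow> x \<in> V k \<Longrightarrow> y \<in> V k \<Longrightarrow> x + y \<in> V k"
  using tower by (simp add: dual_tower_def)

lemma q_push_eq_0:
  fixes h :: "'s \<Rightarrow> 's"
  assumes j: "j \<in> Jideal" and h: "\<And>s e t. e \<in> idems \<Longrightarrow> rep (h (s * e * t)) = rep (h (s * t))"
  shows "q (push h j) = 0"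
proof -
  have j_l1: "j \<in> l1" using j by (simp add: Jideal_iff)
  have "push rep (push h j) = 0"
    unfolding push_push[OF j_l1] by (rule push_Jideal[OF j]) (rule h)
  then show ?thesis using q_push_rep[OF push_l1(1)[OF j_l1]] q_zero by metis
qed

lemma
  assumes j: "j \<in> Jideal"
  shows q_push_mult_left: "q (push (\<lambda>t. s * t) j) = 0" and q_push_mult_right: "q (push (\<lambda>t. t * s) j) = 0"
proof -
  show "q (push (\<lambda>t. s * t) j) = 0"
    by (rule q_push_eq_0[OF j]) (use rep_middle[of _ "s * r" for r] in \<open>simp add: mult.assoc\<close>)
  show "q (push (\<lambda>t. t * s) j) = 0"
    by (rule q_push_eq_0[OF j]) (use rep_middle[of _ r "t * s" for r t] in \<open>simp add: mult.assoc\<close>)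
qed

lemma rep_mult_right: "rep (s * rep t) = rep (s * t)"
  and rep_mult_left: "rep (rep s * t) = rep (s * t)"
proof -
  have J: "delta (rep t) - delta t \<in> Jideal" for t
    by (simp add: Jideal_iff l1.diff_in delta_l1 q_diff q_delta_rep)
  have push_diff: "push h (delta a - delta b) = delta (h a) - delta (h b)" for h :: "'s \<Rightarrow> 's" and a b
    using push_add[OF l1.diff_in[OF delta_l1(1) delta_l1(1)] delta_l1(1), of h a b b]
    by (simp add: push_delta eq_diff_eq)
  show "rep (s * rep t) = rep (s * t)" "rep (rep s * t) = rep (s * t)"
    using q_push_mult_left[OF J, of s t] q_push_mult_right[OF J, of t s]
    by (simp_all add: push_diff q_diff delta_l1 rep_eq_iff)
qed

lemma
  assumes j: "j \<in> Jideal" and f: "f \<in> l1"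
  shows q_conv_Jideal_right: "q (conv f j) = 0" and q_conv_Jideal_left: "q (conv j f) = 0"
proof -
  have j_l1: "j \<in> l1" using j by (simp add: Jideal_iff)
  show "q (conv f j) = 0"
    by (rule q_operator_vanishes[OF l1_operator_conv_right[OF j_l1] _ f])
       (simp add: conv_delta_left[OF j_l1] q_push_mult_left[OF j])
  show "q (conv j f) = 0"
    by (rule q_operator_vanishes[OF l1_operator_conv_left[OF j_l1] _ f])
       (simp add: conv_delta_right[OF j_l1] q_push_mult_right[OF j])
qed

lemma q_operator_cong:
  assumes A: "l1_operator C A" and J: "\<And>j. j \<in> Jideal \<Longrightarrow> q (A j) = 0"
    and g: "g \<in> l1" "g' \<in> l1" "q g = q g'"
  shows "q (A g) = q (A g')"
proof -
  have diff_l1: "g - g' \<in> l1" by (rule l1.diff_in[OF g(1,2)])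
  have "q (A (g - g')) = 0" using J q_eq_iff[OF g(1,2)] g(3) by simp
  moreover have "A g = A (g - g') + A g'" using bounded_operatorD(4)[OF A diff_l1 g(2)] by simp
  ultimately show ?thesis
    using q_add[OF bounded_operatorD(1)[OF A diff_l1] bounded_operatorD(1)[OF A g(2)]] by simp
qed

lemma bounded_operator_quotient:
  assumes A: "l1_operator C A" and T: "\<And>g. g \<in> l1 \<Longrightarrow> T (q g) = q (A g)"
  shows "bounded_operator (V 0) sm (real_norm 0) (2 * C) T"
  unfolding bounded_operator_def
proof (intro conjI ballI allI)
  note A = bounded_operatorD[OF A]
  have C: "0 \<le> C" using assms(1) by (simp add: bounded_operator_def)
  then show "0 \<le> 2 * C" by simp
  fix x assume x: "x \<in> V 0"
  define f where "f = coords x"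
  have f: "f \<in> l1" "q f = x" "l1norm f = nv 0 x"
    by (simp_all add: f_def coords_l1 q_coords nv_coords x)
  have Tx: "T x = q (A f)" using T[OF f(1)] f(2) by simp
  then show Tx_in: "T x \<in> V 0" by (simp add: q_in A(1) f(1))
  have "real_norm 0 (T x) \<le> 2 * l1norm (A f)"
    using real_norm_0_le[OF Tx_in] nv_q_le[OF A(1)[OF f(1)]] Tx by simp
  also have "\<dots> \<le> 2 * (C * real_norm 0 x)"
    using A(2)[OF f(1)] mult_left_mono[OF nv_0_le[OF x] C] f(3) by simp
  finally show "real_norm 0 (T x) \<le> 2 * C * real_norm 0 x" by simp
  show "T (sm c x) = sm c (T x)" for c
    using T[OF l1.sm_in[OF f(1)], of c] by (simp add: q_scale f(1,2) A(1,3) Tx)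
  fix y assume "y \<in> V 0"
  then obtain g where g: "g \<in> l1" "q g = y" using q_surj by blast
  show "T (x + y) = T x + T y"
    using T[OF l1.add_in[OF f(1) g(1)]] T[OF g(1)] by (simp add: q_add f(1,2) g A(1,4) Tx)
qed

definition act_l :: "nat \<Rightarrow> ('s \<Rightarrow> complex) \<Rightarrow> 'v \<Rightarrow> 'v" where
  "act_l k f x = Sl q V pr k f x"

definition act_r :: "nat \<Rightarrow> 'v \<Rightarrow> ('s \<Rightarrow> complex) \<Rightarrow> 'v" where
  "act_r k x f = Sr q V pr k x f"

abbreviation adj_level :: "nat \<Rightarrow> ('v \<Rightarrow> 'v) \<Rightarrow> 'v \<Rightarrow> 'v" where
  "adj_level k \<equiv> complex_dual.adj (V k) (V (Suc k)) (pr k)"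

lemmas adj_eqI = complex_dual.adj_eqI[OF complex_dual_level]

lemma act_0:
  assumes f: "f \<in> l1" and g: "g \<in> l1"
  shows act_l_0: "act_l 0 f (q g) = q (conv f g)" and act_r_0: "act_r 0 (q g) f = q (conv g f)"
proof -
  note lift = lift_l1[OF q_in[OF g]] g q_lift[OF q_in[OF g]]
  show "act_l 0 f (q g) = q (conv f g)" "act_r 0 (q g) f = q (conv g f)"
    using q_operator_cong[OF l1_operator_conv_left[OF f] q_conv_Jideal_right[OF _ f] lift]
      q_operator_cong[OF l1_operator_conv_right[OF f] q_conv_Jideal_left[OF _ f] lift]
    by (simp_all add: act_l_def act_r_def lift_def)
qed

lemma
  assumes "k < L"
  shows act_l_Suc: "act_l (Suc k) f = adj_level k (\<lambda>x. act_r k x f)"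
    and act_r_Suc: "(\<lambda>\<phi>. act_r (Suc k) \<phi> f) = adj_level k (act_l k f)"
  by (simp_all add: fun_eq_iff act_l_def act_r_def complex_dual.adj_def[OF complex_dual_level[OF assms]])

lemma bounded_operator_act:
  assumes f: "f \<in> l1"
  shows "k \<le> L \<Longrightarrow> bounded_operator (V k) sm (real_norm k) (2 * l1norm f) (act_l k f) \<and>
    bounded_operator (V k) sm (real_norm k) (2 * l1norm f) (\<lambda>x. act_r k x f)"
proof (induction k)
  case 0
  show ?case
    using bounded_operator_quotient[OF l1_operator_conv_left[OF f] act_l_0[OF f]]
      bounded_operator_quotient[OF l1_operator_conv_right[OF f] act_r_0[OF f]] by simp
next
  case (Suc k)
  then have k: "k < L" by simp
  interpret complex_dual "V k" sm "real_norm k" "V (Suc k)" sm "real_norm (Suc k)" "pr k"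
    by (rule complex_dual_level[OF k])
  show ?case
    unfolding act_l_Suc[OF k] act_r_Suc[OF k] using Suc by (intro conjI bounded_operator_adj) auto
qed

lemma
  assumes "k \<le> L" "f \<in> l1" "x \<in> V k"
  shows act_l_in: "act_l k f x \<in> V k" and act_r_in: "act_r k x f \<in> V k"
    and act_l_sm: "act_l k f (sm c x) = sm c (act_l k f x)"
    and act_r_sm: "act_r k (sm c x) f = sm c (act_r k x f)"
    and act_l_add: "y \<in> V k \<Longrightarrow> act_l k f (x + y) = act_l k f x + act_l k f y"
    and act_r_add: "y \<in> V k \<Longrightarrow> act_r k (x + y) f = act_r k x f + act_r k y f"
    and real_norm_act_l_le: "real_norm k (act_l k f x) \<le> 2 * l1norm f * real_norm k x"
    and real_norm_act_r_le: "real_norm k (act_r k x f) \<le> 2 * l1norm f * real_norm k x"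
  using bounded_operatorD[OF conjunct1[OF bounded_operator_act[OF assms(2,1)]] assms(3)]
    bounded_operatorD[OF conjunct2[OF bounded_operator_act[OF assms(2,1)]] assms(3)] by simp_all

lemma
  assumes k: "k < L" and f: "f \<in> l1" and "\<phi> \<in> V (Suc k)" "x \<in> V k"
  shows pr_act_l: "pr k (act_l (Suc k) f \<phi>) x = pr k \<phi> (act_r k x f)"
    and pr_act_r: "pr k (act_r (Suc k) \<phi> f) x = pr k \<phi> (act_l k f x)"
proof -
  interpret complex_dual "V k" sm "real_norm k" "V (Suc k)" sm "real_norm (Suc k)" "pr k"
    by (rule complex_dual_level[OF k])
  note operators = bounded_operator_act[OF f less_imp_le[OF k]]
  show "pr k (act_l (Suc k) f \<phi>) x = pr k \<phi> (act_r k x f)"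
    using pr_adj[OF conjunct2[OF operators] assms(3,4)] by (simp add: act_l_Suc[OF k])
  show "pr k (act_r (Suc k) \<phi> f) x = pr k \<phi> (act_l k f x)"
    using pr_adj[OF conjunct1[OF operators] assms(3,4)] fun_cong[OF act_r_Suc[OF k]] by simp
qed

lemma act_add_algebra:
  assumes f: "f \<in> l1" and g: "g \<in> l1"
  shows "k \<le> L \<Longrightarrow> x \<in> V k \<Longrightarrow> act_l k (f + g) x = act_l k f x + act_l k g x \<and>
    act_r k x (f + g) = act_r k x f + act_r k x g"
proof (induction k arbitrary: x)
  case 0
  then obtain h where h: "h \<in> l1" "q h = x" using q_surj by blast
  show ?case
    using bounded_operatorD(4)[OF l1_operator_conv_right[OF h(1)] f g]
      bounded_operatorD(4)[OF l1_operator_conv_left[OF h(1)] f g]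
    by (simp add: act_0 l1.add_in conv_l1 q_add f g h(1) flip: h(2) del: plus_fun_apply)
next
  case (Suc k)
  then have k: "k < L" "k \<le> L" "Suc k \<le> L" by auto
  note simps = pr_act_l[OF k(1)] pr_act_r[OF k(1)] pr_add[OF k(1)] pr_arg_add[OF k(1)]
    act_l_in[OF k(3)] act_r_in[OF k(3)] act_l_in[OF k(2)] act_r_in[OF k(2)] Suc.IH[OF k(2)] l1.add_in f g Suc.prems(2)
  show ?case
    by (intro conjI pr_eqI[OF k(1)] act_l_in act_r_in V_add k l1.add_in f g Suc.prems(2))
       (simp_all add: simps del: plus_fun_apply)
qed

lemma act_scale_algebra:
  assumes f: "f \<in> l1"
  shows "k \<le> L \<Longrightarrow> x \<in> V k \<Longrightarrow> act_l k (\<lambda>u. c * f u) x = sm c (act_l k f x) \<and>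
    act_r k x (\<lambda>u. c * f u) = sm c (act_r k x f)"
proof (induction k arbitrary: x)
  case 0
  then obtain h where h: "h \<in> l1" "q h = x" using q_surj by blast
  show ?case
    using bounded_operatorD(3)[OF l1_operator_conv_right[OF h(1)] f, of c]
      bounded_operatorD(3)[OF l1_operator_conv_left[OF h(1)] f, of c]
    by (simp add: act_0 l1.sm_in conv_l1 q_scale f h(1) flip: h(2))
next
  case (Suc k)
  then have k: "k < L" "k \<le> L" "Suc k \<le> L" by auto
  note simps = pr_act_l[OF k(1)] pr_act_r[OF k(1)] pr_sm[OF k(1)] pr_arg_sm[OF k(1)]
    act_l_in[OF k(3)] act_r_in[OF k(3)] act_l_in[OF k(2)] act_r_in[OF k(2)] Suc.IH[OF k(2)] l1.sm_in f Suc.prems(2)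
  show ?case
    by (intro conjI pr_eqI[OF k(1)] act_l_in act_r_in V_sm k l1.sm_in f Suc.prems(2)) (simp_all add: simps)
qed

lemma act_delta:
  "k \<le> L \<Longrightarrow> x \<in> V k \<Longrightarrow>
    act_l k (delta s) (act_l k (delta t) x) = act_l k (delta (s * t)) x \<and>
    act_r k (act_r k x (delta s)) (delta t) = act_r k x (delta (s * t)) \<and>
    act_r k (act_l k (delta s) x) (delta t) = act_l k (delta s) (act_r k x (delta t)) \<and>
    (e \<in> idems \<longrightarrow> act_l k (delta e) x = x \<and> act_r k x (delta e) = x)"
proof (induction k arbitrary: x s t)
  case 0
  then obtain h where h: "h \<in> l1" "q h = x" using q_surj by blast
  have delta: "act_l 0 (delta s) (q g) = q (push (\<lambda>a. s * a) g)" "act_r 0 (q g) (delta s) = q (push (\<lambda>a. a * s) g)"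
    if "g \<in> l1" for g s
    by (simp_all add: act_0 delta_l1 that conv_delta_left conv_delta_right)
  have "q (push (\<lambda>a. e * a) h) = q h" "q (push (\<lambda>a. a * e) h) = q h" if e: "e \<in> idems"
    by (simp_all add: q_eq_push_iff push_l1 push_push h(1) rep_idem_left[OF e] rep_idem_right[OF e])
  then show ?case
    using h by (auto simp: delta push_l1(1) push_push mult.assoc)
next
  case (Suc k)
  then have k: "k < L" "k \<le> L" "Suc k \<le> L" by auto
  note IH = Suc.IH[OF k(2), THEN conjunct1] Suc.IH[OF k(2), THEN conjunct2, THEN conjunct1]
    Suc.IH[OF k(2), THEN conjunct2, THEN conjunct2, THEN conjunct1]
    Suc.IH[OF k(2), THEN conjunct2, THEN conjunct2, THEN conjunct2, rule_format]
  note simps = pr_act_l[OF k(1)] pr_act_r[OF k(1)] act_l_in[OF k(3)] act_r_in[OF k(3)]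
    act_l_in[OF k(2)] act_r_in[OF k(2)] IH delta_l1(1) Suc.prems(2)
  show ?case
    by (intro conjI impI pr_eqI[OF k(1)] act_l_in act_r_in k delta_l1(1) Suc.prems(2)) (simp_all add: simps)
qed

lemma
  assumes "k \<le> L" "x \<in> V k"
  shows act_l_act_l: "act_l k (delta s) (act_l k (delta t) x) = act_l k (delta (s * t)) x"
    and act_r_act_r: "act_r k (act_r k x (delta s)) (delta t) = act_r k x (delta (s * t))"
    and act_r_act_l: "act_r k (act_l k (delta s) x) (delta t) = act_l k (delta s) (act_r k x (delta t))"
    and act_l_idem: "e \<in> idems \<Longrightarrow> act_l k (delta e) x = x"
    and act_r_idem: "e \<in> idems \<Longrightarrow> act_r k x (delta e) = x"
  using act_delta[OF assms] by blast+

lemma q_conv_idems: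
  assumes f: "f \<in> l1" and \<alpha>: "\<alpha> \<in> l1E"
  shows "q (conv f \<alpha>) = sm (infsum \<alpha> UNIV) (q f)"
proof -
  let ?c = "infsum \<alpha> UNIV"
  have \<alpha>l: "\<alpha> \<in> l1" and idems: "\<And>t. \<alpha> t \<noteq> 0 \<Longrightarrow> t \<in> idems" using \<alpha> by (auto simp: l1E_def)
  note operator = l1.bounded_operator_diff[OF l1_operator_conv_right[OF \<alpha>l] l1.bounded_operator_scale[of ?c]]
  have c_f: "(\<lambda>u. ?c * f u) \<in> l1" if "f \<in> l1" for f by (rule l1.sm_in[OF that])
  have "q (conv f \<alpha> - (\<lambda>u. ?c * f u)) = 0"
  proof (rule q_operator_vanishes[OF operator _ f])
    fix s
    have "push rep (conv (delta s) \<alpha>) = push (\<lambda>t. rep (s * t)) \<alpha>"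
      by (simp add: conv_delta_left push_push \<alpha>l)
    also have "\<dots> = (\<lambda>u. ?c * delta (rep s) u)" using rep_idem_right idems by (intro push_const) blast
    finally have "q (conv (delta s) \<alpha>) = q (\<lambda>u. ?c * delta s u)"
      by (simp add: q_eq_push_iff conv_l1 c_f delta_l1 \<alpha>l push_scale push_delta)
    then show "q (conv (delta s) \<alpha> - (\<lambda>u. ?c * delta s u)) = 0"
      by (simp add: q_diff conv_l1 c_f delta_l1 \<alpha>l)
  qed
  then show ?thesis by (simp add: q_diff conv_l1 c_f f \<alpha>l q_scale)
qed

lemma E_act:
  assumes \<alpha>: "\<alpha> \<in> l1E"
  shows "k \<le> L \<Longrightarrow> x \<in> V k \<Longrightarrow>
    El q V pr k \<alpha> x = sm (infsum \<alpha> UNIV) x \<and> Er q V pr k x \<alpha> = sm (infsum \<alpha> UNIV) x"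
proof (induction k arbitrary: x)
  case 0
  then show ?case
    using q_scale[OF lift_l1] q_conv_idems[OF lift_l1 \<alpha>] q_lift
    by (simp add: Eact_l_def Eact_r_def flip: lift_def)
next
  case (Suc k)
  then have k: "k < L" "k \<le> L" "Suc k \<le> L" and x: "x \<in> V (Suc k)" by auto
  have "adj_level k T x = sm (infsum \<alpha> UNIV) x" if "\<And>z. z \<in> V k \<Longrightarrow> T z = sm (infsum \<alpha> UNIV) z" for T
    using that by (intro adj_eqI[OF k(1)] V_sm[OF k(3) x]) (simp add: pr_sm[OF k(1) x] pr_arg_sm[OF k(1) x])
  then show ?case
    using Suc.IH[OF k(2)] by (simp add: complex_dual.adj_def[OF complex_dual_level[OF k(1)]])
qed

lemma commutative: "k \<le> L \<Longrightarrow> commutative_Emod q V pr k"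
  by (simp add: commutative_Emod_def E_act)

section \<open>Approximate means on the dual tower\<close>

definition conj_act :: "nat \<Rightarrow> 's \<Rightarrow> 'v \<Rightarrow> 'v" where
  "conj_act k g x = act_r k (act_l k (delta g) x) (delta (star g))"

lemma conj_act_in: "k \<le> L \<Longrightarrow> x \<in> V k \<Longrightarrow> conj_act k g x \<in> V k"
  by (simp add: conj_act_def act_l_in act_r_in delta_l1)

lemma conj_act_add:
  "k \<le> L \<Longrightarrow> x \<in> V k \<Longrightarrow> y \<in> V k \<Longrightarrow> conj_act k g (x + y) = conj_act k g x + conj_act k g y"
  by (simp add: conj_act_def act_l_in act_l_add act_r_add delta_l1)

lemma conj_act_star_conj_act:
  assumes k: "k \<le> L" and x: "x \<in> V k"
  shows "conj_act k (star g) (conj_act k g x) = x"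
proof -
  have xg_in: "act_r k x (delta (star g)) \<in> V k" by (rule act_r_in[OF k delta_l1(1) x])
  have "conj_act k (star g) (conj_act k g x) =
      act_r k (act_l k (delta (star g)) (act_l k (delta g) (act_r k x (delta (star g))))) (delta g)"
    by (simp add: conj_act_def star_star[OF inv] act_r_act_l[OF k x])
  also have "\<dots> = act_r k (act_r k x (delta (star g))) (delta g)"
    by (simp add: act_l_act_l[OF k xg_in] act_l_idem[OF k xg_in] star_idems[OF inv])
  also have "\<dots> = x" by (simp add: act_r_act_r[OF k x] act_r_idem[OF k x] star_idems[OF inv])
  finally show ?thesis .
qed

lemma pr_conj_act:
  "k < L \<Longrightarrow> \<phi> \<in> V (Suc k) \<Longrightarrow> x \<in> V k \<Longrightarrow> pr k (conj_act (Suc k) g \<phi>) x = pr k \<phi> (conj_act k (star g) x)"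
  by (simp add: conj_act_def star_star[OF inv] pr_act_l pr_act_r act_l_in delta_l1)

lemma rep_conj: "rep (star g * rep (g * t * star g) * g) = rep t"
proof -
  have "rep (star g * rep (g * t * star g) * g) = rep (rep (star g * rep (g * t * star g)) * g)"
    by (simp only: rep_mult_left)
  also have "\<dots> = rep (star g * (g * t * star g) * g)" by (simp only: rep_mult_left rep_mult_right)
  also have "\<dots> = rep ((star g * g) * t * (star g * g))" by (simp only: mult.assoc)
  also have "\<dots> = rep t"
    by (simp only: rep_idem_right[OF star_idems(2)[OF inv]] rep_idem_left[OF star_idems(2)[OF inv]])
  finally show ?thesis .
qed

lemma coords_conj_act:
  assumes x: "x \<in> V 0" and u: "u \<in> range rep"
  shows "coords (conj_act 0 g x) u = coords x (rep (star g * u * g))"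
proof -
  note coords_x = coords_l1[OF x]
  have rep_u: "rep u = u" using u rep_rep by auto
  have "conj_act 0 g x = q (push (\<lambda>t. g * t * star g) (coords x))"
    using act_l_0[OF delta_l1(1) coords_x] act_r_0[OF delta_l1(1) push_l1(1)[OF coords_x]]
    by (simp add: conj_act_def q_coords[OF x] conv_delta_left conv_delta_right push_l1 push_push coords_x)
  then have "coords (conj_act 0 g x) u = infsum (coords x) {t. rep (g * t * star g) = u}"
    by (simp add: coords_q push_l1 push_push coords_x) (simp add: push_def)
  also have "\<dots> = infsum (coords x) {rep (star g * u * g)}"
  proof (rule infsum_cong_neutral)
    show "coords x t = 0" if "t \<in> {rep (star g * u * g)} - {t. rep (g * t * star g) = u}" for t
      using that rep_conj[of "star g" u] rep_u by (auto simp: star_star[OF inv])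
    show "coords x t = 0" if "t \<in> {t. rep (g * t * star g) = u} - {rep (star g * u * g)}" for t
      using that rep_conj[of g t] rep_rep by (intro coords_supp) auto
  qed simp
  finally show ?thesis by simp
qed

definition conj_index :: "'s \<Rightarrow> 's \<times> bool \<Rightarrow> 's \<times> bool" where
  "conj_index g = (\<lambda>(u, b). (if u \<in> range rep then rep (star g * u * g) else u, b))"

lemma real_coords_conj_act: "x \<in> V 0 \<Longrightarrow> real_coords (conj_act 0 g x) w = real_coords x (conj_index g w)"
  using coords_conj_act coords_supp by (cases w) (simp add: real_coords_def conj_index_def)

lemma conj_index_star_conj_index: "conj_index (star g) (conj_index g w) = w"
  using rep_conj[of "star g"] rep_rep by (cases w) (auto simp: conj_index_def star_star[OF inv])

lemma real_norm_conj_act_0: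
  assumes x: "x \<in> V 0"
  shows "real_norm 0 (conj_act 0 g x) = real_norm 0 x"
proof -
  have "bij (conj_index g)"
    using conj_index_star_conj_index[of g] conj_index_star_conj_index[of "star g"]
    by (intro o_bij[of "conj_index (star g)"]) (auto simp: fun_eq_iff star_star[OF inv])
  then show ?thesis
    using infsum_reindex_bij_betw[of "conj_index g" UNIV UNIV "\<lambda>w. \<bar>real_coords x w\<bar>"]
    by (simp add: real_norm.simps real_coords_conj_act[OF x])
qed

lemma real_norm_conj_act: "k \<le> L \<Longrightarrow> x \<in> V k \<Longrightarrow> real_norm k (conj_act k g x) = real_norm k x"
proof (induction k arbitrary: x g)
  case 0
  then show ?case by (simp add: real_norm_conj_act_0)
next
  case (Suc k)
  then have k: "k < L" "k \<le> L" "Suc k \<le> L" by auto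
  interpret complex_dual "V k" sm "real_norm k" "V (Suc k)" sm "real_norm (Suc k)" "pr k"
    by (rule complex_dual_level[OF k(1)])
  have real_norm_le: "real_norm (Suc k) (conj_act (Suc k) g \<phi>) \<le> real_norm (Suc k) \<phi>" if \<phi>: "\<phi> \<in> V (Suc k)" for g \<phi>
    using Re.pr_le[OF \<phi> conj_act_in[OF k(2)]] Suc.IH[OF k(2)]
    by (intro Re.norm_le[OF conj_act_in[OF k(3) \<phi>] Re.W.N_nonneg[OF \<phi>]]) (simp add: pr_conj_act[OF k(1) \<phi>])
  show ?case
    using real_norm_le[OF Suc.prems(2), of g] real_norm_le[OF conj_act_in[OF k(3) Suc.prems(2)], of "star g" g]
    by (simp add: conj_act_star_conj_act[OF k(3) Suc.prems(2)])
qed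

lemma approx_mean_0: "approx_mean (V 0) (real_norm 0) (conj_act 0)"
proof -
  interpret complex_space "V 0" sm "real_norm 0" by (rule complex_space_0)
  interpret l1_coordinates "V 0" "real_scale sm" "real_norm 0" real_coords "range rep \<times> UNIV"
    by unfold_locales (simp_all add: real_coords_add real_coords_supp real_coords_has_sum real_coords_surj)
  show ?thesis
    by (rule approx_mean_l1) (simp_all add: conj_act_in conj_act_add real_norm_conj_act real_coords_conj_act)
qed

lemma approx_mean_even: "2 * j \<le> L \<Longrightarrow> approx_mean (V (2 * j)) (real_norm (2 * j)) (conj_act (2 * j))"
proof (induction j)
  case 0
  show ?case using approx_mean_0 by simp
next
  case (Suc j)
  define k where "k = 2 * j"
  have k: "k < L" "Suc k < L" "k \<le> L" "Suc k \<le> L" "Suc (Suc k) \<le> L" using Suc.prems by (auto simp: k_def)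
  interpret C: complex_dual "V k" sm "real_norm k" "V (Suc k)" sm "real_norm (Suc k)" "pr k"
    by (rule complex_dual_level[OF k(1)])
  interpret C': complex_dual "V (Suc k)" sm "real_norm (Suc k)"
    "V (Suc (Suc k))" sm "real_norm (Suc (Suc k))" "pr (Suc k)"
    by (rule complex_dual_level[OF k(2)])
  interpret bidual_action "V k" "real_scale sm" "real_norm k" "V (Suc k)" "real_scale sm" "real_norm (Suc k)"
    "\<lambda>\<phi> x. Re (pr k \<phi> x)" "V (Suc (Suc k))" "real_scale sm" "real_norm (Suc (Suc k))" "\<lambda>\<phi> x. Re (pr (Suc k) \<phi> x)"
    "conj_act k" "\<lambda>g. conj_act (Suc k) (star g)" "conj_act (Suc (Suc k))"
    using k by unfold_locales (simp_all add: conj_act_in conj_act_add pr_conj_act star_star[OF inv])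
  show ?case using approx_mean_bidual Suc k(3) by (simp add: k_def)
qed

end

section \<open>Derivations\<close>

context quotient_tower
begin

context
  fixes D
  assumes D: "module_derivation q V pr nv L D"
begin

lemma derivation_in: "a \<in> l1 \<Longrightarrow> D a \<in> V L"
  and derivation_add: "a \<in> l1 \<Longrightarrow> b \<in> l1 \<Longrightarrow> D (a + b) = D a + D b"
  and derivation_conv: "a \<in> l1 \<Longrightarrow> b \<in> l1 \<Longrightarrow> D (conv a b) = act_l L a (D b) + act_r L (D a) b"
  using D by (simp_all add: module_derivation_def act_l_def act_r_def plus_fun_def)

lemma derivation_bounded: "\<exists>C. \<forall>a\<in>l1. real_norm L (D a) \<le> C * l1norm a"
proof -
  obtain C where C: "\<And>a. a \<in> l1 \<Longrightarrow> nv L (D a) \<le> C * l1norm a"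
    using D unfolding module_derivation_def by blast
  obtain K where K: "0 < K" "\<And>x. x \<in> V L \<Longrightarrow> real_norm L x \<le> K * nv L x"
    using equivalent_norms_level[of L] by (auto simp: equivalent_norms_def)
  have "real_norm L (D a) \<le> (K * C) * l1norm a" if a: "a \<in> l1" for a
    using order_trans[OF K(2)[OF derivation_in[OF a]] mult_left_mono[OF C[OF a], of K]] K(1)
    by (simp add: mult.assoc)
  then show ?thesis by blast
qed

lemma derivation_scale:
  assumes a: "a \<in> l1"
  shows "D (\<lambda>u. c * a u) = sm c (D a)"
proof -
  obtain e :: 's where e: "e \<in> idems" using star_idems(1)[OF inv] by blast
  let ?\<alpha> = "\<lambda>u. c * delta e u"
  have \<alpha>: "?\<alpha> \<in> l1E" using e l1.sm_in[OF delta_l1(1)] by (auto simp: l1E_def delta_def)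
  have "infsum (delta e) UNIV = 1"
    using fun_cong[OF push_delta[of "\<lambda>_. ()" e], of "()"] by (simp add: push_def delta_def)
  then have infsum_scale: "infsum ?\<alpha> UNIV = c" by (simp add: infsum_cmult_right')
  have "D (Eact_l ?\<alpha> a) = El q V pr L ?\<alpha> (D a)"
    using D \<alpha> a unfolding module_derivation_def by blast
  then show ?thesis using E_act[OF \<alpha> order_refl derivation_in[OF a]] by (simp add: Eact_l_def infsum_scale)
qed

definition cocycle :: "'s \<Rightarrow> 'v" where
  "cocycle g = act_r L (D (delta g)) (delta (star g))"

lemma cocycle_in: "cocycle g \<in> V L"
  by (simp add: cocycle_def act_r_in derivation_in delta_l1)

lemma conj_act_cocycle: "conj_act L g (cocycle t) + cocycle g = cocycle (g * t)"
proof -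
  define x y where "x = D (delta g)" and "y = D (delta t)"
  have x: "x \<in> V L" and y: "y \<in> V L" by (simp_all add: x_def y_def derivation_in delta_l1)
  have gy: "act_l L (delta g) y \<in> V L" and xt: "act_r L x (delta t) \<in> V L"
    by (simp_all add: act_l_in act_r_in delta_l1 x y)
  have "D (delta (g * t)) = act_l L (delta g) y + act_r L x (delta t)"
    using derivation_conv[OF delta_l1(1) delta_l1(1), of g t] by (simp add: conv_delta_delta x_def y_def)
  then have "cocycle (g * t) = act_r L (act_l L (delta g) y) (delta (star t * star g)) +
      act_r L (act_r L x (delta t)) (delta (star t * star g))"
    by (simp add: cocycle_def star_mult[OF inv] act_r_add delta_l1 gy xt)
  also have "act_r L (act_l L (delta g) y) (delta (star t * star g)) = conj_act L g (cocycle t)"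
    by (simp add: conj_act_def cocycle_def act_r_act_l[OF _ y, symmetric] act_r_act_r[OF _ gy] flip: y_def)
  also have "act_r L (act_r L x (delta t)) (delta (star t * star g)) =
      act_r L (act_r L x (delta (t * star t))) (delta (star g))"
    by (simp add: act_r_act_r[OF _ x] mult.assoc)
  also have "\<dots> = cocycle g"
    by (simp add: act_r_idem[OF _ x] star_idems[OF inv] cocycle_def flip: x_def)
  finally show ?thesis by simp
qed

lemma real_norm_cocycle_le: "\<exists>R. \<forall>g. real_norm L (cocycle g) \<le> R"
proof -
  obtain C where C: "\<And>a. a \<in> l1 \<Longrightarrow> real_norm L (D a) \<le> C * l1norm a" using derivation_bounded by blast
  have "real_norm L (cocycle g) \<le> 2 * C" for g
    using real_norm_act_r_le[OF order_refl delta_l1(1) derivation_in[OF delta_l1(1)], of g "star g"]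
      C[OF delta_l1(1), of g]
    by (simp add: cocycle_def delta_l1)
  then show ?thesis by blast
qed

lemma cocycle_fixed_point:
  assumes L: "L = 2 * n" "0 < n"
  shows "\<exists>y\<in>V L. \<forall>g. conj_act L g y + cocycle g = y"
proof -
  obtain j where j: "Suc j = L" using L by (cases L) auto
  interpret complex_dual "V j" sm "real_norm j" "V L" sm "real_norm L" "pr j"
    using complex_dual_level[of j] by (simp flip: j)
  obtain R where R: "\<And>g. real_norm L (cocycle g) \<le> R" using real_norm_cocycle_le by blast
  have pr: "Re (pr j (conj_act L g \<phi>) x) = Re (pr j \<phi> (conj_act j (star g) x))"
    if "\<phi> \<in> V L" "x \<in> V j" for g \<phi> x
    using pr_conj_act[of j \<phi> x g] that j by simp
  have "j \<le> L" using j by simp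
  moreover have "approx_mean (V L) (real_norm L) (conj_act L)" using approx_mean_even[of n] L by simp
  ultimately show ?thesis
    by (intro Re.affine_fixed_point[of "conj_act L" "\<lambda>g. conj_act j (star g)" cocycle R])
       (simp_all add: conj_act_in conj_act_add real_norm_conj_act pr cocycle_in conj_act_cocycle R)
qed

lemma derivation_delta:
  assumes y: "y \<in> V L" and fixed: "conj_act L g y + cocycle g = y"
  shows "D (delta g) = act_r L y (delta g) - act_l L (delta g) y"
proof -
  have Dg: "D (delta g) \<in> V L" by (rule derivation_in[OF delta_l1(1)])
  have gy: "act_l L (delta g) y \<in> V L" by (rule act_l_in[OF order_refl delta_l1(1) y])
  have "act_r L y (delta g) = act_r L (conj_act L g y) (delta g) + act_r L (cocycle g) (delta g)"
    by (subst fixed[symmetric]) (simp add: act_r_add conj_act_in y cocycle_in delta_l1)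
  also have "act_r L (conj_act L g y) (delta g) = act_l L (delta g) y"
    by (simp add: conj_act_def act_r_act_r[OF _ gy] act_r_idem[OF _ gy] star_idems[OF inv])
  also have "act_r L (cocycle g) (delta g) = D (delta g)"
    by (simp add: cocycle_def act_r_act_r[OF _ Dg] act_r_idem[OF _ Dg] star_idems[OF inv])
  finally show ?thesis by simp
qed

lemma derivation_scale_delta:
  assumes y: "y \<in> V L" and fixed: "conj_act L g y + cocycle g = y"
  shows "D (\<lambda>u. c * delta g u) = act_r L y (\<lambda>u. c * delta g u) - act_l L (\<lambda>u. c * delta g u) y"
  using complex_space.sm_diff_right[OF complex_space_level, OF order_refl act_r_in act_l_in]
    act_scale_algebra[OF delta_l1(1) order_refl y]
  by (simp add: derivation_scale derivation_delta[OF y fixed] delta_l1 y)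

lemma derivation_eq:
  assumes L: "0 < L" and y: "y \<in> V L" and fixed: "\<And>g. conj_act L g y + cocycle g = y" and f: "f \<in> l1"
  shows "D f = act_r L y f - act_l L f y"
proof -
  obtain j where j: "Suc j = L" using L by (cases L) auto
  interpret complex_dual "V j" sm "real_norm j" "V L" sm "real_norm L" "pr j"
    using complex_dual_level[of j] by (simp flip: j)
  define \<Delta> where "\<Delta> f = D f + act_l L f y - act_r L y f" for f
  have D_in: "D f \<in> V L" "act_l L f y \<in> V L" "act_r L y f \<in> V L" if "f \<in> l1" for f
    by (simp_all add: derivation_in act_l_in act_r_in that y)
  have \<Delta>_in: "\<Delta> f \<in> V L" if "f \<in> l1" for f
    unfolding \<Delta>_def by (intro Re.W.diff_in Re.W.add_in D_in that)
  obtain C where C: "\<And>a. a \<in> l1 \<Longrightarrow> real_norm L (D a) \<le> C * l1norm a" using derivation_bounded by blast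
  have "real_norm L (\<Delta> f) \<le> 0"
  proof (rule l1_additive_vanishes[OF f, where T = \<Delta> and N = "real_norm L" and C = "C + 4 * real_norm L y"])
    show "\<Delta> (f + g) = \<Delta> f + \<Delta> g" if "f \<in> l1" "g \<in> l1" for f g
      unfolding \<Delta>_def using act_add_algebra[OF that order_refl y] by (simp add: derivation_add that)
    show "\<Delta> (\<lambda>u. c * delta s u) = 0" for c s
      unfolding \<Delta>_def derivation_scale_delta[OF y fixed] by simp
    show "real_norm L (\<Delta> f) \<le> (C + 4 * real_norm L y) * l1norm f" if f: "f \<in> l1" for f
    proof -
      have "real_norm L (\<Delta> f) \<le> real_norm L (D f) + real_norm L (act_l L f y) + real_norm L (act_r L y f)"
        unfolding \<Delta>_def
        using Re.W.N_diff[OF Re.W.add_in[OF D_in(1,2)] D_in(3), OF f f f] Re.W.N_add[OF D_in(1,2), OF f f] by simp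
      then show ?thesis
        using C[OF f] real_norm_act_l_le[OF order_refl f y] real_norm_act_r_le[OF order_refl f y]
        by (simp add: algebra_simps)
    qed
  qed
  then have "\<Delta> f = 0" using Re.norm_eq_0D[OF \<Delta>_in[OF f]] Re.W.N_nonneg[OF \<Delta>_in[OF f]] by simp
  then show ?thesis by (simp add: \<Delta>_def algebra_simps)
qed

lemma derivation_inner:
  assumes L: "L = 2 * n" "0 < n"
  shows "inner_derivation q V pr L D"
proof -
  interpret complex_space "V L" sm "real_norm L" by (rule complex_space_level) simp
  obtain y where y: "y \<in> V L" and fixed: "\<And>g. conj_act L g y + cocycle g = y"
    using cocycle_fixed_point[OF L] by blast
  show ?thesis
    unfolding inner_derivation_def act_l_def[symmetric] act_r_def[symmetric]
  proof (intro bexI[of _ "- y"] ballI)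
    show "- y \<in> V L" by (rule minus_in[OF y])
    fix f :: "'s \<Rightarrow> complex" assume f: "f \<in> l1"
    have "act_l L f (- y) = - act_l L f y" "act_r L (- y) f = - act_r L y f"
      using act_l_sm[OF order_refl f y, of "- 1"] act_r_sm[OF order_refl f y, of "- 1"]
      by (simp_all add: sm_minus_one y act_l_in act_r_in f)
    then show "D f = act_l L f (- y) - act_r L (- y) f"
      using derivation_eq[OF _ y fixed f] L by simp
  qed
qed

end

end

theorem mainTheorem1:
  fixes n :: nat
    and q :: "('s::semigroup_mult \<Rightarrow> complex) \<Rightarrow> 'v::ab_group_add"
    and sm :: "complex \<Rightarrow> 'v \<Rightarrow> 'v"
    and V :: "nat \<Rightarrow> 'v set"
    and pr :: "nat \<Rightarrow> 'v \<Rightarrow> 'v \<Rightarrow> complex"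
    and nv :: "nat \<Rightarrow> 'v \<Rightarrow> real"
  assumes "inverse_semigroup TYPE('s)"
    and "n \<ge> 1"
    and "dual_tower (2 * n) q sm V pr nv"
  shows "weakly_module_amenable (2 * n) q V pr nv"
proof -
  interpret quotient_tower "2 * n" q sm V pr nv
    using assms by unfold_locales
  show ?thesis
    unfolding weakly_module_amenable_def
    using commutative[of "2 * n"] derivation_inner[of _ n] assms(2) by auto
qed

end
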